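(* The twin-star hypothesis $\mathcal{TS}(4)$ holds true: every cycle-free $4$-partition of $K_8$ is weakly equivalent to a cycle-free $4$-partition $(\Gamma_1,\Gamma_2,\Gamma_3,\Gamma_4)$ of $K_8$ such that at least one of the graphs $\Gamma_i$ is isomorphic to the twin-star graph $TS_4$.
   Context: All graphs are simple and undirected; $(i,j)$ and $(j,i)$ denote the same edge. $K_n$ is the complete graph on $\{1,\dots,n\}$. A $d$-partition of $K_n$ is an ordered tuple $(\Gamma_1,\dots,\Gamma_d)$ of subgraphs of $K_n$, each with vertex set $\{1,\dots,n\}$, whose edge sets are pairwise disjoint and have union $E(K_n)$. It is cycle-free if no $\Gamma_i$ contains a cycle. $\mathcal{P}_d^{cf}(K_{2d})$ is the set of cycle-free $d$-partitions of $K_{2d}$ (here $d=4$). Involutions: it is known that for every $\mathcal{P}\in\mathcal{P}_d^{cf}(K_{2d})$ and distinct vertices $x,y,z$ there is a unique $\mathcal{Q}\in\mathcal{P}_d^{cf}(K_{2d})$ such that $\mathcal{P}$ and $\mathcal{Q}$ coincide (assign the edge to the component of the same index) on every edge of $K_{2d}$ other than $(x,y),(x,z),(y,z)$, and differ on at least two of these three edges. This $\mathcal{Q}$ is denoted $\mathcal{P}^{(x,y,z)}$. Action of $S_{2d}\times S_d$: for $\sigma\in S_{2d}$, $\sigma\circ(\Gamma_1,\dots,\Gamma_d)=(\sigma\circ\Gamma_1,\dots,\sigma\circ\Gamma_d)$ where $E(\sigma\circ\Gamma)=\{(\sigma(i),\sigma(j)):(i,j)\in E(\Gamma)\}$; for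 $\tau\in S_d$, $\tau\odot(\Gamma_1,\dots,\Gamma_d)=(\Gamma_{\tau^{-1}(1)},\dots,\Gamma_{\tau^{-1}(d)})$. These actions commute, and $(\sigma,\tau)\cdot\mathcal{P}=\sigma\circ(\tau\odot\mathcal{P})$. Weak equivalence: $\mathcal{P},\mathcal{Q}\in\mathcal{P}_d^{cf}(K_{2d})$ are weakly equivalent if there are $n\ge 0$, $\mathcal{P}_0,\dots,\mathcal{P}_n\in\mathcal{P}_d^{cf}(K_{2d})$, $1\le x_i<y_i<z_i\le 2d$ and $(\sigma_i,\tau_i)\in S_{2d}\times S_d$ ($1\le i\le n$) with $\mathcal{P}_0=\mathcal{P}$, $\mathcal{P}_n=\mathcal{Q}$ and $(\sigma_i,\tau_i)\cdot(\mathcal{P}_i^{(x_i,y_i,z_i)})=\mathcal{P}_{i-1}$ for all $1\le i\le n$. The twin-star graph $TS_4$ is the tree on $\{1,\dots,8\}$ with edges $(1,2),(1,3),(1,5),(1,7),(2,4),(2,6),(2,8)$. *)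

theory Defs
  imports Main "HOL-Library.Ramsey" "HOL-Library.FuncSet" "HOL-Library.Disjoint_Sets"
    "HOL-Combinatorics.Permutations"
begin

text \<open>
  All graphs here are subgraphs of the complete graph on \<open>{1..n}\<close> with the full vertex set
  \<open>{1..n}\<close>, so a graph is given by its edge set, an edge being a two-element set of vertices.
\<close>

type_synonym edges = "nat set set"

definition complete_edges :: "nat \<Rightarrow> edges" where
  "complete_edges n = nsets {1..n} 2"

text \<open>The list \<open>vs\<close> is the sequence of vertices of the cycle; the index wraps around at the end.\<close>

definition has_cycle :: "edges \<Rightarrow> bool" where
  "has_cycle E \<longleftrightarrow>
    (\<exists>vs. 3 \<le> length vs \<and> distinct vs \<and>
      (\<forall>k < length vs. {vs ! k, vs ! (Suc k mod length vs)} \<in> E))"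

definition relabel :: "(nat \<Rightarrow> nat) \<Rightarrow> edges \<Rightarrow> edges" where
  "relabel \<sigma> E = (\<lambda>e. \<sigma> ` e) ` E"

definition isomorphic_graphs :: "nat \<Rightarrow> edges \<Rightarrow> edges \<Rightarrow> bool" where
  "isomorphic_graphs n E F \<longleftrightarrow> (\<exists>f. bij_betw f {1..n} {1..n} \<and> relabel f E = F)"

definition twin_star_4 :: edges where
  "twin_star_4 = {{1,2}, {1,3}, {1,5}, {1,7}, {2,4}, {2,6}, {2,8}}"

text \<open>
  A \<open>d\<close>-tuple of graphs is a function on \<open>{1..d}\<close>, made extensional so that equality of
  functions is equality of tuples.
\<close>

type_synonym edge_partition = "nat \<Rightarrow> edges"

definition d_partitions :: "nat \<Rightarrow> nat \<Rightarrow> edge_partition set" where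
  "d_partitions d n =
    {\<Gamma> \<in> extensional {1..d}.
      disjoint_family_on \<Gamma> {1..d} \<and> (\<Union>i\<in>{1..d}. \<Gamma> i) = complete_edges n}"

definition cf_partitions :: "nat \<Rightarrow> edge_partition set" where
  "cf_partitions d = {\<Gamma> \<in> d_partitions d (2 * d). \<forall>i\<in>{1..d}. \<not> has_cycle (\<Gamma> i)}"

definition coincide_on :: "nat \<Rightarrow> edge_partition \<Rightarrow> edge_partition \<Rightarrow> nat set \<Rightarrow> bool" where
  "coincide_on d P Q e \<longleftrightarrow> (\<forall>i\<in>{1..d}. e \<in> P i \<longleftrightarrow> e \<in> Q i)"

text \<open>
  The description determines a unique partition whenever \<open>P \<in> cf_partitions d\<close> and
  \<open>x\<close>, \<open>y\<close>, \<open>z\<close> are distinct vertices in \<open>{1..2 * d}\<close>.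
\<close>

definition involution :: "nat \<Rightarrow> edge_partition \<Rightarrow> nat \<Rightarrow> nat \<Rightarrow> nat \<Rightarrow> edge_partition" where
  "involution d P x y z = (THE Q. Q \<in> cf_partitions d \<and>
    (\<forall>e \<in> complete_edges (2 * d) - {{x,y}, {x,z}, {y,z}}. coincide_on d P Q e) \<and>
    2 \<le> card {e \<in> {{x,y}, {x,z}, {y,z}}. \<not> coincide_on d P Q e})"

definition vertex_act :: "nat \<Rightarrow> (nat \<Rightarrow> nat) \<Rightarrow> edge_partition \<Rightarrow> edge_partition" where
  "vertex_act d \<sigma> \<Gamma> = (\<lambda>i\<in>{1..d}. relabel \<sigma> (\<Gamma> i))"

definition index_act :: "nat \<Rightarrow> (nat \<Rightarrow> nat) \<Rightarrow> edge_partition \<Rightarrow> edge_partition" where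
  "index_act d \<tau> \<Gamma> = (\<lambda>i\<in>{1..d}. \<Gamma> (inv \<tau> i))"

definition act :: "nat \<Rightarrow> (nat \<Rightarrow> nat) \<times> (nat \<Rightarrow> nat) \<Rightarrow> edge_partition \<Rightarrow> edge_partition" where
  "act d g \<Gamma> = vertex_act d (fst g) (index_act d (snd g) \<Gamma>)"

definition weakly_equivalent :: "nat \<Rightarrow> edge_partition \<Rightarrow> edge_partition \<Rightarrow> bool" where
  "weakly_equivalent d P Q \<longleftrightarrow>
    (\<exists>(n::nat) (Ps :: nat \<Rightarrow> edge_partition) (x :: nat \<Rightarrow> nat) (y :: nat \<Rightarrow> nat) (z :: nat \<Rightarrow> nat)
        (\<sigma> :: nat \<Rightarrow> nat \<Rightarrow> nat) (\<tau> :: nat \<Rightarrow> nat \<Rightarrow> nat).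
      (\<forall>i\<in>{0..n}. Ps i \<in> cf_partitions d) \<and> Ps 0 = P \<and> Ps n = Q \<and>
      (\<forall>i\<in>{1..n}.
        1 \<le> x i \<and> x i < y i \<and> y i < z i \<and> z i \<le> 2 * d \<and>
        \<sigma> i permutes {1..2 * d} \<and> \<tau> i permutes {1..d} \<and>
        act d (\<sigma> i, \<tau> i) (involution d (Ps i) (x i) (y i) (z i)) = Ps (i - 1)))"

end

theory Submission
  imports Defs "HOL-Library.Transitive_Closure_Table"
begin

text \<open>
  A forest on \<open>2 * d\<close> vertices has at most \<open>2 * d - 1\<close> edges, so by counting edges all parts of a
  cycle-free partition are spanning trees. Deleting the three edges of a triangle from these trees,
  one sees from the way the remaining forests link the corners that the three edges admit exactly one
  other cycle-free colouring. Hence \<open>involution\<close> is well defined and, the description being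
  symmetric, an involution (a flip of the triangle).

  For \<open>d = 4\<close> one plays against an adversary: in a position only some edge colours are known;
  one may ask for the colour of an edge, use that every tree is acyclic and connected, or flip a
  triangle whose colours are known, where all outcomes that rearrange these colours must be
  considered. The winning strategy first produces a vertex of degree 4 in some tree. The three
  remaining edges of that tree form a forest on the other seven vertices, and further flips turn
  it into a star: this is the twin star. The details of the strategy come from a computer search;
  it is recorded as a certificate and verified by a checker that is proved sound.
\<close>

subsection \<open>Forests and spanning trees\<close>

text \<open>The outcome of a flip depends on how the forests link the corners outside the triangle,
  which the colours of a few edges do not determine. This is why positions are partial and every
  rearrangement of the three colours has to be answered. What keeps the game small is that a flip
  never brings a new colour onto the triangle, so there are at most five outcomes, and fewer when
  colours coincide. A second obstacle is circularity: flipping twice restores the partition, so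
  sequences of moves can run in circles. Positions are therefore settled one after the other,
  starting from the twin star, and a branch may end only in a position settled before, up to
  renaming vertices and colours, or in a contradiction with the tree property. The last position
  settled knows nothing at all and so is realized by every partition. On the side of graph theory,
  all questions about a triangle are reduced to which of its corners are linked off the triangle in
  each colour; hence forests are handled through reachability rather than through explicit
  cycles.\<close>

abbreviation linked :: "edges \<Rightarrow> nat \<Rightarrow> nat \<Rightarrow> bool" where
  "linked E \<equiv> (\<lambda>a b. {a, b} \<in> E)\<^sup>*\<^sup>*"

lemma linked_sym: "linked E a b \<Longrightarrow> linked E b a"
proof (induction rule: rtranclp_induct)
  case (step b c)
  then have "{c, b} \<in> E" by (simp add: insert_commute)
  then show ?case using step.IH by (rule converse_rtranclp_into_rtranclp)
qed simp

lemma linked_mono: "linked E a b \<Longrightarrow> E \<subseteq> F \<Longrightarrow> linked F a b"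
  by (rule rtranclp_mono[THEN predicate2D]) auto

text \<open>A walk may be assumed to cross the added edge at most once, in one direction or the
  other. This reduces reachability after adding an edge to reachability before it.\<close>

lemma linked_insertD:
  assumes "linked (insert {p, q} F) a b"
  shows "linked F a b \<or> linked F a p \<and> linked F q b \<or> linked F a q \<and> linked F p b"
  using assms
proof (induction rule: rtranclp_induct)
  case (step b c)
  show ?case
  proof (cases "{b, c} \<in> F")
    case True
    then have bc: "linked F b c" by blast
    have "linked F x b \<Longrightarrow> linked F x c" for x by (rule rtranclp_trans[OF _ bc])
    then show ?thesis using step.IH by blast
  next
    case False
    then have "b = p \<and> c = q \<or> b = q \<and> c = p"
      using step.hyps by (auto simp: doubleton_eq_iff)
    \<comment> \<open>If the walk so far has crossed the new edge and now crosses it back, it ends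
      where the part before the first crossing already led.\<close>
    then show ?thesis using step.IH by fastforce
  qed
qed simp

text \<open>The edge from the last vertex of the cycle back to the first serves: the rest of the
  cycle is a walk between its ends. In this form a cycle can be analysed one edge at a time.\<close>

lemma has_cycle_linked:
  assumes "has_cycle E"
  obtains u v where "u \<noteq> v" "{u, v} \<in> E" "linked (E - {{u, v}}) u v"
proof -
  from assms obtain vs where len: "3 \<le> length vs" and dist: "distinct vs"
    and e: "\<And>k. k < length vs \<Longrightarrow> {vs ! k, vs ! (Suc k mod length vs)} \<in> E"
    unfolding has_cycle_def by blast
  let ?n = "length vs" and ?u = "vs ! 0" and ?v = "vs ! (length vs - 1)"
  have n0: "0 < ?n" "0 \<noteq> ?n - 1" "?n - 1 < ?n" using len by auto
  then have uv: "?u \<noteq> ?v" using nth_eq_iff_index_eq[OF dist] by blast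
  have "linked (E - {{?u, ?v}}) ?u (vs ! k)" if "k < ?n" for k
    using that
  proof (induction k)
    case (Suc k)
    then have "{vs ! k, vs ! Suc k} \<in> E" using e[of k] by simp
    \<comment> \<open>Here it matters that a cycle has length at least 3: with two vertices the only
      step would be the closing edge itself.\<close>
    moreover have "{vs ! k, vs ! Suc k} \<noteq> {?u, ?v}"
      using Suc.prems len n0 by (auto simp: doubleton_eq_iff nth_eq_iff_index_eq[OF dist])
    ultimately show ?case using Suc by (auto intro: rtranclp.rtrancl_into_rtrancl)
  qed simp
  then have l: "linked (E - {{?u, ?v}}) ?u ?v" using n0 by simp
  have "Suc (?n - 1) mod ?n = 0" using n0 by simp
  then have "{?u, ?v} \<in> E" using e[OF n0(3)] by (simp add: insert_commute)
  then show thesis using that uv l by blast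
qed

text \<open>Converse of \<open>has_cycle_linked\<close>: cutting loops out of the walk leaves a path
  with distinct vertices, which the edge \<open>{u, v}\<close> closes.\<close>

lemma linked_has_cycle:
  assumes "u \<noteq> v" "{u, v} \<in> E" "linked (E - {{u, v}}) u v"
  shows "has_cycle E"
proof -
  let ?r = "\<lambda>a b. {a, b} \<in> E - {{u, v}}"
  obtain xs where "rtrancl_path ?r u xs v"
    using assms(3) rtranclp_eq_rtrancl_path[of ?r u v] by auto
  then obtain xs where p: "rtrancl_path ?r u xs v" and d: "distinct (u # xs)"
    by (rule rtrancl_path_distinct)
  have ne: "xs \<noteq> []" using p assms(1) by (auto elim: rtrancl_path.cases)
  have la: "last xs = v" using rtrancl_path_last[OF p ne] .
  have st: "{(u # xs) ! i, xs ! i} \<in> E - {{u, v}}" if "i < length xs" for i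
    using rtrancl_path_nth[OF p that] .
  \<comment> \<open>A path of a single step would be the deleted edge, so at least three vertices
    occur.\<close>
  have "length xs \<noteq> 1"
  proof
    assume "length xs = 1"
    then have "xs = [v]" using la by (cases xs) auto
    then show False using st[of 0] by simp
  qed
  then have len: "3 \<le> length (u # xs)" using ne by (cases xs; cases "tl xs") auto
  have "{(u # xs) ! k, (u # xs) ! (Suc k mod length (u # xs))} \<in> E" if k: "k < length (u # xs)" for k
  proof (cases "k < length xs")
    case True
    then show ?thesis using st[of k] by simp
  next
    case False
    then have "k = length xs" using k by simp
    then have "(u # xs) ! k = v" using la ne by (simp add: last_conv_nth nth_Cons')
    then show ?thesis using \<open>k = length xs\<close> assms(2) by (simp add: insert_commute)
  qed
  then show ?thesis unfolding has_cycle_def using len d by blast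
qed

lemma has_cycle_mono: "has_cycle E \<Longrightarrow> E \<subseteq> F \<Longrightarrow> has_cycle F"
  unfolding has_cycle_def by blast

text \<open>The edge found on a cycle need not be the new one. If it is an old edge
  \<open>{u, v}\<close>, then its ends are not linked in \<open>E\<close> without it, so the way
  around passes through \<open>{p, q}\<close>; the two arms of that detour together with
  \<open>{u, v}\<close> link \<open>p\<close> and \<open>q\<close> inside \<open>E\<close>.\<close>

lemma has_cycle_insert_iff:
  assumes "\<not> has_cycle E" "p \<noteq> q" "{p, q} \<notin> E"
  shows "has_cycle (insert {p, q} E) \<longleftrightarrow> linked E p q"
proof
  assume "linked E p q"
  then show "has_cycle (insert {p, q} E)"
    using assms linked_has_cycle[of p q "insert {p, q} E"] by simp
next
  assume "has_cycle (insert {p, q} E)"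
  then obtain u v where uv: "u \<noteq> v" "{u, v} \<in> insert {p, q} E"
    and l: "linked (insert {p, q} E - {{u, v}}) u v"
    by (rule has_cycle_linked)
  show "linked E p q"
  proof (cases "{u, v} = {p, q}")
    case True
    then have "linked E u v" using l assms(3) by (simp add: insert_Diff_if)
    then show ?thesis using True linked_sym by (auto simp: doubleton_eq_iff)
  next
    case False
    let ?F = "E - {{u, v}}"
    have e: "{u, v} \<in> E" using uv False by simp
    have "linked (insert {p, q} ?F) u v" using l False by (simp add: insert_Diff_if)
    moreover have "\<not> linked ?F u v" using assms(1) linked_has_cycle[OF uv(1) e] by blast
    ultimately have "linked ?F u p \<and> linked ?F q v \<or> linked ?F u q \<and> linked ?F p v"
      using linked_insertD[of p q ?F u v] by simp
    then have "linked E u p \<and> linked E q v \<or> linked E u q \<and> linked E p v"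
      using linked_mono[of ?F _ _ E] by blast
    moreover have "linked E u v" using e by blast
    ultimately show ?thesis using linked_sym[of E] by (meson rtranclp_trans)
  qed
qed

section \<open>Edge counts and cuts in forests\<close>

lemma finite_nsets2: "finite V \<Longrightarrow> E \<subseteq> nsets V 2 \<Longrightarrow> finite (E :: 'a set set)"
  using finite_subset finite_imp_finite_nsets by blast

text \<open>Deleting an edge \<open>{u, v}\<close> of a forest separates \<open>u\<close> from
  \<open>v\<close>. All other edges stay inside the component \<open>A\<close> of \<open>u\<close>
  or inside its complement; both sides are nonempty and smaller, so the induction hypothesis applies
  to each.\<close>

lemma card_forest:
  assumes "finite V" "V \<noteq> {}" "E \<subseteq> nsets V 2" "\<not> has_cycle E"
  shows "card E < card V"
  using assms
proof (induction "card V" arbitrary: V E rule: less_induct)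
  case less
  show ?case
  proof (cases "E = {}")
    case True
    then show ?thesis using less.prems by (simp add: card_gt_0_iff)
  next
    case False
    then obtain u v where e: "{u, v} \<in> E" and uv: "u \<in> V" "v \<in> V" "u \<noteq> v"
      using less.prems(3) by (fastforce simp: nsets_def card_2_iff)
    let ?F = "E - {{u, v}}"
    define A where "A = {w \<in> V. linked ?F u w}"
    have uA: "u \<in> A" and AV: "A \<subseteq> V" using uv by (auto simp: A_def)
    have vA: "v \<notin> A" using less.prems(4) linked_has_cycle[OF uv(3) e] by (auto simp: A_def)
    have fE: "finite E" using less.prems finite_nsets2 by blast
    have acyc: "\<not> has_cycle (?F \<inter> nsets W 2)" for W
      using less.prems(4) has_cycle_mono by blast
    have finA: "finite A" using AV less.prems(1) finite_subset by blast
    have ltA: "card A < card V" using AV uv vA less.prems(1) by (metis psubsetI psubset_card_mono)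
    have ltB: "card (V - A) < card V"
      using uA AV less.prems(1) by (metis DiffD2 Diff_subset psubsetI psubset_card_mono subsetD)
    have split: "?F \<subseteq> (?F \<inter> nsets A 2) \<union> (?F \<inter> nsets (V - A) 2)"
    proof
      fix f assume f: "f \<in> ?F"
      then obtain a b where ab: "f = {a, b}" "a \<noteq> b" "a \<in> V" "b \<in> V"
        using less.prems(3) by (metis DiffD1 nsets2_E subsetD)
      have "linked ?F a b" "linked ?F b a"
        using f ab by (auto simp: insert_commute)
      then have "a \<in> A \<longleftrightarrow> b \<in> A" using ab unfolding A_def by (auto intro: rtranclp_trans)
      then show "f \<in> (?F \<inter> nsets A 2) \<union> (?F \<inter> nsets (V - A) 2)"
        using f ab by (auto simp: nsets_def)
    qed
    \<comment> \<open>Each of the two sides has at least one edge fewer than vertices, and the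
      deleted edge gives back only one.\<close>
    have "card ?F \<le> card (?F \<inter> nsets A 2) + card (?F \<inter> nsets (V - A) 2)"
      using card_mono[OF _ split] fE card_Un_le[of "?F \<inter> nsets A 2" "?F \<inter> nsets (V - A) 2"]
      by (meson finite_Diff finite_Int finite_UnI le_trans)
    moreover have "card (?F \<inter> nsets A 2) < card A"
      using less.hyps[OF ltA finA _ _ acyc] uA by blast
    moreover have "card (?F \<inter> nsets (V - A) 2) < card (V - A)"
      using less.hyps[OF ltB _ _ _ acyc] less.prems(1) uv vA by blast
    moreover have "card A + card (V - A) = card V"
      using AV finA less.prems(1) by (simp add: card_Diff_subset card_mono)
    moreover have "card E = Suc (card ?F)" using card.remove[OF fE e] by simp
    ultimately show ?thesis by linarith
  qed
qed

text \<open>If no edge left \<open>S\<close>, then \<open>E\<close> would consist of a forest on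
  \<open>S\<close> and one on the complement and have at most \<open>card V - 2\<close> edges. This
  cut form of connectedness is the one that the rule \<open>Cut\<close> of the certificates
  uses.\<close>

lemma forest_crossing_edge:
  assumes "finite V" "E \<subseteq> nsets V 2" "\<not> has_cycle E" "Suc (card E) = card V"
    and "S \<subseteq> V" "S \<noteq> {}" "S \<noteq> V"
  shows "\<exists>u\<in>S. \<exists>v\<in>V - S. {u, v} \<in> E"
proof (rule ccontr)
  assume no: "\<not> ?thesis"
  have "E \<subseteq> (E \<inter> nsets S 2) \<union> (E \<inter> nsets (V - S) 2)"
  proof
    fix e assume e: "e \<in> E"
    then obtain a b where "e = {a, b}" "a \<noteq> b" "a \<in> V" "b \<in> V"
      using assms(2) by (metis nsets2_E subsetD)
    moreover from this have "a \<in> S \<longleftrightarrow> b \<in> S" using no e by (metis DiffI insert_commute)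
    ultimately show "e \<in> (E \<inter> nsets S 2) \<union> (E \<inter> nsets (V - S) 2)"
      using e by (auto simp: nsets_def)
  qed
  then have "card E \<le> card ((E \<inter> nsets S 2) \<union> (E \<inter> nsets (V - S) 2))"
    using assms finite_nsets2[of V E] by (intro card_mono) auto
  also have "\<dots> \<le> card (E \<inter> nsets S 2) + card (E \<inter> nsets (V - S) 2)" by (rule card_Un_le)
  finally have "card E \<le> card (E \<inter> nsets S 2) + card (E \<inter> nsets (V - S) 2)" .
  moreover have "card (E \<inter> nsets S 2) < card S"
    using assms has_cycle_mono[of "E \<inter> nsets S 2" E] finite_subset[of S V]
    by (intro card_forest) auto
  moreover have "card (E \<inter> nsets (V - S) 2) < card (V - S)"
    using assms has_cycle_mono[of "E \<inter> nsets (V - S) 2" E] by (intro card_forest) auto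
  moreover have "card S + card (V - S) = card V"
    using assms by (metis card_Diff_subset card_mono finite_subset le_add_diff_inverse)
  ultimately show False using assms(4) by linarith
qed

lemma forest_linked:
  assumes "finite V" "E \<subseteq> nsets V 2" "\<not> has_cycle E" "Suc (card E) = card V" "u \<in> V" "v \<in> V"
  shows "linked E u v"
proof (rule ccontr)
  assume "\<not> linked E u v"
  then have "\<exists>a\<in>{w \<in> V. linked E u w}. \<exists>b\<in>V - {w \<in> V. linked E u w}. {a, b} \<in> E"
    using assms by (intro forest_crossing_edge) auto
  then show False by (auto intro: rtranclp.rtrancl_into_rtrancl)
qed

section \<open>The parts of a cycle-free partition as spanning trees\<close>

lemma cf_partitionsD:
  assumes "P \<in> cf_partitions d"
  shows "P \<in> extensional {1..d}" "disjoint_family_on P {1..d}"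
    "(\<Union>i\<in>{1..d}. P i) = nsets {1..2 * d} 2"
    "\<And>c. c \<in> {1..d} \<Longrightarrow> \<not> has_cycle (P c)"
    "\<And>c. c \<in> {1..d} \<Longrightarrow> P c \<subseteq> nsets {1..2 * d} 2"
  using assms by (auto simp: cf_partitions_def d_partitions_def complete_edges_def)

lemma cf_partition_colour_unique:
  assumes "P \<in> cf_partitions d" "c \<in> {1..d}" "c' \<in> {1..d}" "e \<in> P c" "e \<in> P c'"
  shows "c = c'"
  using cf_partitionsD(2)[OF assms(1)] assms(2-5) unfolding disjoint_family_on_def by blast

lemma cf_partition_colour_ex:
  assumes "P \<in> cf_partitions d" "u \<in> {1..2 * d}" "v \<in> {1..2 * d}" "u \<noteq> v"
  shows "\<exists>c\<in>{1..d}. {u, v} \<in> P c"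
proof -
  have "{u, v} \<in> nsets {1..2 * d} 2" using assms by (simp add: nsets_def)
  then show ?thesis using cf_partitionsD(3)[OF assms(1)] by blast
qed

text \<open>There are \<open>d * (2 * d - 1)\<close> edges to distribute and each of the
  \<open>d\<close> forests takes at most \<open>2 * d - 1\<close>, so a single deficient part would
  spoil the total. This is where the number \<open>2 * d\<close> of vertices enters.\<close>

lemma cf_partition_card:
  assumes P: "P \<in> cf_partitions d" and c: "c \<in> {1..d}"
  shows "Suc (card (P c)) = card {1..2 * d}"
proof -
  let ?V = "{1..2 * d}"
  have fin: "finite (P i)" if "i \<in> {1..d}" for i
    using cf_partitionsD(5)[OF P that] finite_nsets2 by blast
  have lt: "card (P i) < 2 * d" if "i \<in> {1..d}" for i
    using card_forest[of ?V "P i"] cf_partitionsD(4,5)[OF P that] that by simp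
  have "(\<Sum>i\<in>{1..d}. card (P i)) = card (nsets ?V 2)"
    using cf_partitionsD(2,3)[OF P] fin
    by (subst card_UN_disjoint'[symmetric]) (auto simp: disjoint_family_on_def)
  also have "\<dots> = 2 * d * (2 * d - 1) div 2" by (simp add: choose_two)
  also have "\<dots> = (\<Sum>i\<in>{1..d}. 2 * d - 1)" by simp
  finally have sum: "(\<Sum>i\<in>{1..d}. card (P i)) = (\<Sum>i\<in>{1..d}. 2 * d - 1)" .
  have "card (P c) = 2 * d - 1"
  proof (rule ccontr)
    assume "card (P c) \<noteq> 2 * d - 1"
    then have "card (P c) < 2 * d - 1" using lt[OF c] by simp
    moreover have "\<And>i. i \<in> {1..d} \<Longrightarrow> card (P i) \<le> 2 * d - 1" using lt by fastforce
    ultimately have "(\<Sum>i\<in>{1..d}. card (P i)) < (\<Sum>i\<in>{1..d}. 2 * d - 1)"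
      using c by (intro sum_strict_mono_ex1) auto
    then show False using sum by simp
  qed
  then show ?thesis using c by simp
qed

lemma cf_partition_crossing_edge:
  assumes "P \<in> cf_partitions d" "c \<in> {1..d}" "S \<subseteq> {1..2 * d}" "S \<noteq> {}" "S \<noteq> {1..2 * d}"
  shows "\<exists>u\<in>S. \<exists>v\<in>{1..2 * d} - S. {u, v} \<in> P c"
  using assms cf_partitionsD(4,5)[OF assms(1,2)] cf_partition_card[OF assms(1,2)]
  by (intro forest_crossing_edge) auto

lemma cf_partition_linked:
  assumes "P \<in> cf_partitions d" "c \<in> {1..d}" "u \<in> {1..2 * d}" "v \<in> {1..2 * d}"
  shows "linked (P c) u v"
  using assms cf_partitionsD(4,5)[OF assms(1,2)] cf_partition_card[OF assms(1,2)]
  by (intro forest_linked) auto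

section \<open>Triangles and the colours of their edges\<close>

definition triangle_edges :: "nat \<Rightarrow> nat \<Rightarrow> nat \<Rightarrow> edges" where
  "triangle_edges x y z = {{x, y}, {x, z}, {y, z}}"

text \<open>The triple \<open>t\<close> lists the colours of \<open>{x, y}\<close>,
  \<open>{x, z}\<close>, \<open>{y, z}\<close> in this order, and so do all later colour
  triples.\<close>

definition triangle_part :: "nat \<Rightarrow> nat \<Rightarrow> nat \<Rightarrow> nat \<times> nat \<times> nat \<Rightarrow> nat \<Rightarrow> edges" where
  "triangle_part x y z t c = (case t of (i, j, k) \<Rightarrow>
    {e. e = {x, y} \<and> i = c \<or> e = {x, z} \<and> j = c \<or> e = {y, z} \<and> k = c})"

text \<open>A cycle through edges of the triangle meets \<open>B\<close> only in walks between
  corners, so the links among the three corners decide. One added edge closes a cycle if its own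
  ends are linked, two added edges if any two corners are linked, and all three edges are a cycle by
  themselves.\<close>

lemma has_cycle_triangle_part_iff:
  assumes B: "\<not> has_cycle B" "B \<inter> triangle_edges x y z = {}" and d: "x \<noteq> y" "x \<noteq> z" "y \<noteq> z"
  shows "has_cycle (B \<union> triangle_part x y z (i, j, k) c) \<longleftrightarrow>
    i = c \<and> j = c \<and> k = c \<or> i = c \<and> linked B x y \<or> j = c \<and> linked B x z \<or> k = c \<and> linked B y z \<or>
    i = c \<and> j = c \<and> linked B y z \<or> i = c \<and> k = c \<and> linked B x z \<or> j = c \<and> k = c \<and> linked B x y"
proof -
  have e: "{x, y} \<notin> B" "{x, z} \<notin> B" "{y, z} \<notin> B" using B(2) by (auto simp: triangle_edges_def)
  have two: "has_cycle (insert {q, r} (insert {p, q} B)) \<longleftrightarrow> linked B p q \<or> linked B q r \<or> linked B p r"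
    if "p \<noteq> q" "q \<noteq> r" "p \<noteq> r" "{p, q} \<notin> B" "{q, r} \<notin> B" for p q r
  proof (cases "linked B p q")
    case True
    then have "has_cycle (insert {p, q} B)" using has_cycle_insert_iff[OF B(1) that(1,4)] by simp
    then show ?thesis using True has_cycle_mono by blast
  next
    case False
    then have nc: "\<not> has_cycle (insert {p, q} B)" using has_cycle_insert_iff[OF B(1) that(1,4)] by simp
    have "{q, r} \<notin> insert {p, q} B" using that by (auto simp: doubleton_eq_iff)
    then have "has_cycle (insert {q, r} (insert {p, q} B)) \<longleftrightarrow> linked (insert {p, q} B) q r"
      using has_cycle_insert_iff[OF nc that(2)] by simp
    also have "\<dots> \<longleftrightarrow> linked B q r \<or> linked B p r"
    proof
      assume "linked (insert {p, q} B) q r"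
      then show "linked B q r \<or> linked B p r" using linked_insertD by blast
    next
      assume "linked B q r \<or> linked B p r"
      then have "linked (insert {p, q} B) q r \<or> linked (insert {p, q} B) p r"
        using linked_mono[OF _ subset_insertI] by blast
      moreover have "linked (insert {p, q} B) q p" by (simp add: insert_commute r_into_rtranclp)
      ultimately show "linked (insert {p, q} B) q r" by (meson rtranclp_trans)
    qed
    finally show ?thesis using False by blast
  qed
  have tri: "has_cycle (insert {y, z} (insert {x, z} (insert {x, y} B)))"
  proof -
    let ?E = "insert {y, z} (insert {x, z} (insert {x, y} B))"
    have "{x, z} \<in> ?E - {{x, y}}" "{z, y} \<in> ?E - {{x, y}}" using d by (auto simp: doubleton_eq_iff)
    then have "linked (?E - {{x, y}}) x y"
      by (meson r_into_rtranclp rtranclp.rtrancl_into_rtrancl)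
    then show ?thesis using linked_has_cycle[of x y ?E] d by blast
  qed
  have eq: "B \<union> triangle_part x y z (i, j, k) c =
     (if i = c then {{x, y}} else {}) \<union> (if j = c then {{x, z}} else {}) \<union> (if k = c then {{y, z}} else {}) \<union> B"
    by (auto simp: triangle_part_def)
  note one = has_cycle_insert_iff[OF B(1)]
  note sym = linked_sym[of B]
  \<comment> \<open>The three instances of \<open>two\<close> have the common corner of the two
    added edges in the middle: \<open>x\<close>, then \<open>y\<close>, then \<open>z\<close>. The
    right-hand side is the same each time, since the two edges join all three corners.\<close>
  have xyz: "has_cycle (insert {x, z} (insert {x, y} B)) \<longleftrightarrow> linked B x y \<or> linked B x z \<or> linked B y z"
    using two[of z x y] d e sym[of z x] sym[of x z] sym[of z y] sym[of y z] by (simp add: insert_commute) blast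
  have yxz: "has_cycle (insert {y, z} (insert {x, y} B)) \<longleftrightarrow> linked B x y \<or> linked B x z \<or> linked B y z"
    using two[of z y x] d e sym[of z y] sym[of y z] sym[of x y] sym[of y x] sym[of z x] sym[of x z] by (simp add: insert_commute) blast
  have zxy: "has_cycle (insert {y, z} (insert {x, z} B)) \<longleftrightarrow> linked B x y \<or> linked B x z \<or> linked B y z"
    using two[of y z x] d e sym[of x y] sym[of y x] sym[of x z] sym[of z x] by (simp add: insert_commute) blast
  show ?thesis
    unfolding eq using B(1) e d tri xyz yxz zxy one[of x y] one[of x z] one[of y z] sym[of x y] sym[of x z] sym[of y z]
    by (cases "i = c"; cases "j = c"; cases "k = c") (simp_all, blast+)
qed

text \<open>The restriction to \<open>{1..d}\<close> keeps the result extensional, as equality with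
  members of \<open>cf_partitions\<close> requires.\<close>

definition recolour :: "nat \<Rightarrow> nat \<Rightarrow> nat \<Rightarrow> nat \<Rightarrow> nat \<times> nat \<times> nat \<Rightarrow> edge_partition \<Rightarrow> edge_partition" where
  "recolour d x y z t P = (\<lambda>c\<in>{1..d}. (P c - triangle_edges x y z) \<union> triangle_part x y z t c)"

subsection \<open>Flipping a triangle\<close>

lemma triangle_part_subset: "triangle_part x y z t c \<subseteq> triangle_edges x y z"
  by (auto simp: triangle_part_def triangle_edges_def split: prod.splits)

lemma triangle_distinct_edges:
  assumes "x \<noteq> y" "x \<noteq> z" "y \<noteq> (z::nat)"
  shows "{x, y} \<noteq> {x, z}" "{x, y} \<noteq> {y, z}" "{x, z} \<noteq> {y, z}"
  using assms by (auto simp: doubleton_eq_iff)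

lemma triangle_subset:
  assumes "x \<noteq> y" "x \<noteq> z" "y \<noteq> z" "{x, y, z} \<subseteq> V"
  shows "triangle_edges x y z \<subseteq> nsets V 2"
  using assms by (auto simp: triangle_edges_def nsets_def)

lemma mem_triangle_part:
  assumes "x \<noteq> y" "x \<noteq> z" "y \<noteq> (z::nat)"
  shows "{x, y} \<in> triangle_part x y z (i, j, k) c \<longleftrightarrow> i = c"
    "{x, z} \<in> triangle_part x y z (i, j, k) c \<longleftrightarrow> j = c"
    "{y, z} \<in> triangle_part x y z (i, j, k) c \<longleftrightarrow> k = c"
  using assms by (simp_all add: triangle_part_def doubleton_eq_iff)

text \<open>Off the triangle nothing changes and on it each edge has exactly one colour. Through
  this lemma, the search for flips becomes a search for colour triples.\<close>

lemma recolour_eqI: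
  assumes P: "P \<in> cf_partitions d" and Q: "Q \<in> cf_partitions d"
    and xyz: "x \<noteq> y" "x \<noteq> z" "y \<noteq> z"
    and co: "\<forall>e \<in> complete_edges (2 * d) - triangle_edges x y z. coincide_on d P Q e"
    and ijk: "i \<in> {1..d}" "j \<in> {1..d}" "k \<in> {1..d}"
    and e: "{x, y} \<in> Q i" "{x, z} \<in> Q j" "{y, z} \<in> Q k"
  shows "recolour d x y z (i, j, k) P = Q"
proof (rule extensionalityI[of _ "{1..d}"])
  show "recolour d x y z (i, j, k) P \<in> extensional {1..d}" by (simp add: recolour_def)
  show "Q \<in> extensional {1..d}" using cf_partitionsD(1)[OF Q] .
  fix c assume c: "c \<in> {1..d}"
  have "f \<in> (P c - triangle_edges x y z) \<union> triangle_part x y z (i, j, k) c \<longleftrightarrow> f \<in> Q c" for f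
  proof (cases "f \<in> triangle_edges x y z")
    case True
    have "f \<in> Q c \<longleftrightarrow> f \<in> triangle_part x y z (i, j, k) c"
    proof -
      have "{x, y} \<in> Q c \<longleftrightarrow> i = c" using cf_partition_colour_unique[OF Q ijk(1) c e(1)] e(1) by blast
      moreover have "{x, z} \<in> Q c \<longleftrightarrow> j = c"
        using cf_partition_colour_unique[OF Q ijk(2) c e(2)] e(2) by blast
      moreover have "{y, z} \<in> Q c \<longleftrightarrow> k = c"
        using cf_partition_colour_unique[OF Q ijk(3) c e(3)] e(3) by blast
      moreover have "f = {x, y} \<or> f = {x, z} \<or> f = {y, z}" using True by (simp add: triangle_edges_def)
      ultimately show ?thesis using mem_triangle_part[OF xyz] by (elim disjE) simp_all
    qed
    then show ?thesis using True by blast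
  next
    case False
    then have "f \<notin> triangle_part x y z (i, j, k) c" using triangle_part_subset by blast
    moreover have "f \<in> P c \<longleftrightarrow> f \<in> Q c"
      using co False c cf_partitionsD(5)[OF P c] cf_partitionsD(5)[OF Q c]
      unfolding coincide_on_def complete_edges_def by blast
    ultimately show ?thesis using False by blast
  qed
  then show "recolour d x y z (i, j, k) P c = Q c" using c unfolding recolour_def by auto
qed

lemma recolour_self:
  assumes "P \<in> cf_partitions d" "x \<noteq> y" "x \<noteq> z" "y \<noteq> z"
    "i \<in> {1..d}" "j \<in> {1..d}" "k \<in> {1..d}" "{x, y} \<in> P i" "{x, z} \<in> P j" "{y, z} \<in> P k"
  shows "recolour d x y z (i, j, k) P = P"
  using assms by (intro recolour_eqI) (auto simp: coincide_on_def)

text \<open>Each edge of the triangle receives exactly one colour, so disjointness and covering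
  survive any recolouring, and only acyclicity is left to test.\<close>

lemma recolour_cf_iff:
  assumes P: "P \<in> cf_partitions d"
    and xyz: "x \<noteq> y" "x \<noteq> z" "y \<noteq> z" "{x, y, z} \<subseteq> {1..2 * d}"
    and ijk: "i \<in> {1..d}" "j \<in> {1..d}" "k \<in> {1..d}"
  shows "recolour d x y z (i, j, k) P \<in> cf_partitions d \<longleftrightarrow>
    (\<forall>c\<in>{1..d}. \<not> has_cycle ((P c - triangle_edges x y z) \<union> triangle_part x y z (i, j, k) c))"
proof -
  let ?R = "recolour d x y z (i, j, k) P" and ?T = "triangle_edges x y z"
  have R: "?R c = (P c - ?T) \<union> triangle_part x y z (i, j, k) c" if "c \<in> {1..d}" for c
    using that by (simp add: recolour_def)
  have "disjoint_family_on ?R {1..d}"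
  proof -
    have "f \<notin> ?R c'" if "c \<in> {1..d}" "c' \<in> {1..d}" "c \<noteq> c'" "f \<in> ?R c" for c c' f
    proof (cases "f \<in> ?T")
      case True
      then have "f = {x, y} \<or> f = {x, z} \<or> f = {y, z}" by (simp add: triangle_edges_def)
      moreover have "f \<in> triangle_part x y z (i, j, k) c" using True that R[of c] by simp
      ultimately have "f \<notin> triangle_part x y z (i, j, k) c'"
        using mem_triangle_part[OF xyz(1-3)] that(3) by (elim disjE) simp_all
      then show ?thesis using True R[OF that(2)] by simp
    next
      case False
      then show ?thesis
        using that R[of c] R[of c'] triangle_part_subset cf_partition_colour_unique[OF P that(1,2)]
        by blast
    qed
    then show ?thesis unfolding disjoint_family_on_def by blast
  qed
  moreover have "(\<Union>c\<in>{1..d}. ?R c) = complete_edges (2 * d)"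
  proof -
    have "(\<Union>c\<in>{1..d}. ?R c) = (\<Union>c\<in>{1..d}. P c - ?T) \<union> (\<Union>c\<in>{1..d}. triangle_part x y z (i, j, k) c)"
      using R by auto
    also have "(\<Union>c\<in>{1..d}. triangle_part x y z (i, j, k) c) = ?T"
      using ijk by (auto simp: triangle_part_def triangle_edges_def)
    also have "(\<Union>c\<in>{1..d}. P c - ?T) = nsets {1..2 * d} 2 - ?T"
      using cf_partitionsD(3)[OF P] by blast
    finally show ?thesis
      using triangle_subset[OF xyz] by (auto simp: complete_edges_def)
  qed
  moreover have "?R \<in> extensional {1..d}" by (simp add: recolour_def)
  ultimately show ?thesis using R by (simp add: cf_partitions_def d_partitions_def)
qed

text \<open>The five permutations of the positions other than the identity. When colours coincide,
  the list has repetitions and may contain the original triple, which is why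
  \<open>t \<noteq> (i, j, k)\<close> is always demanded separately.\<close>

fun rearrangements :: "'a \<times> 'a \<times> 'a \<Rightarrow> ('a \<times> 'a \<times> 'a) list" where
  "rearrangements (i, j, k) = [(i, k, j), (j, i, k), (j, k, i), (k, i, j), (k, j, i)]"

text \<open>For a fixed colour \<open>c\<close>, the truth values \<open>X c\<close>, \<open>Y c\<close>, \<open>Z c\<close> say which of the pairs
  \<open>xy\<close>, \<open>xz\<close>, \<open>yz\<close> are linked in colour \<open>c\<close> off the triangle.\<close>

definition closes_cycle ::
  "('c \<Rightarrow> bool) \<Rightarrow> ('c \<Rightarrow> bool) \<Rightarrow> ('c \<Rightarrow> bool) \<Rightarrow> 'c \<times> 'c \<times> 'c \<Rightarrow> 'c \<Rightarrow> bool" where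
  "closes_cycle X Y Z t c = (case t of (i, j, k) \<Rightarrow>
    i = c \<and> j = c \<and> k = c \<or> i = c \<and> X c \<or> j = c \<and> Y c \<or> k = c \<and> Z c \<or>
    i = c \<and> j = c \<and> Z c \<or> i = c \<and> k = c \<and> Y c \<or> j = c \<and> k = c \<and> X c)"

text \<open>Colours absent from the triple link all corners, so only \<open>i\<close>,
  \<open>j\<close>, \<open>k\<close> can be used again. If these are distinct, each links exactly
  one pair of corners, and not the pair that it holds. Used twice, such a colour would close a
  cycle, so the new triple is a permutation keeping every colour off the pair that it links. Thus
  each colour has its own place and one other. Sending a colour to the owner of its other place is a
  map on three elements without fixed points; such a map has exactly one cyclic orbit, and moving
  the colours along this orbit is the one alternative. If two colours coincide, the repeated one
  links nothing, and the single one has exactly one other place.\<close>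

lemma unique_rearrangement:
  fixes X Y Z :: "'c \<Rightarrow> bool" and i j k :: 'c
  assumes ijk: "i \<in> D" "j \<in> D" "k \<in> D"
    and trans: "\<And>c. X c \<Longrightarrow> Y c \<Longrightarrow> Z c" "\<And>c. X c \<Longrightarrow> Z c \<Longrightarrow> Y c" "\<And>c. Y c \<Longrightarrow> Z c \<Longrightarrow> X c"
    and ac: "\<And>c. c \<in> D \<Longrightarrow> \<not> closes_cycle X Y Z (i, j, k) c"
    and conn: "\<And>c. c \<in> D \<Longrightarrow> c \<noteq> i \<Longrightarrow> c \<noteq> j \<Longrightarrow> c \<noteq> k \<Longrightarrow> X c \<and> Y c \<and> Z c"
      "i \<noteq> j \<Longrightarrow> i \<noteq> k \<Longrightarrow> Y i \<or> Z i" "j \<noteq> i \<Longrightarrow> j \<noteq> k \<Longrightarrow> X j \<or> Z j"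
      "k \<noteq> i \<Longrightarrow> k \<noteq> j \<Longrightarrow> X k \<or> Y k"
  shows "\<exists>t. t \<in> set (rearrangements (i, j, k)) \<and> t \<noteq> (i, j, k) \<and>
    (\<forall>u. u \<in> D \<times> D \<times> D \<and> u \<noteq> (i, j, k) \<and> (\<forall>c\<in>D. \<not> closes_cycle X Y Z u c) \<longleftrightarrow> u = t)"
proof -
  let ?ok = "\<lambda>i' j' k'. \<forall>c\<in>{i, j, k}. \<not> closes_cycle X Y Z (i', j', k') c"
  \<comment> \<open>A colour outside the triple closes a cycle wherever it is put, and a colour that
    the triple \<open>u\<close> does not contain cannot close one. So \<open>D\<close> may be
    replaced by \<open>{i, j, k}\<close> both for the entries and for the test.\<close>
  have red: "(u \<in> D \<times> D \<times> D \<and> (\<forall>c\<in>D. \<not> closes_cycle X Y Z u c)) \<longleftrightarrow>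
      (\<exists>i' j' k'. u = (i', j', k') \<and> {i', j', k'} \<subseteq> {i, j, k} \<and> ?ok i' j' k')" for u
  proof (cases u)
    case (fields i' j' k')
    have 1: "i' \<in> {i, j, k}" if "i' \<in> D" "\<not> closes_cycle X Y Z (i', j', k') i'"
      using that conn(1)[of i'] by (auto simp: closes_cycle_def)
    have 2: "j' \<in> {i, j, k}" if "j' \<in> D" "\<not> closes_cycle X Y Z (i', j', k') j'"
      using that conn(1)[of j'] by (auto simp: closes_cycle_def)
    have 3: "k' \<in> {i, j, k}" if "k' \<in> D" "\<not> closes_cycle X Y Z (i', j', k') k'"
      using that conn(1)[of k'] by (auto simp: closes_cycle_def)
    have 4: "\<not> closes_cycle X Y Z (i', j', k') c" if "c \<notin> {i', j', k'}" for c
      using that by (auto simp: closes_cycle_def)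
    have "i' \<in> D \<and> j' \<in> D \<and> k' \<in> D \<and> (\<forall>c\<in>D. \<not> closes_cycle X Y Z (i', j', k') c) \<longleftrightarrow>
      {i', j', k'} \<subseteq> {i, j, k} \<and> ?ok i' j' k'" (is "?l \<longleftrightarrow> ?r")
    proof
      assume l: ?l
      then have "i' \<in> {i, j, k}" "j' \<in> {i, j, k}" "k' \<in> {i, j, k}" using 1 2 3 by blast+
      then show ?r using l ijk by simp
    next
      assume r: ?r
      then have D: "i' \<in> D" "j' \<in> D" "k' \<in> D" using ijk by auto
      have "\<not> closes_cycle X Y Z (i', j', k') c" for c
      proof (cases "c \<in> {i', j', k'}")
        case True
        then have "c \<in> {i, j, k}" using r by blast
        then show ?thesis using r by blast
      qed (rule 4)
      then show ?l using D by blast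
    qed
    then show ?thesis unfolding fields by simp
  qed
  note aci = ac[OF ijk(1)] ac[OF ijk(2)] ac[OF ijk(3)]
  have main: "\<exists>t\<in>set (rearrangements (i, j, k)). t \<noteq> (i, j, k) \<and> (\<forall>c\<in>{i, j, k}. \<not> closes_cycle X Y Z t c) \<and>
    (\<forall>i'\<in>{i, j, k}. \<forall>j'\<in>{i, j, k}. \<forall>k'\<in>{i, j, k}.
      ?ok i' j' k' \<longrightarrow> (i', j', k') \<noteq> (i, j, k) \<longrightarrow> (i', j', k') = t)"
  proof -
    consider "i = j" "i = k" | "i = j" "i \<noteq> k" | "i = k" "i \<noteq> j" | "j = k" "i \<noteq> j"
      | "i \<noteq> j" "i \<noteq> k" "j \<noteq> k" by blast
    then show ?thesis
    proof cases
      case 1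
      \<comment> \<open>A triangle in a single colour would already be a cycle.\<close>
      then show ?thesis using aci by (simp add: closes_cycle_def)
    next
      case 2
      \<comment> \<open>The repeated colour \<open>i\<close> links no two corners. The single colour
        \<open>k\<close> links exactly one pair, not \<open>yz\<close>, which it holds; it has to
        move to the remaining pair. The next two cases are the same with the places
        exchanged.\<close>
      then have b: "\<not> X i" "\<not> Y i" "\<not> Z i" "\<not> Z k" "Y k \<longleftrightarrow> \<not> X k"
        using aci conn trans[of k] by (auto simp: closes_cycle_def)
      show ?thesis
      proof (cases "X k")
        case True
        show ?thesis
          by (rule bexI[of _ "(i, k, i)"])
            (use 2 b True in \<open>simp_all add: closes_cycle_def\<close>)
      next
        case False
        show ?thesis
          by (rule bexI[of _ "(k, i, i)"])
            (use 2 b False in \<open>simp_all add: closes_cycle_def\<close>)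
      qed
    next
      case 3
      then have b: "\<not> X i" "\<not> Y i" "\<not> Z i" "\<not> Y j" "Z j \<longleftrightarrow> \<not> X j"
        using aci conn trans[of j] by (auto simp: closes_cycle_def)
      show ?thesis
      proof (cases "X j")
        case True
        show ?thesis
          by (rule bexI[of _ "(i, i, j)"])
            (use 3 b True in \<open>simp_all add: closes_cycle_def\<close>)
      next
        case False
        show ?thesis
          by (rule bexI[of _ "(j, i, i)"])
            (use 3 b False in \<open>simp_all add: closes_cycle_def\<close>)
      qed
    next
      case 4
      then have b: "\<not> X j" "\<not> Y j" "\<not> Z j" "\<not> X i" "Z i \<longleftrightarrow> \<not> Y i"
        using aci conn trans[of i] by (auto simp: closes_cycle_def)
      show ?thesis
      proof (cases "Y i")
        case True
        show ?thesis
          by (rule bexI[of _ "(j, j, i)"])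
            (use 4 b True in \<open>simp_all add: closes_cycle_def\<close>)
      next
        case False
        show ?thesis
          by (rule bexI[of _ "(j, i, j)"])
            (use 4 b False in \<open>simp_all add: closes_cycle_def\<close>)
      qed
    next
      case 5
      have "\<not> X i" "\<not> Y j" "\<not> Z k" using aci 5 by (auto simp: closes_cycle_def)
      moreover have "Y i \<or> Z i" "X j \<or> Z j" "X k \<or> Y k" using 5 conn by auto
      ultimately have b: "\<not> X i" "\<not> Y j" "\<not> Z k" "Z i \<longleftrightarrow> \<not> Y i" "Z j \<longleftrightarrow> \<not> X j" "Y k \<longleftrightarrow> \<not> X k"
        using trans by blast+
      have ne: "i \<noteq> j" "i \<noteq> k" "j \<noteq> k" "j \<noteq> i" "k \<noteq> i" "k \<noteq> j" using 5 by auto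
      \<comment> \<open>These truth values tell which pair each colour links, hence its other place.
        With \<open>Y i\<close> and \<open>\<not> X k\<close>, the colours \<open>i\<close> and
        \<open>k\<close> aim at each other's place and trade them whatever \<open>j\<close> does, so
        \<open>X j\<close> is left open there.\<close>
      consider "Y i" "X j" "X k" | "Y i" "\<not> X j" "X k" | "\<not> Y i" "X j" "X k" | "\<not> Y i" "\<not> X j" "X k"
        | "Y i" "\<not> X k" | "\<not> Y i" "X j" "\<not> X k" | "\<not> Y i" "\<not> X j" "\<not> X k" by blast
      then show ?thesis
      proof cases
        case 1
        show ?thesis
          by (rule bexI[of _ "(i, k, j)"])
            (use ne b 1 in \<open>simp_all add: closes_cycle_def\<close>)
      next
        case 2
        show ?thesis
          by (rule bexI[of _ "(j, k, i)"])
            (use ne b 2 in \<open>simp_all add: closes_cycle_def\<close>)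
      next
        case 3
        show ?thesis
          by (rule bexI[of _ "(i, k, j)"])
            (use ne b 3 in \<open>simp_all add: closes_cycle_def\<close>)
      next
        case 4
        show ?thesis
          by (rule bexI[of _ "(j, i, k)"])
            (use ne b 4 in \<open>simp_all add: closes_cycle_def\<close>)
      next
        case 5
        show ?thesis
          by (rule bexI[of _ "(k, j, i)"])
            (use ne b 5 in \<open>simp_all add: closes_cycle_def\<close>)
      next
        case 6
        show ?thesis
          by (rule bexI[of _ "(k, i, j)"])
            (use ne b 6 in \<open>simp_all add: closes_cycle_def\<close>)
      next
        case 7
        show ?thesis
          by (rule bexI[of _ "(j, i, k)"])
            (use ne b 7 in \<open>simp_all add: closes_cycle_def\<close>)
      qed
    qed
  qed
  then obtain t where t: "t \<in> set (rearrangements (i, j, k))" "t \<noteq> (i, j, k)"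
      "\<forall>c\<in>{i, j, k}. \<not> closes_cycle X Y Z t c"
    and "\<forall>i'\<in>{i, j, k}. \<forall>j'\<in>{i, j, k}. \<forall>k'\<in>{i, j, k}.
      ?ok i' j' k' \<longrightarrow> (i', j', k') \<noteq> (i, j, k) \<longrightarrow> (i', j', k') = t"
    by (elim bexE conjE)
  then have uniq: "(i', j', k') = t"
    if "{i', j', k'} \<subseteq> {i, j, k}" "?ok i' j' k'" "(i', j', k') \<noteq> (i, j, k)" for i' j' k'
    using that by blast
  obtain a b c where abc: "t = (a, b, c)" by (cases t)
  have "{a, b, c} \<subseteq> {i, j, k}" using t(1) abc by auto
  then have "(u \<in> D \<times> D \<times> D \<and> (\<forall>c\<in>D. \<not> closes_cycle X Y Z u c)) \<and> u \<noteq> (i, j, k) \<longleftrightarrow> u = t" for u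
    unfolding red using t uniq abc by blast
  then show ?thesis using t by blast
qed

text \<open>The links are taken in the parts with the triangle removed. Acyclicity of the parts of
  \<open>P\<close> and their connectedness then become the hypotheses of
  \<open>unique_rearrangement\<close>.\<close>

lemma flip_unique_colours:
  assumes P: "P \<in> cf_partitions d"
    and xyz: "x \<noteq> y" "x \<noteq> z" "y \<noteq> z" "{x, y, z} \<subseteq> {1..2 * d}"
    and ijk: "i \<in> {1..d}" "j \<in> {1..d}" "k \<in> {1..d}"
    and e: "{x, y} \<in> P i" "{x, z} \<in> P j" "{y, z} \<in> P k"
  obtains t where "t \<in> set (rearrangements (i, j, k))" "t \<noteq> (i, j, k)"
    "\<And>u. u \<in> {1..d} \<times> {1..d} \<times> {1..d} \<and> u \<noteq> (i, j, k) \<and>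
      recolour d x y z u P \<in> cf_partitions d \<longleftrightarrow> u = t"
proof -
  define B where "B = (\<lambda>c. P c - triangle_edges x y z)"
  define X where "X = (\<lambda>c. linked (B c) x y)"
  define Y where "Y = (\<lambda>c. linked (B c) x z)"
  define Z where "Z = (\<lambda>c. linked (B c) y z)"
  let ?D = "{1..d}"
  have B: "\<not> has_cycle (B c)" "B c \<inter> triangle_edges x y z = {}" if "c \<in> ?D" for c
    using cf_partitionsD(4)[OF P that] has_cycle_mono[of "B c" "P c"] by (auto simp: B_def)
  have cyc: "has_cycle (B c \<union> triangle_part x y z u c) \<longleftrightarrow> closes_cycle X Y Z u c" if "c \<in> ?D" for u c
    by (cases u) (simp add: has_cycle_triangle_part_iff[OF B[OF that] xyz(1-3)] closes_cycle_def X_def Y_def Z_def)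
  \<comment> \<open>\<open>P\<close> is the recolouring of itself by its own triple, so the
    acyclicity test also applies to it.\<close>
  have Pc: "P c = B c \<union> triangle_part x y z (i, j, k) c" if "c \<in> ?D" for c
    using fun_cong[OF recolour_self[OF P xyz(1-3) ijk e], of c] that
    by (simp add: recolour_def B_def)
  have lP: "linked (P c) u v" if "c \<in> ?D" "u \<in> {x, y, z}" "v \<in> {x, y, z}" for c u v
    using cf_partition_linked[OF P that(1), of u v] that xyz(4) by blast
  \<comment> \<open>A colour absent from the triangle keeps its whole spanning tree, which links all
    corners.\<close>
  have none: "X c \<and> Y c \<and> Z c" if "c \<in> ?D" "c \<noteq> i" "c \<noteq> j" "c \<noteq> k" for c
  proof -
    have "P c = B c" using Pc[OF that(1)] that by (auto simp: triangle_part_def)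
    then show ?thesis using lP[OF that(1)] by (simp add: X_def Y_def Z_def)
  qed
  \<comment> \<open>The tree links the third corner to the single edge it has on the triangle; by
    \<open>linked_insertD\<close> this leaves a link off the triangle to one end of that
    edge.\<close>
  have only_i: "Y i \<or> Z i" if "i \<noteq> j" "i \<noteq> k"
  proof -
    have "P i = insert {x, y} (B i)" using Pc[OF ijk(1)] that by (auto simp: triangle_part_def)
    then have "linked (insert {x, y} (B i)) x z" using lP[OF ijk(1)] by simp
    then show ?thesis using linked_insertD unfolding Y_def Z_def by blast
  qed
  have only_j: "X j \<or> Z j" if "j \<noteq> i" "j \<noteq> k"
  proof -
    have "P j = insert {x, z} (B j)" using Pc[OF ijk(2)] that by (auto simp: triangle_part_def)
    then have "linked (insert {x, z} (B j)) x y" using lP[OF ijk(2)] by simp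
    then show ?thesis using linked_insertD linked_sym unfolding X_def Z_def by blast
  qed
  have only_k: "X k \<or> Y k" if "k \<noteq> i" "k \<noteq> j"
  proof -
    have "P k = insert {y, z} (B k)" using Pc[OF ijk(3)] that by (auto simp: triangle_part_def)
    then have "linked (insert {y, z} (B k)) x y" using lP[OF ijk(3)] by simp
    then show ?thesis using linked_insertD linked_sym unfolding X_def Y_def by blast
  qed
  have "\<exists>t. t \<in> set (rearrangements (i, j, k)) \<and> t \<noteq> (i, j, k) \<and>
    (\<forall>u. u \<in> ?D \<times> ?D \<times> ?D \<and> u \<noteq> (i, j, k) \<and> (\<forall>c\<in>?D. \<not> closes_cycle X Y Z u c) \<longleftrightarrow> u = t)"
  proof (rule unique_rearrangement[OF ijk])
    show "X c \<Longrightarrow> Y c \<Longrightarrow> Z c" for c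
      unfolding X_def Y_def Z_def by (rule rtranclp_trans[OF linked_sym])
    show "X c \<Longrightarrow> Z c \<Longrightarrow> Y c" for c
      unfolding X_def Y_def Z_def by (rule rtranclp_trans)
    show "Y c \<Longrightarrow> Z c \<Longrightarrow> X c" for c
      unfolding X_def Y_def Z_def by (rule rtranclp_trans[OF _ linked_sym])
    show "\<not> closes_cycle X Y Z (i, j, k) c" if "c \<in> ?D" for c
      using cyc[OF that] Pc[OF that] cf_partitionsD(4)[OF P that] by simp
  qed (use none only_i only_j only_k in auto)
  then obtain t where t: "t \<in> set (rearrangements (i, j, k))" "t \<noteq> (i, j, k)"
    "\<And>u. u \<in> ?D \<times> ?D \<times> ?D \<and> u \<noteq> (i, j, k) \<and> (\<forall>c\<in>?D. \<not> closes_cycle X Y Z u c) \<longleftrightarrow> u = t"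
    by blast
  have rec: "recolour d x y z u P \<in> cf_partitions d \<longleftrightarrow> (\<forall>c\<in>?D. \<not> closes_cycle X Y Z u c)"
    if "u \<in> ?D \<times> ?D \<times> ?D" for u
  proof -
    obtain a b c where u: "u = (a, b, c)" by (cases u)
    have D: "a \<in> ?D" "b \<in> ?D" "c \<in> ?D" using that unfolding u by simp_all
    show ?thesis unfolding u recolour_cf_iff[OF P xyz D] using cyc by (simp add: B_def)
  qed
  have "u \<in> ?D \<times> ?D \<times> ?D \<and> u \<noteq> (i, j, k) \<and> recolour d x y z u P \<in> cf_partitions d \<longleftrightarrow> u = t" for u
  proof (cases "u \<in> ?D \<times> ?D \<times> ?D")
    case True
    show ?thesis unfolding rec[OF True] by (rule t(3))
  next
    case False
    then show ?thesis using t(3)[of u] by blast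
  qed
  with t(1,2) show thesis by (rule that)
qed

section \<open>Existence and uniqueness of the flipped partition\<close>

lemma cf_partition_colours_ex:
  assumes "P \<in> cf_partitions d" "x \<noteq> y" "x \<noteq> z" "y \<noteq> z" "{x, y, z} \<subseteq> {1..2 * d}"
  obtains i j k where "i \<in> {1..d}" "j \<in> {1..d}" "k \<in> {1..d}"
    "{x, y} \<in> P i" "{x, z} \<in> P j" "{y, z} \<in> P k"
  using cf_partition_colour_ex[OF assms(1), of x y] cf_partition_colour_ex[OF assms(1), of x z]
    cf_partition_colour_ex[OF assms(1), of y z] assms(2-5) by auto

text \<open>Both partitions are recolourings of \<open>P\<close> by triples other than its own, and
  only one such triple is admissible. The requirement is merely to differ from \<open>P\<close>,
  which is weaker than differing on two edges and so gives the stronger uniqueness.\<close>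

lemma flip_unique:
  assumes P: "P \<in> cf_partitions d"
    and xyz: "x \<noteq> y" "x \<noteq> z" "y \<noteq> z" "{x, y, z} \<subseteq> {1..2 * d}"
    and Q: "Q \<in> cf_partitions d" "Q \<noteq> P" "\<forall>e \<in> complete_edges (2 * d) - triangle_edges x y z. coincide_on d P Q e"
    and R: "R \<in> cf_partitions d" "R \<noteq> P" "\<forall>e \<in> complete_edges (2 * d) - triangle_edges x y z. coincide_on d P R e"
  shows "Q = R"
proof -
  obtain i j k where p: "i \<in> {1..d}" "j \<in> {1..d}" "k \<in> {1..d}" "{x, y} \<in> P i" "{x, z} \<in> P j" "{y, z} \<in> P k"
    by (rule cf_partition_colours_ex[OF P xyz])
  obtain a b c where q: "a \<in> {1..d}" "b \<in> {1..d}" "c \<in> {1..d}" "{x, y} \<in> Q a" "{x, z} \<in> Q b" "{y, z} \<in> Q c"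
    by (rule cf_partition_colours_ex[OF Q(1) xyz])
  obtain a' b' c' where r: "a' \<in> {1..d}" "b' \<in> {1..d}" "c' \<in> {1..d}" "{x, y} \<in> R a'" "{x, z} \<in> R b'" "{y, z} \<in> R c'"
    by (rule cf_partition_colours_ex[OF R(1) xyz])
  obtain t where t: "\<And>u. u \<in> {1..d} \<times> {1..d} \<times> {1..d} \<and> u \<noteq> (i, j, k) \<and>
      recolour d x y z u P \<in> cf_partitions d \<longleftrightarrow> u = t"
    using flip_unique_colours[OF P xyz p] by metis
  have p': "recolour d x y z (i, j, k) P = P" by (rule recolour_self[OF P xyz(1-3) p])
  have q': "recolour d x y z (a, b, c) P = Q" by (rule recolour_eqI[OF P Q(1) xyz(1-3) Q(3) q])
  have r': "recolour d x y z (a', b', c') P = R" by (rule recolour_eqI[OF P R(1) xyz(1-3) R(3) r])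
  have "(a, b, c) = t" using t[of "(a, b, c)"] q q' Q p' by auto
  moreover have "(a', b', c') = t" using t[of "(a', b', c')"] r r' R p' by auto
  ultimately show ?thesis using q' r' by simp
qed

lemma flip_exists:
  assumes P: "P \<in> cf_partitions d"
    and xyz: "x \<noteq> y" "x \<noteq> z" "y \<noteq> z" "{x, y, z} \<subseteq> {1..2 * d}"
    and p: "i \<in> {1..d}" "j \<in> {1..d}" "k \<in> {1..d}" "{x, y} \<in> P i" "{x, z} \<in> P j" "{y, z} \<in> P k"
  obtains Q i' j' k' where "Q \<in> cf_partitions d" "Q \<noteq> P"
    "(i', j', k') \<in> set (rearrangements (i, j, k))" "(i', j', k') \<noteq> (i, j, k)"
    "{x, y} \<in> Q i'" "{x, z} \<in> Q j'" "{y, z} \<in> Q k'"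
    "\<And>c e. e \<notin> triangle_edges x y z \<Longrightarrow> c \<in> {1..d} \<Longrightarrow> e \<in> Q c \<longleftrightarrow> e \<in> P c"
proof -
  obtain t where t: "t \<in> set (rearrangements (i, j, k))" "t \<noteq> (i, j, k)"
    "\<And>u. u \<in> {1..d} \<times> {1..d} \<times> {1..d} \<and> u \<noteq> (i, j, k) \<and>
      recolour d x y z u P \<in> cf_partitions d \<longleftrightarrow> u = t"
    using flip_unique_colours[OF P xyz p] by metis
  obtain a b c where abc: "t = (a, b, c)" by (cases t)
  let ?Q = "recolour d x y z t P"
  have D: "a \<in> {1..d}" "b \<in> {1..d}" "c \<in> {1..d}" using t(3)[of t] abc by auto
  have e: "{x, y} \<in> ?Q a" "{x, z} \<in> ?Q b" "{y, z} \<in> ?Q c"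
    using D mem_triangle_part[OF xyz(1-3)] by (simp_all add: recolour_def abc)
  have off: "f \<in> ?Q m \<longleftrightarrow> f \<in> P m" if "f \<notin> triangle_edges x y z" "m \<in> {1..d}" for f m
    using that triangle_part_subset[of x y z t m] by (auto simp: recolour_def)
  have cf: "?Q \<in> cf_partitions d" using t(3)[of t] by simp
  have "?Q \<noteq> P"
  proof
    assume eq: "?Q = P"
    have "a = i" "b = j" "c = k"
      using cf_partition_colour_unique[OF P] D p e unfolding eq by blast+
    then show False using t(2) abc by simp
  qed
  then show thesis using that[OF cf _ _ _ e off] t abc by blast
qed

text \<open>Differing from \<open>P\<close> at all forces two of the three edges to change, because
  the new colours are a rearrangement of the old ones. Hence the definite description is settled by
  \<open>flip_unique\<close>.\<close>

lemma involution_eqI: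
  assumes P: "P \<in> cf_partitions d" and Q: "Q \<in> cf_partitions d" "Q \<noteq> P"
    and xyz: "x \<noteq> y" "x \<noteq> z" "y \<noteq> z" "{x, y, z} \<subseteq> {1..2 * d}"
    and off: "\<forall>e \<in> complete_edges (2 * d) - triangle_edges x y z. coincide_on d P Q e"
  shows "involution d P x y z = Q"
proof -
  obtain i j k where p: "i \<in> {1..d}" "j \<in> {1..d}" "k \<in> {1..d}" "{x, y} \<in> P i" "{x, z} \<in> P j" "{y, z} \<in> P k"
    by (rule cf_partition_colours_ex[OF P xyz])
  let ?S = "{e \<in> triangle_edges x y z. \<not> coincide_on d P Q e}"
  have fin: "finite ?S" by (simp add: triangle_edges_def)
  have "2 \<le> card ?S"
  proof -
    obtain R i' j' k' where R: "R \<in> cf_partitions d" "R \<noteq> P"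
      "(i', j', k') \<in> set (rearrangements (i, j, k))" "(i', j', k') \<noteq> (i, j, k)"
      "{x, y} \<in> R i'" "{x, z} \<in> R j'" "{y, z} \<in> R k'"
      "\<And>c e. e \<notin> triangle_edges x y z \<Longrightarrow> c \<in> {1..d} \<Longrightarrow> e \<in> R c \<longleftrightarrow> e \<in> P c"
      by (rule flip_exists[OF P xyz p], rule that)
    \<comment> \<open>By uniqueness \<open>Q\<close> is the flip constructed by
      \<open>flip_exists\<close>, so its colours on the triangle are known to be a
      rearrangement.\<close>
    have "R = Q" using R P Q off by (intro flip_unique[OF P xyz]) (auto simp: coincide_on_def)
    note q = R(5-7)[unfolded \<open>R = Q\<close>]
    have D: "i' \<in> {1..d}" "j' \<in> {1..d}" "k' \<in> {1..d}" using R(3) p by auto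
    have "i' = i" if "coincide_on d P Q {x, y}"
      using cf_partition_colour_unique[OF Q(1) D(1) p(1) q(1)] that p D by (auto simp: coincide_on_def)
    moreover have "j' = j" if "coincide_on d P Q {x, z}"
      using cf_partition_colour_unique[OF Q(1) D(2) p(2) q(2)] that p D by (auto simp: coincide_on_def)
    moreover have "k' = k" if "coincide_on d P Q {y, z}"
      using cf_partition_colour_unique[OF Q(1) D(3) p(3) q(3)] that p D by (auto simp: coincide_on_def)
    \<comment> \<open>A rearrangement that keeps two of three entries also keeps the third.\<close>
    moreover have "i' \<noteq> i \<and> j' \<noteq> j \<or> i' \<noteq> i \<and> k' \<noteq> k \<or> j' \<noteq> j \<and> k' \<noteq> k" using R(3,4) by auto
    ultimately have "{{x, y}, {x, z}} \<subseteq> ?S \<or> {{x, y}, {y, z}} \<subseteq> ?S \<or> {{x, z}, {y, z}} \<subseteq> ?S"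
      by (auto simp: triangle_edges_def)
    moreover have "card {{x, y}, {x, z}} = 2" "card {{x, y}, {y, z}} = 2" "card {{x, z}, {y, z}} = 2"
      using triangle_distinct_edges[OF xyz(1-3)] by auto
    ultimately obtain W where "W \<subseteq> ?S" "card W = 2" by blast
    then show ?thesis using card_mono[OF fin, of W] by simp
  qed
  then have H: "Q \<in> cf_partitions d \<and> (\<forall>e \<in> complete_edges (2 * d) - {{x,y}, {x,z}, {y,z}}. coincide_on d P Q e) \<and>
    2 \<le> card {e \<in> {{x,y}, {x,z}, {y,z}}. \<not> coincide_on d P Q e}"
    using Q off unfolding triangle_edges_def by blast
  show ?thesis
    unfolding involution_def
  proof (rule the_equality, rule H)
    fix R
    assume R: "R \<in> cf_partitions d \<and> (\<forall>e \<in> complete_edges (2 * d) - {{x,y}, {x,z}, {y,z}}. coincide_on d P R e) \<and>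
      2 \<le> card {e \<in> {{x,y}, {x,z}, {y,z}}. \<not> coincide_on d P R e}"
    have "R \<noteq> P"
    proof
      assume "R = P"
      then have none: "{e \<in> {{x,y}, {x,z}, {y,z}}. \<not> coincide_on d P R e} = {}"
        by (simp add: coincide_on_def)
      have "2 \<le> card {e \<in> {{x,y}, {x,z}, {y,z}}. \<not> coincide_on d P R e}" using R by blast
      then show False unfolding none by simp
    qed
    then show "R = Q" using R Q off by (intro flip_unique[OF P xyz]) (auto simp: triangle_edges_def)
  qed
qed

section \<open>Flips as steps of weak equivalence\<close>

lemma act_id:
  assumes "P \<in> extensional {1..d}"
  shows "act d (id, id) P = P"
  using assms by (intro extensionalityI[of _ "{1..d}"]) (auto simp: act_def vertex_act_def index_act_def relabel_def)

lemma weakly_equivalent_refl: "P \<in> cf_partitions d \<Longrightarrow> weakly_equivalent d P P"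
  unfolding weakly_equivalent_def by (rule exI[of _ 0]) (auto intro!: exI[of _ "\<lambda>_. P"])

text \<open>The chains of the definition run backwards: step \<open>i\<close> flips
  \<open>Ps i\<close> and yields \<open>Ps (i - 1)\<close>. A chain from \<open>Q\<close> is
  therefore prolonged at its front by a flip of \<open>Q\<close> that yields
  \<open>P\<close>.\<close>

lemma weakly_equivalent_step:
  assumes P: "P \<in> cf_partitions d" and xyz: "1 \<le> x" "x < y" "y < z" "z \<le> 2 * d"
    and inv: "involution d Q x y z = P" and QR: "weakly_equivalent d Q R"
  shows "weakly_equivalent d P R"
proof -
  obtain n Ps X Y Z \<sigma> \<tau> where
    *: "\<forall>i\<in>{0..n::nat}. Ps i \<in> cf_partitions d" "Ps 0 = Q" "Ps n = R"
      "\<forall>i\<in>{1..n}. 1 \<le> X i \<and> X i < Y i \<and> Y i < Z i \<and> Z i \<le> 2 * d \<and>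
        \<sigma> i permutes {1..2 * d} \<and> \<tau> i permutes {1..d} \<and>
        act d (\<sigma> i, \<tau> i) (involution d (Ps i) (X i) (Y i) (Z i)) = Ps (i - 1)"
    using QR unfolding weakly_equivalent_def by blast
  \<comment> \<open>Position 0 and step 1 are new; all others move up by one index. The new step
    uses the identity permutations.\<close>
  define Ps' where "Ps' = (\<lambda>i. if i = 0 then P else Ps (i - 1))"
  define X' where "X' = (\<lambda>i. if i = 1 then x else X (i - 1))"
  define Y' where "Y' = (\<lambda>i. if i = 1 then y else Y (i - 1))"
  define Z' where "Z' = (\<lambda>i. if i = 1 then z else Z (i - 1))"
  define \<sigma>' where "\<sigma>' = (\<lambda>i. if i = 1 then id else \<sigma> (i - 1))"
  define \<tau>' where "\<tau>' = (\<lambda>i. if i = 1 then id else \<tau> (i - 1))"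
  note defs = Ps'_def X'_def Y'_def Z'_def \<sigma>'_def \<tau>'_def
  have "\<forall>i\<in>{0..Suc n}. Ps' i \<in> cf_partitions d"
    using *(1) P by (auto simp: Ps'_def)
  moreover have "Ps' 0 = P" "Ps' (Suc n) = R" using *(3) by (simp_all add: Ps'_def)
  moreover have "1 \<le> X' i \<and> X' i < Y' i \<and> Y' i < Z' i \<and> Z' i \<le> 2 * d \<and>
        \<sigma>' i permutes {1..2 * d} \<and> \<tau>' i permutes {1..d} \<and>
        act d (\<sigma>' i, \<tau>' i) (involution d (Ps' i) (X' i) (Y' i) (Z' i)) = Ps' (i - 1)"
    if i: "i \<in> {1..Suc n}" for i
  proof (cases "i = 1")
    case True
    then show ?thesis
      using *(2) inv act_id[OF cf_partitionsD(1)[OF P]] xyz permutes_id by (simp add: defs)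
  next
    case False
    then have i': "i - 1 \<in> {1..n}" "i \<noteq> 0" "i - 1 \<noteq> 0" using i by auto
    show ?thesis using bspec[OF *(4) i'(1)] i'(2,3) False by (simp only: defs if_False)
  qed
  ultimately show ?thesis unfolding weakly_equivalent_def by blast
qed

text \<open>Agreement off the triangle and distinctness are symmetric in \<open>P\<close> and
  \<open>Q\<close>, so flipping \<open>Q\<close> leads back to \<open>P\<close>, which is the
  direction that \<open>weakly_equivalent_step\<close> asks for.\<close>

lemma flip_weakly_equivalent:
  assumes P: "P \<in> cf_partitions d" and Q: "Q \<in> cf_partitions d" "Q \<noteq> P"
    and xyz: "x \<noteq> y" "x \<noteq> z" "y \<noteq> z" "{x, y, z} \<subseteq> {1..2 * d}"
    and off: "\<And>c e. e \<notin> triangle_edges x y z \<Longrightarrow> c \<in> {1..d} \<Longrightarrow> e \<in> Q c \<longleftrightarrow> e \<in> P c"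
    and QR: "weakly_equivalent d Q R"
  shows "weakly_equivalent d P R"
proof -
  \<comment> \<open>Certificates name the corners of a triangle in any order, whereas weak
    equivalence wants them increasing.\<close>
  have "\<exists>a b c. a < b \<and> b < c \<and> {a, b, c} = {x, y, z} \<and> triangle_edges a b c = triangle_edges x y z"
  proof -
    have eq: "triangle_edges x z y = triangle_edges x y z" "triangle_edges y x z = triangle_edges x y z"
      "triangle_edges y z x = triangle_edges x y z" "triangle_edges z x y = triangle_edges x y z"
      "triangle_edges z y x = triangle_edges x y z"
      by (auto simp: triangle_edges_def insert_commute)
    have sorted: ?thesis if "a < b" "b < c" "{a, b, c} = {x, y, z}" "triangle_edges a b c = triangle_edges x y z" for a b c
      using that by blast
    consider "x < y" "y < z" | "x < z" "z < y" | "y < x" "x < z" | "y < z" "z < x" | "z < x" "x < y" | "z < y" "y < x"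
      using xyz(1-3) by linarith
    then show ?thesis
    proof cases
      case 1
      show ?thesis by (rule sorted[of x y z]) (use 1 eq in auto)
    next
      case 2
      show ?thesis by (rule sorted[of x z y]) (use 2 eq in auto)
    next
      case 3
      show ?thesis by (rule sorted[of y x z]) (use 3 eq in auto)
    next
      case 4
      show ?thesis by (rule sorted[of y z x]) (use 4 eq in auto)
    next
      case 5
      show ?thesis by (rule sorted[of z x y]) (use 5 eq in auto)
    next
      case 6
      show ?thesis by (rule sorted[of z y x]) (use 6 eq in auto)
    qed
  qed
  then obtain a b c where abc: "a < b" "b < c" "{a, b, c} = {x, y, z}" "triangle_edges a b c = triangle_edges x y z"
    by blast
  have D: "{a, b, c} \<subseteq> {1..2 * d}" using abc(3) xyz(4) by simp
  have "involution d Q a b c = P"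
    using P Q abc D off by (intro involution_eqI) (auto simp: coincide_on_def)
  then show ?thesis using abc D by (intro weakly_equivalent_step[OF P _ _ _ _ _ QR]) auto
qed

subsection \<open>Certificates\<close>

text \<open>A fact \<open>(u, v, c)\<close> says that the edge between the abstract vertices \<open>u\<close>, \<open>v\<close> has the abstract
  colour \<open>c\<close>. Since realizations are up to bijections of vertices and colours, a result about one list
  of facts covers all its relabellings; the group elements in the definition of weak equivalence
  can therefore always be taken to be the identity.\<close>

type_synonym facts = "(nat \<times> nat \<times> nat) list"

text \<open>Abstract vertices and colours count from 0, so that they can index lists;
  \<open>\<phi>\<close> and \<open>\<kappa>\<close> carry them to the actual ones, which count from
  1. Edges without a recorded fact are unrestricted.\<close>

definition realizes :: "nat \<Rightarrow> (nat \<Rightarrow> nat) \<Rightarrow> (nat \<Rightarrow> nat) \<Rightarrow> facts \<Rightarrow> edge_partition \<Rightarrow> bool" where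
  "realizes d \<phi> \<kappa> K P \<longleftrightarrow> bij_betw \<phi> {..<2 * d} {1..2 * d} \<and> bij_betw \<kappa> {..<d} {1..d} \<and>
    (\<forall>(u, v, c) \<in> set K. u < 2 * d \<and> v < 2 * d \<and> c < d \<and> {\<phi> u, \<phi> v} \<in> P (\<kappa> c))"

text \<open>\<open>K\<close> is a won position for the target \<open>T\<close>, whichever partition
  the adversary hides behind it. The bijections realizing \<open>T\<close> may differ from those
  realizing \<open>K\<close>, so winning is invariant under renaming.\<close>

definition reaches :: "nat \<Rightarrow> facts \<Rightarrow> facts \<Rightarrow> bool" where
  "reaches d T K \<longleftrightarrow> (\<forall>P \<in> cf_partitions d. (\<exists>\<phi> \<kappa>. realizes d \<phi> \<kappa> K P) \<longrightarrow>
    (\<exists>Q \<in> cf_partitions d. weakly_equivalent d P Q \<and> (\<exists>\<phi> \<kappa>. realizes d \<phi> \<kappa> T Q)))"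

definition colour_of :: "facts \<Rightarrow> nat \<Rightarrow> nat \<Rightarrow> nat option" where
  "colour_of K u v =
    map_option (snd \<circ> snd) (find (\<lambda>(a, b, c). a = u \<and> b = v \<or> a = v \<and> b = u) K)"

text \<open>\<open>Cycle\<close> and \<open>Cut\<close> are the two halves of being a spanning tree,
  acyclicity and connectedness. \<open>Cycle\<close> refutes a position; so does a
  \<open>Cut\<close> all of whose crossing edges are known in other colours. Only
  \<open>Flip\<close> moves to another partition.\<close>

datatype rule = Cycle nat "nat list" | Cut nat "nat list" | Branch nat nat | Flip nat nat nat

text \<open>\<open>Flip\<close> also works when only the two edges at \<open>x\<close> are known, provided they have the same colour:
  the third edge then has another colour, and after the flip it has theirs.\<close>

fun expand :: "nat \<Rightarrow> facts \<Rightarrow> rule \<Rightarrow> facts list option" where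
  "expand d K (Cycle c vs) =
    (if c < d \<and> 3 \<le> length vs \<and> distinct vs \<and> list_all (\<lambda>v. v < 2 * d) vs \<and>
        list_all (\<lambda>(u, v). colour_of K u v = Some c) (zip vs (rotate1 vs))
     then Some [] else None)"
| "expand d K (Cut c S) =
    (if c < d \<and> S \<noteq> [] \<and> list_all (\<lambda>v. v < 2 * d) S \<and> list_ex (\<lambda>v. v \<notin> set S) [0..<2 * d]
     then Some [(u, v, c) # K. u \<leftarrow> S, v \<leftarrow> [0..<2 * d], v \<notin> set S,
       case colour_of K u v of None \<Rightarrow> True | Some c' \<Rightarrow> c' = c]
     else None)"
| "expand d K (Branch u v) =
    (if u \<noteq> v \<and> u < 2 * d \<and> v < 2 * d then Some (map (\<lambda>c. (u, v, c) # K) [0..<d]) else None)"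
| "expand d K (Flip x y z) =
    (if x \<noteq> y \<and> x \<noteq> z \<and> y \<noteq> z \<and> x < 2 * d \<and> y < 2 * d \<and> z < 2 * d then
       let K' = filter (\<lambda>(a, b, c). \<not> (a \<in> {x, y, z} \<and> b \<in> {x, y, z})) K in
       (case (colour_of K x y, colour_of K x z, colour_of K y z) of
          (Some i, Some j, Some k) \<Rightarrow>
            Some (map (\<lambda>(a, b, c). (x, y, a) # (x, z, b) # (y, z, c) # K')
              (remdups (removeAll (i, j, k) (rearrangements (i, j, k)))))
        | (Some i, Some j, None) \<Rightarrow>
            if i = j then
              Some [(x, y, i) # (y, z, i) # K', (x, z, i) # (y, z, i) # K']
            else None
        | _ \<Rightarrow> None)
     else None)"

text \<open>In \<open>Goal g vs cs\<close> the lists send the vertices and colours of entry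
  \<open>g\<close> to those of the current position. The current position may know more than the
  entry demands.\<close>

datatype certificate = Goal nat "nat list" "nat list" | Node rule "certificate list"

text \<open>A full permutation is demanded even when the cited entry mentions few vertices, so that
  composing with it keeps the maps in \<open>realizes\<close> bijective.\<close>

definition permutation_list :: "nat \<Rightarrow> nat list \<Rightarrow> bool" where
  "permutation_list n vs \<longleftrightarrow> length vs = n \<and> distinct vs \<and> list_all (\<lambda>v. v < n) vs"

fun check :: "nat \<Rightarrow> facts list \<Rightarrow> facts \<Rightarrow> certificate \<Rightarrow> bool" where
  "check d Gs K (Goal g vs cs) \<longleftrightarrow>
    g < length Gs \<and> permutation_list (2 * d) vs \<and> permutation_list d cs \<and>
    list_all (\<lambda>(u, v, c). u < 2 * d \<and> v < 2 * d \<and> c < d \<and> colour_of K (vs ! u) (vs ! v) = Some (cs ! c)) (Gs ! g)"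
| "check d Gs K (Node r cs) \<longleftrightarrow>
    (case expand d K r of None \<Rightarrow> False | Some Ks \<Rightarrow> list_all2 (\<lambda>K' c. check d Gs K' c) Ks cs)"

text \<open>Settled positions are appended at the end, so entry numbers stay valid, and a
  certificate can cite only positions settled before it. This is what excludes circular
  arguments.\<close>

fun check_all :: "nat \<Rightarrow> facts list \<Rightarrow> (facts \<times> certificate) list \<Rightarrow> bool" where
  "check_all d Gs [] \<longleftrightarrow> True"
| "check_all d Gs ((K, c) # cs) \<longleftrightarrow> check d Gs K c \<and> check_all d (Gs @ [K]) cs"

section \<open>Soundness of the rules and of the checker\<close>

lemma colour_of_SomeD:
  assumes "colour_of K u v = Some c" "realizes d \<phi> \<kappa> K P"
  shows "c < d" "{\<phi> u, \<phi> v} \<in> P (\<kappa> c)"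
proof -
  from assms(1) obtain a b where ab: "find (\<lambda>(a, b, c). a = u \<and> b = v \<or> a = v \<and> b = u) K = Some (a, b, c)"
    unfolding colour_of_def by (auto simp: comp_def)
  then have "(a, b, c) \<in> set K" "a = u \<and> b = v \<or> a = v \<and> b = u"
    using nth_mem by (force simp: find_Some_iff)+
  then show "c < d" "{\<phi> u, \<phi> v} \<in> P (\<kappa> c)"
    using assms(2) unfolding realizes_def by (auto simp: insert_commute)
qed

lemma realizes_Cons:
  "realizes d \<phi> \<kappa> ((u, v, c) # K) P \<longleftrightarrow> realizes d \<phi> \<kappa> K P \<and> u < 2 * d \<and> v < 2 * d \<and> c < d \<and> {\<phi> u, \<phi> v} \<in> P (\<kappa> c)"
  by (auto simp: realizes_def)

lemma realizes_vertex:
  assumes "realizes d \<phi> \<kappa> K P" "u < 2 * d"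
  shows "\<phi> u \<in> {1..2 * d}"
  using assms bij_betwE unfolding realizes_def by blast

lemma realizes_vertex_eq:
  assumes "realizes d \<phi> \<kappa> K P" "u < 2 * d" "v < 2 * d"
  shows "\<phi> u = \<phi> v \<longleftrightarrow> u = v"
  using assms unfolding realizes_def bij_betw_def inj_on_def by auto

lemma realizes_colour:
  assumes "realizes d \<phi> \<kappa> K P" "c < d"
  shows "\<kappa> c \<in> {1..d}"
  using assms bij_betwE unfolding realizes_def by blast

text \<open>The rule leaves no successor position, so its soundness means that it cannot fire on a
  realized position: the listed vertices would be a cycle in one part.\<close>

lemma expand_Cycle_unrealizable:
  assumes P: "P \<in> cf_partitions d" and R: "realizes d \<phi> \<kappa> K P"
  shows "expand d K (Cycle c vs) = None"
proof (rule ccontr)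
  assume "\<not> ?thesis"
  then have c: "c < d" "3 \<le> length vs" "distinct vs" "list_all (\<lambda>v. v < 2 * d) vs"
      "list_all (\<lambda>(u, v). colour_of K u v = Some c) (zip vs (rotate1 vs))"
    by (auto split: if_splits)
  let ?ws = "map \<phi> vs"
  have "inj_on \<phi> (set vs)"
    using c(4) realizes_vertex_eq[OF R] by (auto simp: inj_on_def list_all_iff)
  then have "distinct ?ws" using c(3) by (simp add: distinct_map)
  moreover have "{?ws ! k, ?ws ! (Suc k mod length ?ws)} \<in> P (\<kappa> c)" if "k < length ?ws" for k
  proof -
    have k: "k < length vs" using that by simp
    \<comment> \<open>Pairing with \<open>rotate1\<close> joins each vertex to its cyclic successor,
      which matches the wrap-around index in \<open>has_cycle\<close>.\<close>
    then have "(vs ! k, rotate1 vs ! k) \<in> set (zip vs (rotate1 vs))"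
      by (auto simp: set_zip)
    then have "colour_of K (vs ! k) (vs ! (Suc k mod length vs)) = Some c"
      using c(5) k by (auto simp: list_all_iff nth_rotate1)
    moreover have "Suc k mod length vs < length vs" using k by (intro mod_less_divisor) linarith
    ultimately show ?thesis using colour_of_SomeD(2)[OF _ R] k by (simp only: nth_map length_map)
  qed
  ultimately have "has_cycle (P (\<kappa> c))"
    unfolding has_cycle_def using c(2) by (intro exI[of _ ?ws]) simp
  then show False using cf_partitionsD(4)[OF P realizes_colour[OF R c(1)]] by simp
qed

text \<open>The spanning tree of colour \<open>\<kappa> c\<close> has an edge leaving the image of
  \<open>S\<close>; the successors guess which one.\<close>

lemma expand_Cut_sound:
  assumes P: "P \<in> cf_partitions d" and R: "realizes d \<phi> \<kappa> K P" and e: "expand d K (Cut c S) = Some Ks"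
  shows "\<exists>K'\<in>set Ks. realizes d \<phi> \<kappa> K' P"
proof -
  have c: "c < d" "S \<noteq> []" "\<forall>v\<in>set S. v < 2 * d" "\<exists>v<2 * d. v \<notin> set S"
    and Ks: "Ks = [(u, v, c) # K. u \<leftarrow> S, v \<leftarrow> [0..<2 * d], v \<notin> set S,
       case colour_of K u v of None \<Rightarrow> True | Some c' \<Rightarrow> c' = c]"
    using e by (auto simp: list_all_iff list_ex_iff split: if_splits)
  have \<kappa>: "\<kappa> c \<in> {1..d}" by (rule realizes_colour[OF R c(1)])
  have bij: "bij_betw \<phi> {..<2 * d} {1..2 * d}" using R by (simp add: realizes_def)
  have sub: "\<phi> ` set S \<subseteq> {1..2 * d}" using c(3) realizes_vertex[OF R] by blast
  moreover have "\<phi> ` set S \<noteq> {1..2 * d}"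
  proof
    assume eq: "\<phi> ` set S = {1..2 * d}"
    obtain v where v: "v < 2 * d" "v \<notin> set S" using c(4) by blast
    then have "\<phi> v \<in> \<phi> ` set S" using realizes_vertex[OF R] eq by blast
    then show False using v c(3) realizes_vertex_eq[OF R] by blast
  qed
  ultimately have "\<exists>p\<in>\<phi> ` set S. \<exists>q\<in>{1..2 * d} - \<phi> ` set S. {p, q} \<in> P (\<kappa> c)"
    using c(2) by (intro cf_partition_crossing_edge[OF P \<kappa>]) auto
  then obtain p q where "p \<in> \<phi> ` set S" "q \<in> {1..2 * d} - \<phi> ` set S" "{p, q} \<in> P (\<kappa> c)" by blast
  moreover have "\<exists>v<2 * d. q = \<phi> v" if "q \<in> {1..2 * d}" for q
    using bij that unfolding bij_betw_def by blast
  ultimately obtain u v where uv: "u \<in> set S" "v < 2 * d" "v \<notin> set S" "{\<phi> u, \<phi> v} \<in> P (\<kappa> c)"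
    by blast
  \<comment> \<open>Pairs recorded with another colour were left out of the list. The crossing edge
    is not among them, since its colour is unique.\<close>
  have "c' = c" if "colour_of K u v = Some c'" for c'
  proof -
    note c' = colour_of_SomeD[OF that R]
    then have "\<kappa> c' = \<kappa> c"
      using cf_partition_colour_unique[OF P realizes_colour[OF R c'(1)] \<kappa>] uv(4) by blast
    then show ?thesis using R c'(1) c(1) by (auto simp: realizes_def bij_betw_def inj_on_def)
  qed
  then have "case colour_of K u v of None \<Rightarrow> True | Some c' \<Rightarrow> c' = c" by (simp split: option.split)
  then have "(u, v, c) # K \<in> set Ks" unfolding Ks using uv by auto
  moreover have "realizes d \<phi> \<kappa> ((u, v, c) # K) P" using R uv c by (simp add: realizes_Cons)
  ultimately show ?thesis by blast
qed

lemma expand_Branch_sound: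
  assumes P: "P \<in> cf_partitions d" and R: "realizes d \<phi> \<kappa> K P" and e: "expand d K (Branch u v) = Some Ks"
  shows "\<exists>K'\<in>set Ks. realizes d \<phi> \<kappa> K' P"
proof -
  have uv: "u \<noteq> v" "u < 2 * d" "v < 2 * d" and Ks: "Ks = map (\<lambda>c. (u, v, c) # K) [0..<d]"
    using e by (auto split: if_splits)
  obtain i where i: "i \<in> {1..d}" "{\<phi> u, \<phi> v} \<in> P i"
    using cf_partition_colour_ex[OF P realizes_vertex[OF R uv(2)] realizes_vertex[OF R uv(3)]]
      realizes_vertex_eq[OF R uv(2,3)] uv(1) by blast
  then obtain c where "c < d" "i = \<kappa> c"
    using R unfolding realizes_def bij_betw_def by blast
  then show ?thesis using i R Ks uv by (auto simp: realizes_Cons)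
qed

text \<open>Permuting positions commutes with renaming colours, so an outcome seen in actual colours
  can be read in abstract ones.\<close>

lemma rearrangements_map:
  "set (rearrangements (f i, f j, f k)) = (\<lambda>(a, b, c). (f a, f b, f c)) ` set (rearrangements (i, j, k))"
  by simp

text \<open>The bijections stay the same while the partition changes. Facts off the triangle
  persist, and the outcome on the triangle is one of the listed rearrangements. The implication
  between weak equivalences is in the form in which successive flips compose, each one prolonging a
  chain at its front.\<close>

lemma expand_Flip_sound:
  assumes P: "P \<in> cf_partitions d" and R: "realizes d \<phi> \<kappa> K P" and e: "expand d K (Flip x y z) = Some Ks"
  shows "\<exists>K'\<in>set Ks. \<exists>Q\<in>cf_partitions d. realizes d \<phi> \<kappa> K' Q \<and>
    (\<forall>S. weakly_equivalent d Q S \<longrightarrow> weakly_equivalent d P S)"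
proof -
  define K' where "K' = filter (\<lambda>(a, b, c). \<not> (a \<in> {x, y, z} \<and> b \<in> {x, y, z})) K"
  have xyz: "x \<noteq> y" "x \<noteq> z" "y \<noteq> z" "x < 2 * d" "y < 2 * d" "z < 2 * d"
    using e by (auto split: if_splits)
  have bij: "bij_betw \<phi> {..<2 * d} {1..2 * d}" "bij_betw \<kappa> {..<d} {1..d}"
    using R by (simp_all add: realizes_def)
  note eq = realizes_vertex_eq[OF R]
  let ?x = "\<phi> x" and ?y = "\<phi> y" and ?z = "\<phi> z"
  have ne: "?x \<noteq> ?y" "?x \<noteq> ?z" "?y \<noteq> ?z" using xyz eq by auto
  have V: "{?x, ?y, ?z} \<subseteq> {1..2 * d}" using xyz realizes_vertex[OF R] by blast
  have colour: "\<exists>c<d. {\<phi> u, \<phi> v} \<in> P (\<kappa> c)" if uv: "u < 2 * d" "v < 2 * d" "u \<noteq> v" for u v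
  proof -
    obtain i where i: "i \<in> {1..d}" "{\<phi> u, \<phi> v} \<in> P i"
      using cf_partition_colour_ex[OF P realizes_vertex[OF R uv(1)] realizes_vertex[OF R uv(2)]]
        eq[OF uv(1,2)] uv(3) by blast
    have "i \<in> \<kappa> ` {..<d}" using i(1) bij_betw_imp_surj_on[OF bij(2)] by simp
    then show ?thesis using i(2) by blast
  qed
  obtain i j k where c: "i < d" "j < d" "k < d" "{?x, ?y} \<in> P (\<kappa> i)" "{?x, ?z} \<in> P (\<kappa> j)" "{?y, ?z} \<in> P (\<kappa> k)"
    using colour xyz by metis
  note D = realizes_colour[OF R c(1)] realizes_colour[OF R c(2)] realizes_colour[OF R c(3)]
  obtain Q i' j' k' where Q: "Q \<in> cf_partitions d" "Q \<noteq> P"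
    "(i', j', k') \<in> set (rearrangements (\<kappa> i, \<kappa> j, \<kappa> k))" "(i', j', k') \<noteq> (\<kappa> i, \<kappa> j, \<kappa> k)"
    "{?x, ?y} \<in> Q i'" "{?x, ?z} \<in> Q j'" "{?y, ?z} \<in> Q k'"
    and off: "\<And>c e. e \<notin> triangle_edges ?x ?y ?z \<Longrightarrow> c \<in> {1..d} \<Longrightarrow> e \<in> Q c \<longleftrightarrow> e \<in> P c"
    by (rule flip_exists[OF P ne V D c(4-6)], rule that)
  have we: "weakly_equivalent d P S" if "weakly_equivalent d Q S" for S
    by (rule flip_weakly_equivalent[OF P Q(1,2) ne V off that])
  obtain a b c' where abc: "(a, b, c') \<in> set (rearrangements (i, j, k))" "i' = \<kappa> a" "j' = \<kappa> b" "k' = \<kappa> c'"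
    using Q(3) unfolding rearrangements_map by (elim imageE) (simp split: prod.splits)
  have abc_ne: "(a, b, c') \<noteq> (i, j, k)" using Q(4) abc by auto
  have abc_lt: "a < d" "b < d" "c' < d" using abc(1) c by auto
  have K'Q: "realizes d \<phi> \<kappa> K' Q"
  proof -
    have "{\<phi> u, \<phi> v} \<in> Q (\<kappa> m)" if K': "(u, v, m) \<in> set K'" for u v m
    proof -
      have K: "u < 2 * d" "v < 2 * d" "m < d" "{\<phi> u, \<phi> v} \<in> P (\<kappa> m)"
        using K' R by (auto simp: K'_def realizes_def)
      \<comment> \<open>Facts that survive the filter have an end off the triangle, so the flip does
        not touch their edges.\<close>
      have "\<not> (u \<in> {x, y, z} \<and> v \<in> {x, y, z})" using K' by (auto simp: K'_def)
      then have "{\<phi> u, \<phi> v} \<notin> triangle_edges ?x ?y ?z"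
        using xyz K(1,2) eq by (auto simp: triangle_edges_def doubleton_eq_iff)
      then show ?thesis using off realizes_colour[OF R K(3)] K(4) by blast
    qed
    then show ?thesis using R by (auto simp: realizes_def K'_def)
  qed
  \<comment> \<open>An edge has only one colour and \<open>\<kappa>\<close> is injective, so a
    recorded colour is the true one.\<close>
  have same: "m = n" if "colour_of K u v = Some m" "n < d" "{\<phi> u, \<phi> v} \<in> P (\<kappa> n)" for u v m n
  proof -
    note m = colour_of_SomeD[OF that(1) R]
    then have "\<kappa> m = \<kappa> n"
      using cf_partition_colour_unique[OF P realizes_colour[OF R m(1)] realizes_colour[OF R that(2)]] that(3)
      by blast
    then show ?thesis using bij(2) m(1) that(2) by (auto simp: bij_betw_def inj_on_def)
  qed
  \<comment> \<open>In both admissible forms of the rule, the two edges at \<open>x\<close> have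
    recorded colours; otherwise \<open>expand\<close> would return \<open>None\<close>.\<close>
  have "\<exists>i0 j0. colour_of K x y = Some i0 \<and> colour_of K x z = Some j0"
    using e xyz by (cases "colour_of K x y"; cases "colour_of K x z") (auto simp: Let_def)
  then have xy: "colour_of K x y = Some i" and xz: "colour_of K x z = Some j"
    using same c by blast+
  have new: "realizes d \<phi> \<kappa> ((x, y, a) # (x, z, b) # (y, z, c') # K') Q"
    using K'Q Q(5-7) abc xyz abc_lt by (simp add: realizes_Cons)
  have "\<exists>K''\<in>set Ks. realizes d \<phi> \<kappa> K'' Q"
  proof (cases "colour_of K y z")
    case (Some k0)
    then have "colour_of K y z = Some k" using same c by blast
    let ?g = "\<lambda>(a, b, c). (x, y, a) # (x, z, b) # (y, z, c) # K'"
    from \<open>colour_of K y z = Some k\<close> have "Ks = map ?g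
        (remdups (removeAll (i, j, k) (rearrangements (i, j, k))))"
      using e xy xz xyz unfolding K'_def by (simp add: Let_def del: rearrangements.simps)
    moreover have "(a, b, c') \<in> set (remdups (removeAll (i, j, k) (rearrangements (i, j, k))))"
      using abc(1) abc_ne by (simp del: rearrangements.simps)
    ultimately have "?g (a, b, c') \<in> set Ks" by (simp only: set_map imageI)
    then have "(x, y, a) # (x, z, b) # (y, z, c') # K' \<in> set Ks" by simp
    then show ?thesis using new by blast
  next
    case None
    then have ij: "i = j" and Ks: "Ks = [(x, y, i) # (y, z, i) # K', (x, z, i) # (y, z, i) # K']"
      using e xy xz xyz unfolding K'_def by (auto simp: Let_def split: if_splits)
    \<comment> \<open>Any other arrangement of \<open>(i, i, k)\<close> puts \<open>i\<close> on
      \<open>{y, z}\<close> and on one of the edges at \<open>x\<close>. The remaining edge takes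
      the unknown colour \<open>k\<close>, and the new position records nothing for it.\<close>
    have "a = i \<and> c' = i \<or> b = i \<and> c' = i" using abc(1) abc_ne ij by auto
    then show ?thesis using new Ks by (auto simp: realizes_Cons)
  qed
  then show ?thesis using Q(1) we by blast
qed

lemma expand_sound:
  assumes P: "P \<in> cf_partitions d" and R: "realizes d \<phi> \<kappa> K P" and e: "expand d K r = Some Ks"
  shows "\<exists>K'\<in>set Ks. \<exists>Q\<in>cf_partitions d. realizes d \<phi> \<kappa> K' Q \<and>
    (\<forall>S. weakly_equivalent d Q S \<longrightarrow> weakly_equivalent d P S)"
proof (cases r)
  case (Cycle c vs)
  then show ?thesis using expand_Cycle_unrealizable[OF P R] e by simp
next
  case (Cut c S)
  then show ?thesis using expand_Cut_sound[OF P R] e P by blast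
next
  case (Branch u v)
  then show ?thesis using expand_Branch_sound[OF P R] e P by blast
next
  case (Flip x y z)
  then show ?thesis using expand_Flip_sound[OF P R] e by blast
qed

lemma permutation_list_bij:
  assumes "permutation_list n vs"
  shows "bij_betw ((!) vs) {..<n} {..<n}"
proof -
  have "set vs = {..<n}"
    using assms by (intro card_subset_eq) (auto simp: permutation_list_def list_all_iff distinct_card)
  moreover have "bij_betw ((!) vs) {..<length vs} (set vs)"
    using assms by (intro bij_betw_nth) (auto simp: permutation_list_def)
  ultimately show ?thesis using assms by (simp add: permutation_list_def)
qed

text \<open>At a \<open>Node\<close> the partition at hand, possibly after a flip, realizes one of
  the successors, and all of them are won. At a \<open>Goal\<close> it realizes a settled entry
  under other names.\<close>

lemma check_sound:
  assumes "check d Gs K c" "\<forall>G\<in>set Gs. reaches d T G"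
  shows "reaches d T K"
  using assms(1)
proof (induction c arbitrary: K)
  case (Goal g vs cs)
  then have g: "reaches d T (Gs ! g)" and vs: "permutation_list (2 * d) vs" and cs: "permutation_list d cs"
    and col: "\<And>u v c. (u, v, c) \<in> set (Gs ! g) \<Longrightarrow>
      u < 2 * d \<and> v < 2 * d \<and> c < d \<and> colour_of K (vs ! u) (vs ! v) = Some (cs ! c)"
    using assms(2) by (auto simp: list_all_iff)
  show ?case
    unfolding reaches_def
  proof (intro ballI impI)
    fix P assume P: "P \<in> cf_partitions d" "\<exists>\<phi> \<kappa>. realizes d \<phi> \<kappa> K P"
    then obtain \<phi> \<kappa> where R: "realizes d \<phi> \<kappa> K P" by blast
    \<comment> \<open>The lists translate from the names of the cited entry to those of
      \<open>K\<close>, and the old bijections translate from there to actual vertices and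
      colours.\<close>
    have "realizes d (\<phi> \<circ> (!) vs) (\<kappa> \<circ> (!) cs) (Gs ! g) P"
      unfolding realizes_def
    proof (intro conjI)
      show "bij_betw (\<phi> \<circ> (!) vs) {..<2 * d} {1..2 * d}" "bij_betw (\<kappa> \<circ> (!) cs) {..<d} {1..d}"
        using R bij_betw_trans[OF permutation_list_bij[OF vs]] bij_betw_trans[OF permutation_list_bij[OF cs]]
        unfolding realizes_def by blast+
      show "\<forall>(u, v, c)\<in>set (Gs ! g). u < 2 * d \<and> v < 2 * d \<and> c < d \<and>
          {(\<phi> \<circ> (!) vs) u, (\<phi> \<circ> (!) vs) v} \<in> P ((\<kappa> \<circ> (!) cs) c)"
      proof (clarify, intro conjI)
        fix u v c assume "(u, v, c) \<in> set (Gs ! g)"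
        note uvc = col[OF this]
        then show "u < 2 * d" "v < 2 * d" "c < d" by simp_all
        show "{(\<phi> \<circ> (!) vs) u, (\<phi> \<circ> (!) vs) v} \<in> P ((\<kappa> \<circ> (!) cs) c)"
          using uvc colour_of_SomeD(2)[OF _ R] by simp
      qed
    qed
    then show "\<exists>Q\<in>cf_partitions d. weakly_equivalent d P Q \<and> (\<exists>\<phi> \<kappa>. realizes d \<phi> \<kappa> T Q)"
      using g P(1) unfolding reaches_def by blast
  qed
next
  case (Node r cs)
  from Node.prems obtain Ks where e: "expand d K r = Some Ks" and all: "list_all2 (check d Gs) Ks cs"
    unfolding check.simps by (cases "expand d K r") simp_all
  have sub: "reaches d T K'" if "K' \<in> set Ks" for K'
  proof -
    from that obtain n where n: "n < length Ks" "Ks ! n = K'" by (auto simp: in_set_conv_nth)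
    have "check d Gs K' (cs ! n)" using list_all2_nthD[OF all n(1)] n(2) by simp
    moreover have "cs ! n \<in> set cs" using n(1) list_all2_lengthD[OF all] by simp
    ultimately show ?thesis by (intro Node.IH)
  qed
  show ?case
    unfolding reaches_def
  proof (intro ballI impI)
    fix P assume P: "P \<in> cf_partitions d" "\<exists>\<phi> \<kappa>. realizes d \<phi> \<kappa> K P"
    then obtain \<phi> \<kappa> where R: "realizes d \<phi> \<kappa> K P" by blast
    obtain K' Q where K': "K' \<in> set Ks" "Q \<in> cf_partitions d" "realizes d \<phi> \<kappa> K' Q"
        "\<forall>S. weakly_equivalent d Q S \<longrightarrow> weakly_equivalent d P S"
      using expand_sound[OF P(1) R e] by blast
    have "\<exists>S\<in>cf_partitions d. weakly_equivalent d Q S \<and> (\<exists>\<phi> \<kappa>. realizes d \<phi> \<kappa> T S)"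
      using sub[OF K'(1)] K'(2,3) unfolding reaches_def by blast
    then show "\<exists>S\<in>cf_partitions d. weakly_equivalent d P S \<and> (\<exists>\<phi> \<kappa>. realizes d \<phi> \<kappa> T S)"
      using K'(4) by blast
  qed
qed

lemma check_all_sound:
  assumes "check_all d Gs cs" "\<forall>G\<in>set Gs. reaches d T G"
  shows "\<forall>K\<in>fst ` set cs. reaches d T K"
  using assms
proof (induction cs arbitrary: Gs)
  case (Cons kc cs)
  obtain K c where kc: "kc = (K, c)" by (cases kc)
  have "reaches d T K" using check_sound[of d Gs K c T] Cons.prems kc by simp
  then show ?case using Cons.IH[of "Gs @ [K]"] Cons.prems kc by simp
qed simp

lemma reaches_self: "reaches d T T"
  unfolding reaches_def using weakly_equivalent_refl by blast

lemma bij_betw_Suc_lessThan: "bij_betw Suc {..<n} {1..n}"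
  by (rule bij_betwI[of _ _ _ "\<lambda>n. n - 1"]) auto

text \<open>The edges of \<open>twin_star_4\<close> with all vertices lowered by one, in colour
  0.\<close>

definition twin_star_facts :: facts where
  "twin_star_facts = [(0, 1, 0), (0, 2, 0), (0, 4, 0), (0, 6, 0), (1, 3, 0), (1, 5, 0), (1, 7, 0)]"

text \<open>The facts yield only an inclusion of the twin star in a part. That part is a spanning
  tree on eight vertices and has seven edges, as many as the twin star, so the inclusion is an
  equality.\<close>

lemma realizes_twin_star:
  assumes P: "P \<in> cf_partitions 4" and R: "realizes 4 \<phi> \<kappa> twin_star_facts P"
  shows "\<exists>i\<in>{1..4}. isomorphic_graphs 8 (P i) twin_star_4"
proof -
  have \<phi>: "bij_betw \<phi> {..<8} {1..8}" using R by (simp add: realizes_def)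
  have i: "\<kappa> 0 \<in> {1..4}" using realizes_colour[OF R] by simp
  \<comment> \<open>\<open>f\<close> undoes \<open>\<phi>\<close> and shifts back to vertices
    counted from 1, so it carries the realized copy onto \<open>twin_star_4\<close> itself.\<close>
  define f where "f = Suc \<circ> inv_into {..<8} \<phi>"
  have f: "bij_betw f {1..8} {1..8}"
    unfolding f_def using bij_betw_trans[OF bij_betw_inv_into[OF \<phi>] bij_betw_Suc_lessThan] .
  have f\<phi>: "f (\<phi> u) = Suc u" if "u < 8" for u
    using that \<phi> by (simp add: f_def bij_betw_inv_into_left[OF \<phi>])
  have sub: "twin_star_4 \<subseteq> relabel f (P (\<kappa> 0))"
  proof -
    have "{Suc u, Suc v} \<in> relabel f (P (\<kappa> 0))" if "(u, v, 0) \<in> set twin_star_facts" for u v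
    proof -
      have "u < 8" "v < 8" "{\<phi> u, \<phi> v} \<in> P (\<kappa> 0)" using R that by (auto simp: realizes_def)
      then show ?thesis unfolding relabel_def using f\<phi> by (intro image_eqI[of _ _ "{\<phi> u, \<phi> v}"]) auto
    qed
    from this[of 0 1] this[of 0 2] this[of 0 4] this[of 0 6] this[of 1 3] this[of 1 5] this[of 1 7]
    show ?thesis by (simp add: twin_star_facts_def twin_star_4_def eval_nat_numeral)
  qed
  have fin: "finite (P (\<kappa> 0))" using cf_partitionsD(5)[OF P i] finite_nsets2 by blast
  have "card (relabel f (P (\<kappa> 0))) \<le> card (P (\<kappa> 0))"
    unfolding relabel_def by (rule card_image_le[OF fin])
  also have "\<dots> = card twin_star_4"
    using cf_partition_card[OF P i] by (simp add: twin_star_4_def doubleton_eq_iff)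
  finally have "twin_star_4 = relabel f (P (\<kappa> 0))"
    using sub fin by (intro card_seteq) (auto simp: relabel_def)
  then show ?thesis using f i unfolding isomorphic_graphs_def by metis
qed

subsection \<open>The strategy\<close>

text \<open>\<open>Goal g vs cs\<close> refers to entry number \<open>g\<close>, where number 0 is the twin star itself. Landmarks:
  number 49 is a vertex of degree 4, number 108 a vertex of degree 3, number 110 a vertex all of whose
  degrees are at most 2; numbers 26 and 39 are the stages in which the three edges away from a vertex of
  degree 4 form \<open>P\<^sub>3 + K\<^sub>2\<close> and \<open>P\<^sub>4\<close>.\<close>

definition twin_star_strategy :: "(facts \<times> certificate) list" where
  "twin_star_strategy = [
  ([(0, 1, 0), (0, 2, 0), (0, 3, 0), (0, 4, 0), (0, 5, 0)], Node (Branch 0 6) [Node (Cut 1 [0]) [Node (Cut 2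
    [0]) []], Node (Cut 2 [0]) [Node (Cut 3 [0]) []], Node (Cut 1 [0]) [Node (Cut 3 [0]) []], Node (Cut 1 [0])
    [Node (Cut 2 [0]) []]]),
  ([(0, 1, 0), (0, 2, 0), (0, 3, 0), (0, 4, 0), (1, 5, 0), (1, 6, 0), (1, 7, 0)], Goal 0 [0, 1, 2, 5, 3, 6, 4,
    7] [0, 1, 2, 3]),
  ([(0, 1, 0), (0, 2, 0), (0, 3, 0), (0, 4, 0), (1, 5, 0), (5, 6, 0), (5, 7, 0)], Node (Flip 1 5 0) [Goal 2
    [0, 5, 2, 3, 4, 1, 6, 7] [0, 1, 2, 3], Goal 1 [0, 1, 2, 3, 4, 5, 6, 7] [0, 1, 2, 3]]),
  ([(0, 1, 0), (0, 2, 0), (0, 3, 0), (0, 4, 0), (1, 5, 0), (1, 6, 0), (2, 7, 0), (1, 2, 1), (1, 3, 1), (2, 5,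
    1), (1, 7, 2), (2, 6, 2), (3, 4, 2), (1, 4, 3), (2, 3, 3), (2, 4, 3)], Node (Branch 3 5) [Node (Cycle 0
    [1, 5, 3, 0]) [], Node (Cycle 1 [2, 5, 3, 1]) [], Node (Flip 2 3 4) [Node (Flip 1 2 3) [Node (Cycle 3 [3,
    4, 1]) [], Node (Flip 1 2 7) [Node (Cut 2 [1]) [], Node (Cut 3 [2]) [], Goal 2 [0, 1, 2, 3, 4, 5, 6, 7]
    [0, 1, 2, 3], Node (Cycle 0 [1, 2, 0]) [], Node (Cycle 0 [1, 2, 0]) []]], Node (Flip 2 3 5) [Node (Cycle 1
    [2, 3, 1]) [], Node (Flip 1 2 7) [Node (Cut 2 [1]) [], Node (Cut 1 [2]) [], Goal 2 [0, 1, 2, 3, 4, 5, 6,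
    7] [0, 1, 2, 3], Node (Cycle 0 [1, 2, 0]) [], Node (Cycle 0 [1, 2, 0]) []]]], Node (Flip 2 3 5) [Node
    (Cycle 1 [2, 3, 1]) [], Node (Flip 1 2 7) [Node (Cut 2 [1]) [], Node (Cut 1 [2]) [], Goal 2 [0, 1, 2, 3,
    4, 5, 6, 7] [0, 1, 2, 3], Node (Cycle 0 [1, 2, 0]) [], Node (Cycle 0 [1, 2, 0]) []]]]),
  ([(0, 1, 0), (0, 2, 0), (0, 3, 0), (0, 4, 0), (1, 5, 0), (1, 6, 0), (2, 7, 0), (1, 2, 1), (1, 3, 1), (2, 5,
    1), (1, 7, 2), (2, 6, 2), (3, 4, 2), (1, 4, 3), (2, 4, 3)], Node (Branch 2 3) [Node (Cycle 0 [2, 3, 0])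
    [], Node (Cycle 1 [2, 3, 1]) [], Node (Flip 1 2 6) [Node (Flip 1 2 5) [Node (Cycle 0 [1, 2, 0]) [], Goal 2
    [0, 2, 1, 3, 4, 5, 6, 7] [0, 1, 2, 3]], Node (Cycle 0 [1, 2, 0]) [], Node (Cycle 0 [1, 2, 0]) [], Node
    (Flip 1 2 4) [Node (Flip 1 2 5) [Node (Cut 1 [2]) [], Node (Cycle 0 [1, 2, 0]) [], Node (Cycle 0 [1, 2,
    0]) [], Goal 2 [0, 2, 1, 3, 4, 5, 6, 7] [0, 1, 2, 3], Node (Cut 3 [1]) []], Node (Cycle 2 [3, 4, 2]) []],
    Node (Flip 1 2 7) [Goal 2 [0, 1, 2, 3, 4, 5, 6, 7] [0, 1, 2, 3], Node (Cycle 0 [1, 2, 0]) []]], Goal 4 [0,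
    1, 2, 3, 4, 5, 6, 7] [0, 1, 2, 3]]),
  ([(0, 1, 0), (0, 2, 0), (0, 3, 0), (0, 4, 0), (1, 5, 0), (1, 6, 0), (2, 7, 0), (1, 2, 1), (1, 3, 1), (2, 5,
    1), (1, 7, 2), (2, 6, 2), (1, 4, 3), (2, 4, 3)], Node (Branch 3 4) [Node (Cycle 0 [3, 4, 0]) [], Node
    (Flip 1 2 4) [Node (Cycle 1 [3, 4, 1]) [], Node (Flip 4 2 3) [Node (Flip 1 2 7) [Node (Cut 2 [1]) [], Node
    (Cut 3 [2]) [], Goal 2 [0, 1, 2, 3, 4, 5, 6, 7] [0, 1, 2, 3], Node (Cycle 0 [1, 2, 0]) [], Node (Cycle 0
    [1, 2, 0]) []], Node (Branch 2 4) [Node (Cycle 0 [2, 4, 0]) [], Node (Cycle 1 [3, 4, 2]) [], Node (Flip 1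
    2 7) [Node (Cut 2 [1]) [], Node (Cut 3 [2]) [], Goal 2 [0, 1, 2, 3, 4, 5, 6, 7] [0, 1, 2, 3], Node (Cycle
    0 [1, 2, 0]) [], Node (Cycle 0 [1, 2, 0]) []], Node (Cycle 3 [2, 4, 1]) []]]], Goal 5 [0, 1, 2, 3, 4, 5,
    6, 7] [0, 1, 2, 3], Node (Branch 2 3) [Node (Cycle 0 [2, 3, 0]) [], Node (Cycle 1 [2, 3, 1]) [], Node
    (Flip 2 3 6) [Node (Flip 1 2 3) [Node (Cut 2 [2]) [Node (Flip 1 2 7) [Goal 2 [0, 1, 2, 3, 4, 5, 6, 7] [0,
    1, 2, 3], Node (Cycle 2 [2, 6, 3, 1]) [], Node (Cycle 2 [2, 6, 3, 1]) [], Node (Cycle 0 [1, 2, 0]) [],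
    Node (Cycle 0 [1, 2, 0]) []]], Node (Flip 1 2 7) [Goal 2 [0, 1, 2, 3, 4, 5, 6, 7] [0, 1, 2, 3], Node
    (Cycle 0 [1, 2, 0]) []]], Node (Branch 2 3) [Node (Cycle 0 [2, 3, 0]) [], Node (Cycle 1 [2, 3, 1]) [],
    Node (Cycle 2 [3, 6, 2]) [], Node (Cycle 3 [3, 4, 2]) []]], Node (Cycle 3 [3, 4, 2]) []]]),
  ([(0, 1, 0), (0, 2, 0), (0, 3, 0), (0, 4, 0), (1, 5, 0), (1, 6, 0), (2, 7, 0), (1, 2, 1), (1, 3, 1), (2, 5,
    1), (1, 7, 2), (2, 6, 2), (1, 4, 3)], Node (Branch 2 4) [Node (Cycle 0 [2, 4, 0]) [], Node (Flip 1 2 3)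
    [Node (Cut 3 [2]) [], Node (Cut 3 [2]) [Node (Flip 1 2 7) [Node (Cut 2 [1]) [], Node (Cut 3 [2]) [], Goal
    2 [0, 1, 2, 3, 4, 5, 6, 7] [0, 1, 2, 3], Node (Cycle 0 [1, 2, 0]) [], Node (Cycle 0 [1, 2, 0]) []]]], Node
    (Flip 1 2 3) [Node (Cut 3 [2]) [], Node (Cut 3 [2]) [Node (Flip 1 2 7) [Node (Cut 2 [1]) [], Node (Cut 3
    [2]) [], Goal 2 [0, 1, 2, 3, 4, 5, 6, 7] [0, 1, 2, 3], Node (Cycle 0 [1, 2, 0]) [], Node (Cycle 0 [1, 2,
    0]) []]]], Goal 6 [0, 1, 2, 3, 4, 5, 6, 7] [0, 1, 2, 3]]),
  ([(0, 1, 0), (0, 2, 0), (0, 3, 0), (0, 4, 0), (1, 5, 0), (1, 6, 0), (2, 7, 0), (1, 2, 1), (1, 3, 1), (2, 5,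
    1), (1, 7, 2), (2, 3, 2), (2, 4, 2), (1, 4, 3), (2, 6, 3)], Node (Branch 3 5) [Node (Cycle 0 [1, 5, 3, 0])
    [], Node (Cycle 1 [2, 5, 3, 1]) [], Node (Flip 2 3 5) [Node (Cycle 1 [2, 3, 1]) [], Node (Flip 1 2 7)
    [Node (Cut 2 [1]) [], Node (Cut 1 [2]) [], Goal 2 [0, 1, 2, 3, 4, 5, 6, 7] [0, 1, 2, 3], Node (Cycle 0 [1,
    2, 0]) [], Node (Cycle 0 [1, 2, 0]) []]], Node (Flip 2 3 4) [Node (Flip 1 2 3) [Node (Cut 2 [2]) [Node
    (Flip 1 2 7) [Goal 2 [0, 1, 2, 3, 4, 5, 6, 7] [0, 1, 2, 3], Node (Cycle 2 [2, 4, 3, 1]) [], Node (Cycle 2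
    [2, 4, 3, 1]) [], Node (Cycle 0 [1, 2, 0]) [], Node (Cycle 0 [1, 2, 0]) []]], Node (Flip 1 2 7) [Goal 2
    [0, 1, 2, 3, 4, 5, 6, 7] [0, 1, 2, 3], Node (Cycle 0 [1, 2, 0]) []]], Node (Branch 2 3) [Node (Cycle 0 [2,
    3, 0]) [], Node (Cycle 1 [2, 3, 1]) [], Node (Cycle 2 [3, 4, 2]) [], Node (Flip 2 3 5) [Node (Cycle 1 [2,
    3, 1]) [], Node (Flip 1 2 7) [Node (Cut 2 [1]) [], Node (Cut 1 [2]) [], Goal 2 [0, 1, 2, 3, 4, 5, 6, 7]
    [0, 1, 2, 3], Node (Cycle 0 [1, 2, 0]) [], Node (Cycle 0 [1, 2, 0]) []]]]]]),
  ([(0, 1, 0), (0, 2, 0), (0, 3, 0), (0, 4, 0), (1, 5, 0), (1, 6, 0), (2, 7, 0), (1, 2, 1), (1, 3, 1), (2, 5,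
    1), (1, 7, 2), (2, 4, 2), (3, 6, 2), (1, 4, 3), (2, 3, 3), (2, 6, 3)], Node (Branch 3 4) [Node (Cycle 0
    [3, 4, 0]) [], Node (Flip 1 2 4) [Node (Cut 2 [2]) [], Node (Cycle 1 [3, 4, 1]) [], Node (Cut 2 [2]) [],
    Node (Cycle 1 [3, 4, 1]) [], Node (Flip 1 2 7) [Goal 2 [0, 1, 2, 3, 4, 5, 6, 7] [0, 1, 2, 3], Node (Cycle
    0 [1, 2, 0]) []]], Node (Flip 1 3 6) [Node (Flip 1 2 5) [Node (Cycle 0 [1, 2, 0]) [], Node (Flip 2 3 6)
    [Goal 2 [0, 2, 1, 3, 4, 5, 6, 7] [0, 1, 2, 3], Node (Cycle 0 [2, 3, 0]) []]], Node (Cycle 0 [1, 3, 0]) [],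
    Node (Cycle 0 [1, 3, 0]) [], Node (Flip 1 2 5) [Node (Cycle 0 [1, 2, 0]) [], Node (Flip 2 3 6) [Goal 2 [0,
    2, 1, 3, 4, 5, 6, 7] [0, 1, 2, 3], Node (Cycle 0 [2, 3, 0]) []]], Node (Flip 1 2 7) [Goal 2 [0, 1, 2, 3,
    4, 5, 6, 7] [0, 1, 2, 3], Node (Cycle 2 [2, 4, 3, 1]) [], Node (Cycle 2 [2, 4, 3, 1]) [], Node (Cycle 0
    [1, 2, 0]) [], Node (Cycle 0 [1, 2, 0]) []]], Node (Flip 1 2 5) [Node (Cycle 0 [1, 2, 0]) [], Node (Flip 1
    2 6) [Goal 2 [0, 2, 1, 3, 4, 5, 6, 7] [0, 1, 2, 3], Node (Cycle 0 [1, 2, 0]) [], Node (Cycle 0 [1, 2, 0])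
    [], Node (Cycle 3 [2, 3, 4, 1]) [], Node (Cycle 3 [2, 3, 4, 1]) []]]]),
  ([(0, 1, 0), (0, 2, 0), (0, 3, 0), (0, 4, 0), (1, 5, 0), (1, 6, 0), (2, 7, 0), (1, 2, 1), (1, 3, 1), (2, 5,
    1), (1, 7, 2), (2, 4, 2), (1, 4, 3), (2, 3, 3), (2, 6, 3)], Node (Branch 3 6) [Node (Cycle 0 [1, 6, 3, 0])
    [], Node (Flip 1 2 3) [Node (Flip 1 2 5) [Node (Cycle 0 [1, 2, 0]) [], Node (Flip 1 2 6) [Node (Cut 3 [2])
    [], Node (Cycle 0 [1, 2, 0]) [], Node (Cycle 0 [1, 2, 0]) [], Goal 2 [0, 2, 1, 3, 4, 5, 6, 7] [0, 1, 2,
    3], Node (Cycle 1 [3, 6, 2]) []]], Node (Flip 1 2 4) [Node (Cut 2 [2]) [], Node (Flip 1 2 7) [Goal 2 [0,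
    1, 2, 3, 4, 5, 6, 7] [0, 1, 2, 3], Node (Cycle 0 [1, 2, 0]) []]]], Goal 9 [0, 1, 2, 3, 4, 5, 6, 7] [0, 1,
    2, 3], Node (Cycle 3 [3, 6, 2]) []]),
  ([(0, 1, 0), (0, 2, 0), (0, 3, 0), (0, 4, 0), (1, 5, 0), (1, 6, 0), (2, 7, 0), (1, 2, 1), (1, 3, 1), (2, 5,
    1), (1, 7, 2), (2, 4, 2), (1, 4, 3), (2, 6, 3)], Node (Branch 2 3) [Node (Cycle 0 [2, 3, 0]) [], Node
    (Cycle 1 [2, 3, 1]) [], Goal 8 [0, 1, 2, 3, 4, 5, 6, 7] [0, 1, 2, 3], Goal 10 [0, 1, 2, 3, 4, 5, 6, 7] [0,
    1, 2, 3]]),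
  ([(0, 1, 0), (0, 2, 0), (0, 3, 0), (0, 4, 0), (1, 5, 0), (1, 6, 0), (2, 7, 0), (1, 2, 1), (1, 3, 1), (2, 5,
    1), (1, 7, 2), (1, 4, 3), (2, 6, 3)], Node (Branch 2 4) [Node (Cycle 0 [2, 4, 0]) [], Node (Flip 1 2 3)
    [Node (Cut 2 [2]) [], Node (Cut 2 [2]) [Node (Flip 1 2 7) [Goal 2 [0, 1, 2, 3, 4, 5, 6, 7] [0, 1, 2, 3],
    Node (Cycle 0 [1, 2, 0]) []]]], Goal 11 [0, 1, 2, 3, 4, 5, 6, 7] [0, 1, 2, 3], Node (Flip 1 2 3) [Node
    (Cut 2 [2]) [], Node (Cut 2 [2]) [Node (Flip 1 2 7) [Goal 2 [0, 1, 2, 3, 4, 5, 6, 7] [0, 1, 2, 3], Node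
    (Cycle 0 [1, 2, 0]) []]]]]),
  ([(0, 1, 0), (0, 2, 0), (0, 3, 0), (0, 4, 0), (1, 5, 0), (1, 6, 0), (2, 7, 0), (1, 2, 1), (1, 3, 1), (2, 5,
    1), (1, 7, 2), (1, 4, 3)], Node (Branch 2 6) [Node (Cycle 0 [1, 6, 2, 0]) [], Node (Flip 1 2 5) [Node
    (Cycle 0 [1, 2, 0]) [], Node (Flip 1 2 6) [Node (Cycle 0 [1, 2, 0]) [], Goal 2 [0, 2, 1, 3, 4, 5, 6, 7]
    [0, 1, 2, 3]]], Goal 7 [0, 1, 2, 3, 4, 5, 6, 7] [0, 1, 2, 3], Goal 12 [0, 1, 2, 3, 4, 5, 6, 7] [0, 1, 2,
    3]]),
  ([(0, 1, 0), (0, 2, 0), (0, 3, 0), (0, 4, 0), (1, 5, 0), (1, 6, 0), (2, 7, 0), (1, 2, 1), (1, 3, 1), (2, 4,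
    1), (1, 7, 2), (2, 3, 2), (2, 5, 2), (1, 4, 3), (2, 6, 3)], Node (Branch 3 4) [Node (Cycle 0 [3, 4, 0])
    [], Node (Cycle 1 [2, 4, 3, 1]) [], Node (Flip 2 3 4) [Node (Cycle 1 [2, 3, 1]) [], Node (Flip 1 2 7)
    [Node (Cut 2 [1]) [], Node (Cut 1 [2]) [], Goal 2 [0, 1, 2, 3, 4, 5, 6, 7] [0, 1, 2, 3], Node (Cycle 0 [1,
    2, 0]) [], Node (Cycle 0 [1, 2, 0]) []]], Node (Flip 2 3 5) [Node (Flip 1 2 3) [Node (Cut 2 [2]) [Node
    (Flip 1 2 7) [Goal 2 [0, 1, 2, 3, 4, 5, 6, 7] [0, 1, 2, 3], Node (Cycle 2 [2, 5, 3, 1]) [], Node (Cycle 2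
    [2, 5, 3, 1]) [], Node (Cycle 0 [1, 2, 0]) [], Node (Cycle 0 [1, 2, 0]) []]], Node (Flip 1 2 7) [Goal 2
    [0, 1, 2, 3, 4, 5, 6, 7] [0, 1, 2, 3], Node (Cycle 0 [1, 2, 0]) []]], Node (Branch 2 3) [Node (Cycle 0 [2,
    3, 0]) [], Node (Cycle 1 [2, 3, 1]) [], Node (Cycle 2 [3, 5, 2]) [], Node (Flip 2 3 4) [Node (Cycle 1 [2,
    3, 1]) [], Node (Flip 1 2 7) [Node (Cut 2 [1]) [], Node (Cut 1 [2]) [], Goal 2 [0, 1, 2, 3, 4, 5, 6, 7]
    [0, 1, 2, 3], Node (Cycle 0 [1, 2, 0]) [], Node (Cycle 0 [1, 2, 0]) []]]]]]),
  ([(0, 1, 0), (0, 2, 0), (0, 3, 0), (0, 4, 0), (1, 5, 0), (1, 6, 0), (2, 7, 0), (1, 2, 1), (1, 3, 1), (2, 4,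
    1), (1, 7, 2), (2, 5, 2), (3, 6, 2), (1, 4, 3), (2, 3, 3), (2, 6, 3)], Node (Branch 3 4) [Node (Cycle 0
    [3, 4, 0]) [], Node (Cycle 1 [2, 4, 3, 1]) [], Node (Flip 2 3 6) [Node (Flip 1 2 3) [Node (Cut 3 [2]) [],
    Node (Flip 1 2 7) [Node (Cut 2 [1]) [], Node (Cut 3 [2]) [], Goal 2 [0, 1, 2, 3, 4, 5, 6, 7] [0, 1, 2, 3],
    Node (Cycle 0 [1, 2, 0]) [], Node (Cycle 0 [1, 2, 0]) []]], Node (Flip 2 3 4) [Node (Cycle 1 [2, 3, 1])
    [], Node (Flip 1 2 7) [Node (Cut 2 [1]) [], Node (Cut 1 [2]) [], Goal 2 [0, 1, 2, 3, 4, 5, 6, 7] [0, 1, 2,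
    3], Node (Cycle 0 [1, 2, 0]) [], Node (Cycle 0 [1, 2, 0]) []]]], Node (Flip 2 3 4) [Node (Cycle 1 [2, 3,
    1]) [], Node (Flip 1 2 7) [Node (Cut 2 [1]) [], Node (Cut 1 [2]) [], Goal 2 [0, 1, 2, 3, 4, 5, 6, 7] [0,
    1, 2, 3], Node (Cycle 0 [1, 2, 0]) [], Node (Cycle 0 [1, 2, 0]) []]]]),
  ([(0, 1, 0), (0, 2, 0), (0, 3, 0), (0, 4, 0), (1, 5, 0), (1, 6, 0), (2, 7, 0), (1, 2, 1), (1, 3, 1), (2, 4,
    1), (1, 7, 2), (2, 5, 2), (1, 4, 3), (2, 3, 3), (2, 6, 3)], Node (Branch 3 6) [Node (Cycle 0 [1, 6, 3, 0])
    [], Node (Flip 1 2 5) [Node (Cut 2 [2]) [], Node (Cycle 0 [1, 2, 0]) [], Node (Cycle 0 [1, 2, 0]) [], Node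
    (Flip 1 3 6) [Node (Cycle 0 [1, 3, 0]) [], Node (Flip 2 3 6) [Goal 2 [0, 2, 1, 3, 4, 5, 6, 7] [0, 1, 2,
    3], Node (Cycle 0 [2, 3, 0]) []]], Node (Flip 1 2 7) [Goal 2 [0, 1, 2, 3, 4, 5, 6, 7] [0, 1, 2, 3], Node
    (Cycle 0 [1, 2, 0]) []]], Goal 15 [0, 1, 2, 3, 4, 5, 6, 7] [0, 1, 2, 3], Node (Cycle 3 [3, 6, 2]) []]),
  ([(0, 1, 0), (0, 2, 0), (0, 3, 0), (0, 4, 0), (1, 5, 0), (1, 6, 0), (2, 7, 0), (1, 2, 1), (1, 3, 1), (2, 4,
    1), (1, 7, 2), (2, 5, 2), (1, 4, 3), (2, 6, 3)], Node (Branch 2 3) [Node (Cycle 0 [2, 3, 0]) [], Node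
    (Cycle 1 [2, 3, 1]) [], Goal 14 [0, 1, 2, 3, 4, 5, 6, 7] [0, 1, 2, 3], Goal 16 [0, 1, 2, 3, 4, 5, 6, 7]
    [0, 1, 2, 3]]),
  ([(0, 1, 0), (0, 2, 0), (0, 3, 0), (0, 4, 0), (1, 5, 0), (1, 6, 0), (2, 7, 0), (1, 2, 1), (1, 3, 1), (1, 7,
    2), (2, 5, 2), (1, 4, 3), (2, 6, 3)], Node (Branch 2 4) [Node (Cycle 0 [2, 4, 0]) [], Goal 17 [0, 1, 2, 3,
    4, 5, 6, 7] [0, 1, 2, 3], Node (Flip 1 2 7) [Node (Cut 2 [1]) [], Node (Cut 1 [2]) [Node (Flip 1 2 7)
    [Goal 2 [0, 1, 2, 3, 4, 5, 6, 7] [0, 1, 2, 3], Node (Cycle 1 [2, 3, 1]) [], Node (Cycle 1 [2, 3, 1]) [],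
    Node (Cycle 0 [1, 2, 0]) [], Node (Cycle 0 [1, 2, 0]) []]], Goal 2 [0, 1, 2, 3, 4, 5, 6, 7] [0, 1, 2, 3],
    Node (Cycle 0 [1, 2, 0]) [], Node (Cycle 0 [1, 2, 0]) []], Node (Flip 1 2 7) [Node (Cut 2 [1]) [], Node
    (Cut 1 [2]) [Node (Flip 1 2 7) [Goal 2 [0, 1, 2, 3, 4, 5, 6, 7] [0, 1, 2, 3], Node (Cycle 1 [2, 3, 1]) [],
    Node (Cycle 1 [2, 3, 1]) [], Node (Cycle 0 [1, 2, 0]) [], Node (Cycle 0 [1, 2, 0]) []]], Goal 2 [0, 1, 2,
    3, 4, 5, 6, 7] [0, 1, 2, 3], Node (Cycle 0 [1, 2, 0]) [], Node (Cycle 0 [1, 2, 0]) []]]),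
  ([(0, 1, 0), (0, 2, 0), (0, 3, 0), (0, 4, 0), (1, 5, 0), (1, 6, 0), (2, 7, 0), (1, 2, 1), (1, 3, 1), (1, 7,
    2), (2, 5, 2), (1, 4, 3)], Node (Branch 2 6) [Node (Cycle 0 [1, 6, 2, 0]) [], Goal 7 [0, 1, 2, 3, 4, 6, 5,
    7] [0, 1, 2, 3], Node (Flip 1 2 7) [Node (Cut 2 [1]) [], Node (Flip 1 2 5) [Node (Cycle 0 [1, 2, 0]) [],
    Node (Flip 1 2 6) [Node (Cycle 0 [1, 2, 0]) [], Goal 2 [0, 2, 1, 3, 4, 5, 6, 7] [0, 1, 2, 3]]], Goal 2 [0,
    1, 2, 3, 4, 5, 6, 7] [0, 1, 2, 3], Node (Cycle 0 [1, 2, 0]) [], Node (Cycle 0 [1, 2, 0]) []], Goal 18 [0,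
    1, 2, 3, 4, 5, 6, 7] [0, 1, 2, 3]]),
  ([(0, 1, 0), (0, 2, 0), (0, 3, 0), (0, 4, 0), (1, 5, 0), (1, 6, 0), (2, 7, 0), (1, 2, 1), (1, 3, 1), (1, 7,
    2), (1, 4, 3), (2, 5, 3)], Node (Branch 2 6) [Node (Cycle 0 [1, 6, 2, 0]) [], Goal 12 [0, 1, 2, 3, 4, 6,
    5, 7] [0, 1, 2, 3], Goal 18 [0, 1, 2, 3, 4, 6, 5, 7] [0, 1, 2, 3], Node (Flip 1 2 7) [Node (Cut 2 [1]) [],
    Node (Flip 1 2 5) [Node (Flip 1 2 6) [Goal 2 [0, 2, 1, 3, 4, 5, 6, 7] [0, 1, 2, 3], Node (Cycle 0 [1, 2,
    0]) [], Node (Cycle 0 [1, 2, 0]) [], Goal 2 [0, 2, 1, 3, 4, 5, 6, 7] [0, 1, 2, 3], Node (Cut 2 [1]) []],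
    Node (Cycle 0 [1, 2, 0]) [], Node (Cycle 0 [1, 2, 0]) [], Node (Flip 1 2 6) [Node (Cycle 0 [1, 2, 0]) [],
    Goal 2 [0, 2, 1, 3, 4, 5, 6, 7] [0, 1, 2, 3]], Node (Cut 2 [1]) []], Goal 2 [0, 1, 2, 3, 4, 5, 6, 7] [0,
    1, 2, 3], Node (Cycle 0 [1, 2, 0]) [], Node (Cycle 0 [1, 2, 0]) []]]),
  ([(0, 1, 0), (0, 2, 0), (0, 3, 0), (0, 4, 0), (1, 5, 0), (1, 6, 0), (2, 7, 0), (1, 2, 1), (1, 3, 1), (1, 7,
    2), (1, 4, 3)], Node (Branch 2 5) [Node (Cycle 0 [1, 5, 2, 0]) [], Goal 13 [0, 1, 2, 3, 4, 5, 6, 7] [0, 1,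
    2, 3], Goal 19 [0, 1, 2, 3, 4, 5, 6, 7] [0, 1, 2, 3], Goal 20 [0, 1, 2, 3, 4, 5, 6, 7] [0, 1, 2, 3]]),
  ([(0, 1, 0), (0, 2, 0), (0, 3, 0), (0, 4, 0), (1, 5, 0), (1, 6, 0), (2, 7, 0), (1, 2, 1), (1, 7, 2), (1, 3,
    3), (1, 4, 3)], Node (Branch 3 4) [Node (Cycle 0 [3, 4, 0]) [], Node (Flip 1 3 4) [Goal 21 [0, 1, 2, 4, 3,
    5, 6, 7] [0, 1, 2, 3], Goal 21 [0, 1, 2, 3, 4, 5, 6, 7] [0, 1, 2, 3]], Node (Flip 2 7 0) [Node (Flip 1 3
    4) [Goal 21 [0, 1, 7, 4, 3, 5, 6, 2] [0, 2, 1, 3], Goal 21 [0, 1, 7, 3, 4, 5, 6, 2] [0, 2, 1, 3]], Goal 1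
    [0, 1, 2, 3, 4, 7, 5, 6] [0, 1, 2, 3]], Node (Cycle 3 [3, 4, 1]) []]),
  ([(0, 1, 0), (0, 2, 0), (0, 3, 0), (0, 4, 0), (1, 5, 0), (1, 6, 0), (2, 7, 0), (1, 2, 1), (1, 7, 2), (1, 3,
    3)], Node (Branch 1 4) [Node (Cycle 0 [1, 4, 0]) [], Goal 21 [0, 1, 2, 4, 3, 5, 6, 7] [0, 1, 2, 3], Node
    (Flip 2 7 0) [Goal 21 [0, 1, 7, 4, 3, 5, 6, 2] [0, 2, 1, 3], Goal 1 [0, 1, 2, 3, 4, 7, 5, 6] [0, 1, 2,
    3]], Goal 22 [0, 1, 2, 3, 4, 5, 6, 7] [0, 1, 2, 3]]),
  ([(0, 1, 0), (0, 2, 0), (0, 3, 0), (0, 4, 0), (1, 5, 0), (1, 6, 0), (2, 7, 0), (1, 2, 1), (1, 7, 2)], Node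
    (Branch 1 3) [Node (Cycle 0 [1, 3, 0]) [], Node (Cut 3 [1]) [Goal 21 [0, 1, 2, 3, 4, 5, 6, 7] [0, 1, 2,
    3]], Node (Flip 2 7 0) [Node (Cut 3 [1]) [Goal 21 [0, 1, 7, 3, 4, 5, 6, 2] [0, 2, 1, 3]], Goal 1 [0, 1, 2,
    3, 4, 7, 5, 6] [0, 1, 2, 3]], Goal 23 [0, 1, 2, 3, 4, 5, 6, 7] [0, 1, 2, 3]]),
  ([(0, 1, 0), (0, 2, 0), (0, 3, 0), (0, 4, 0), (1, 5, 0), (1, 6, 0), (2, 7, 0), (1, 2, 1)], Node (Branch 1 7)
    [Node (Cycle 0 [1, 7, 2, 0]) [], Node (Flip 1 2 7) [Goal 2 [0, 1, 2, 3, 4, 5, 6, 7] [0, 1, 2, 3], Node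
    (Cycle 0 [1, 2, 0]) []], Goal 24 [0, 1, 2, 3, 4, 5, 6, 7] [0, 1, 2, 3], Goal 24 [0, 1, 2, 3, 4, 5, 6, 7]
    [0, 1, 3, 2]]),
  ([(0, 1, 0), (0, 2, 0), (0, 3, 0), (0, 4, 0), (1, 5, 0), (1, 6, 0), (2, 7, 0)], Node (Branch 1 2) [Node
    (Cycle 0 [1, 2, 0]) [], Goal 25 [0, 1, 2, 3, 4, 5, 6, 7] [0, 1, 2, 3], Goal 25 [0, 1, 2, 3, 4, 5, 6, 7]
    [0, 2, 1, 3], Goal 25 [0, 1, 2, 3, 4, 5, 6, 7] [0, 3, 1, 2]]),
  ([(0, 1, 0), (0, 2, 0), (0, 3, 0), (0, 4, 0), (1, 5, 0), (2, 7, 0), (5, 6, 0)], Node (Flip 1 5 0) [Goal 26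
    [0, 5, 2, 3, 4, 1, 6, 7] [0, 1, 2, 3], Goal 1 [0, 1, 2, 3, 4, 5, 6, 7] [0, 1, 2, 3]]),
  ([(0, 1, 0), (0, 2, 0), (0, 3, 0), (0, 4, 0), (1, 5, 0), (5, 6, 0), (6, 7, 0), (1, 3, 1), (1, 6, 1), (2, 5,
    1), (1, 7, 2), (1, 2, 3)], Node (Branch 1 4) [Node (Cycle 0 [1, 4, 0]) [], Node (Flip 6 7 5) [Node (Flip 1
    5 7) [Goal 3 [0, 1, 2, 3, 4, 7, 5, 6] [0, 1, 2, 3], Node (Cut 2 [1]) []], Goal 3 [0, 1, 2, 3, 4, 5, 6, 7]
    [0, 1, 2, 3]], Node (Flip 1 5 6) [Goal 3 [0, 1, 2, 3, 4, 6, 5, 7] [0, 1, 2, 3], Node (Flip 1 2 5) [Goal 27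
    [0, 1, 2, 3, 4, 6, 7, 5] [0, 1, 2, 3], Node (Cycle 0 [1, 2, 0]) [], Node (Cycle 0 [1, 2, 0]) [], Goal 27
    [0, 1, 2, 3, 4, 6, 7, 5] [0, 1, 2, 3], Node (Cut 3 [1]) []]], Node (Flip 6 7 5) [Node (Flip 1 5 7) [Goal 3
    [0, 1, 2, 3, 4, 7, 5, 6] [0, 1, 2, 3], Node (Cut 2 [1]) []], Goal 3 [0, 1, 2, 3, 4, 5, 6, 7] [0, 1, 2,
    3]]]),
  ([(0, 1, 0), (0, 2, 0), (0, 3, 0), (0, 4, 0), (1, 5, 0), (5, 6, 0), (6, 7, 0), (1, 6, 1), (2, 5, 1), (1, 7,
    2), (1, 2, 3), (1, 3, 3)], Node (Branch 1 4) [Node (Cycle 0 [1, 4, 0]) [], Goal 28 [0, 1, 2, 4, 3, 5, 6,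
    7] [0, 1, 2, 3], Node (Flip 1 5 6) [Goal 3 [0, 1, 2, 3, 4, 6, 5, 7] [0, 1, 2, 3], Node (Cut 1 [1]) []],
    Node (Flip 1 5 6) [Goal 3 [0, 1, 2, 3, 4, 6, 5, 7] [0, 1, 2, 3], Node (Cut 1 [1]) []]]),
  ([(0, 1, 0), (0, 2, 0), (0, 3, 0), (0, 4, 0), (1, 5, 0), (5, 6, 0), (6, 7, 0), (1, 6, 1), (2, 5, 1), (1, 7,
    2), (1, 2, 3)], Node (Branch 1 3) [Node (Cycle 0 [1, 3, 0]) [], Goal 28 [0, 1, 2, 3, 4, 5, 6, 7] [0, 1, 2,
    3], Node (Flip 1 5 6) [Goal 3 [0, 1, 2, 3, 4, 6, 5, 7] [0, 1, 2, 3], Node (Cut 1 [1]) [Node (Flip 1 2 5)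
    [Goal 27 [0, 1, 2, 3, 4, 6, 7, 5] [0, 1, 2, 3], Node (Cycle 0 [1, 2, 0]) [], Node (Cycle 0 [1, 2, 0]) [],
    Goal 27 [0, 1, 2, 3, 4, 6, 7, 5] [0, 1, 2, 3], Node (Cut 3 [1]) []]]], Goal 29 [0, 1, 2, 3, 4, 5, 6, 7]
    [0, 1, 2, 3]]),
  ([(0, 1, 0), (0, 2, 0), (0, 3, 0), (0, 4, 0), (1, 5, 0), (5, 6, 0), (6, 7, 0), (1, 6, 1), (2, 5, 1), (1, 2,
    3), (2, 7, 3)], Node (Branch 1 7) [Node (Cycle 0 [5, 6, 7, 1]) [], Node (Flip 1 6 7) [Node (Flip 1 2 7)
    [Node (Cycle 0 [1, 2, 0]) [], Goal 27 [0, 1, 2, 3, 4, 5, 6, 7] [0, 1, 2, 3]], Node (Cycle 0 [5, 6, 1])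
    []], Goal 30 [0, 1, 2, 3, 4, 5, 6, 7] [0, 1, 2, 3], Node (Cycle 3 [2, 7, 1]) []]),
  ([(0, 1, 0), (0, 2, 0), (0, 3, 0), (0, 4, 0), (1, 5, 0), (5, 6, 0), (6, 7, 0), (0, 6, 1), (2, 5, 1)], Node
    (Branch 0 5) [Node (Cycle 0 [1, 5, 0]) [], Node (Cut 2 [0]) [Node (Cut 3 [0]) []], Node (Flip 0 2 5) [Node
    (Flip 0 5 6) [Goal 1 [0, 1, 2, 3, 4, 6, 5, 7] [0, 1, 2, 3], Node (Cycle 0 [1, 5, 0]) []], Node (Cycle 0
    [1, 5, 0]) [], Node (Flip 0 5 6) [Goal 27 [0, 1, 6, 3, 4, 5, 2, 7] [0, 1, 2, 3], Node (Cycle 0 [1, 5, 0])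
    []], Node (Cycle 0 [1, 5, 0]) [], Node (Cut 3 [0]) [Node (Flip 0 1 5) [Goal 26 [5, 0, 6, 1, 2, 3, 4, 7]
    [0, 1, 2, 3], Node (Cut 2 [0]) []]]], Node (Flip 0 2 5) [Node (Flip 0 5 6) [Goal 1 [0, 1, 2, 3, 4, 6, 5,
    7] [0, 1, 2, 3], Node (Cycle 0 [1, 5, 0]) []], Node (Cycle 0 [1, 5, 0]) [], Node (Flip 0 5 6) [Goal 27 [0,
    1, 6, 3, 4, 5, 2, 7] [0, 1, 2, 3], Node (Cycle 0 [1, 5, 0]) []], Node (Cycle 0 [1, 5, 0]) [], Node (Cut 2
    [0]) [Node (Flip 0 1 5) [Goal 26 [5, 0, 6, 1, 2, 3, 4, 7] [0, 1, 2, 3], Node (Cut 3 [0]) []]]]]),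
  ([(0, 1, 0), (0, 2, 0), (0, 3, 0), (0, 4, 0), (1, 5, 0), (5, 6, 0), (6, 7, 0), (1, 6, 2), (2, 6, 2), (0, 6,
    3)], Node (Branch 0 5) [Node (Cycle 0 [1, 5, 0]) [], Node (Cut 2 [0]) [Node (Flip 0 2 6) [Node (Cut 3 [0])
    [], Node (Cycle 0 [1, 5, 6, 0]) [], Node (Flip 0 1 6) [Goal 26 [6, 0, 5, 2, 7, 3, 4, 1] [0, 1, 2, 3], Node
    (Cycle 0 [5, 6, 1]) []], Node (Cycle 0 [1, 5, 6, 0]) [], Node (Flip 0 1 6) [Node (Cut 3 [0]) [], Goal 26
    [6, 0, 5, 2, 7, 3, 4, 1] [0, 1, 2, 3], Node (Cycle 0 [5, 6, 1]) [], Node (Cut 3 [0]) [], Node (Cycle 0 [5,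
    6, 1]) []]]], Node (Flip 0 2 6) [Node (Flip 0 1 5) [Node (Cycle 2 [1, 6, 0]) [], Goal 1 [0, 1, 2, 3, 4, 5,
    6, 7] [0, 1, 2, 3]], Node (Cycle 0 [1, 5, 6, 0]) [], Node (Flip 0 1 6) [Goal 26 [6, 0, 5, 2, 7, 3, 4, 1]
    [0, 1, 2, 3], Node (Cycle 0 [5, 6, 1]) []], Node (Cycle 0 [1, 5, 6, 0]) [], Node (Cut 1 [0]) [Node (Flip 0
    1 6) [Node (Cut 3 [0]) [], Goal 26 [6, 0, 5, 2, 7, 3, 4, 1] [0, 1, 2, 3], Node (Cycle 0 [5, 6, 1]) [],
    Node (Cut 3 [0]) [], Node (Cycle 0 [5, 6, 1]) []]]], Node (Cut 1 [0]) [Node (Cut 2 [0]) []]]),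
  ([(0, 1, 0), (0, 2, 0), (0, 3, 0), (0, 4, 0), (1, 5, 0), (5, 6, 0), (6, 7, 0), (2, 5, 1), (1, 6, 2), (2, 6,
    2)], Node (Branch 0 6) [Node (Cycle 0 [1, 5, 6, 0]) [], Goal 32 [0, 1, 2, 3, 4, 5, 6, 7] [0, 1, 2, 3],
    Node (Flip 0 1 6) [Node (Flip 0 2 6) [Node (Cycle 2 [1, 6, 0]) [], Goal 26 [6, 0, 5, 2, 7, 3, 4, 1] [0, 1,
    2, 3]], Node (Cycle 0 [5, 6, 1]) []], Goal 33 [0, 1, 2, 3, 4, 5, 6, 7] [0, 1, 2, 3]]),
  ([(0, 1, 0), (0, 2, 0), (0, 3, 0), (0, 4, 0), (1, 5, 0), (5, 6, 0), (6, 7, 0), (2, 5, 1), (2, 6, 2), (1, 2,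
    3), (2, 7, 3)], Node (Branch 1 6) [Node (Cycle 0 [5, 6, 1]) [], Goal 31 [0, 1, 2, 3, 4, 5, 6, 7] [0, 1, 2,
    3], Goal 34 [0, 1, 2, 3, 4, 5, 6, 7] [0, 1, 2, 3], Node (Flip 2 6 7) [Goal 27 [0, 1, 2, 3, 4, 5, 6, 7] [0,
    1, 2, 3], Node (Cycle 3 [2, 6, 1]) [], Node (Cycle 3 [2, 6, 1]) [], Node (Cycle 0 [1, 5, 6, 2, 0]) [],
    Node (Cycle 0 [1, 5, 6, 2, 0]) []]]),
  ([(0, 1, 0), (0, 2, 0), (0, 3, 0), (0, 4, 0), (1, 5, 0), (5, 6, 0), (6, 7, 0), (2, 5, 1), (2, 6, 2), (1, 2,
    3)], Node (Branch 2 7) [Node (Cycle 0 [1, 5, 6, 7, 2, 0]) [], Node (Flip 6 7 5) [Node (Flip 2 5 7) [Goal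
    27 [0, 2, 1, 3, 4, 7, 6, 5] [0, 1, 2, 3], Node (Cycle 0 [1, 5, 2, 0]) []], Goal 3 [0, 1, 2, 3, 4, 5, 6, 7]
    [0, 1, 2, 3]], Node (Flip 2 6 7) [Goal 27 [0, 1, 2, 3, 4, 5, 6, 7] [0, 1, 2, 3], Node (Cycle 0 [1, 5, 6,
    2, 0]) []], Goal 35 [0, 1, 2, 3, 4, 5, 6, 7] [0, 1, 2, 3]]),
  ([(0, 1, 0), (0, 2, 0), (0, 3, 0), (0, 4, 0), (1, 5, 0), (5, 6, 0), (6, 7, 0), (2, 5, 1), (2, 6, 2)], Node
    (Branch 1 2) [Node (Cycle 0 [1, 2, 0]) [], Node (Flip 1 5 0) [Node (Flip 1 2 5) [Goal 27 [0, 5, 2, 3, 4,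
    6, 7, 1] [0, 1, 2, 3], Node (Cycle 0 [2, 5, 0]) []], Goal 1 [0, 1, 2, 3, 4, 5, 6, 7] [0, 1, 2, 3]], Node
    (Flip 5 6 1) [Goal 3 [0, 1, 2, 3, 4, 6, 5, 7] [0, 1, 2, 3], Node (Flip 1 2 6) [Node (Cycle 0 [1, 2, 0])
    [], Goal 27 [0, 2, 1, 3, 4, 6, 7, 5] [0, 1, 2, 3]]], Goal 36 [0, 1, 2, 3, 4, 5, 6, 7] [0, 1, 2, 3]]),
  ([(0, 1, 0), (0, 2, 0), (0, 3, 0), (0, 4, 0), (1, 5, 0), (5, 6, 0), (6, 7, 0), (2, 5, 1)], Node (Branch 2 6)
    [Node (Cycle 0 [1, 5, 6, 2, 0]) [], Node (Flip 2 5 6) [Goal 27 [0, 2, 1, 3, 4, 6, 7, 5] [0, 1, 2, 3], Node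
    (Cycle 0 [1, 5, 2, 0]) []], Goal 37 [0, 1, 2, 3, 4, 5, 6, 7] [0, 1, 2, 3], Goal 37 [0, 1, 2, 3, 4, 5, 6,
    7] [0, 1, 3, 2]]),
  ([(0, 1, 0), (0, 2, 0), (0, 3, 0), (0, 4, 0), (1, 5, 0), (5, 6, 0), (6, 7, 0)], Node (Branch 2 5) [Node
    (Cycle 0 [1, 5, 2, 0]) [], Goal 38 [0, 1, 2, 3, 4, 5, 6, 7] [0, 1, 2, 3], Goal 38 [0, 1, 2, 3, 4, 5, 6, 7]
    [0, 2, 1, 3], Goal 38 [0, 1, 2, 3, 4, 5, 6, 7] [0, 3, 1, 2]]),
  ([(0, 1, 0), (0, 2, 0), (0, 3, 0), (0, 4, 0), (1, 5, 0), (1, 6, 0), (6, 7, 0)], Node (Flip 1 5 0) [Goal 39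
    [0, 5, 2, 3, 4, 1, 6, 7] [0, 1, 2, 3], Goal 1 [0, 1, 2, 3, 4, 5, 6, 7] [0, 1, 2, 3]]),
  ([(0, 1, 0), (0, 2, 0), (0, 3, 0), (0, 4, 0), (1, 5, 0), (2, 6, 0), (3, 7, 0), (1, 2, 1), (1, 6, 2), (2, 5,
    3)], Node (Branch 5 6) [Node (Cycle 0 [1, 5, 6, 2, 0]) [], Node (Flip 1 2 5) [Goal 26 [0, 2, 3, 1, 4, 5,
    6, 7] [0, 1, 2, 3], Node (Cycle 0 [1, 2, 0]) [], Node (Cycle 0 [1, 2, 0]) [], Goal 26 [0, 2, 3, 1, 4, 5,
    6, 7] [0, 1, 2, 3], Node (Flip 2 5 6) [Node (Cycle 0 [1, 5, 2, 0]) [], Goal 27 [0, 1, 3, 2, 4, 5, 6, 7]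
    [0, 1, 2, 3]]], Node (Flip 1 5 6) [Node (Cycle 0 [1, 6, 2, 0]) [], Goal 27 [0, 2, 3, 1, 4, 6, 5, 7] [0, 1,
    2, 3]], Node (Flip 2 5 6) [Node (Cycle 0 [1, 5, 2, 0]) [], Goal 27 [0, 1, 3, 2, 4, 5, 6, 7] [0, 1, 2,
    3]]]),
  ([(0, 1, 0), (0, 2, 0), (0, 3, 0), (0, 4, 0), (1, 5, 0), (2, 6, 0), (3, 7, 0), (1, 2, 1), (1, 6, 2)], Node
    (Branch 2 5) [Node (Cycle 0 [1, 5, 2, 0]) [], Node (Flip 1 2 5) [Node (Cycle 0 [1, 2, 0]) [], Goal 26 [0,
    2, 3, 1, 4, 5, 6, 7] [0, 1, 2, 3]], Node (Flip 1 2 5) [Goal 26 [0, 2, 3, 1, 4, 5, 6, 7] [0, 1, 2, 3], Node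
    (Cycle 0 [1, 2, 0]) [], Node (Cycle 0 [1, 2, 0]) [], Goal 26 [0, 2, 3, 1, 4, 5, 6, 7] [0, 1, 2, 3], Node
    (Flip 1 2 6) [Goal 26 [0, 1, 3, 2, 4, 5, 6, 7] [0, 1, 2, 3], Node (Cycle 0 [1, 2, 0]) []]], Goal 41 [0, 1,
    2, 3, 4, 5, 6, 7] [0, 1, 2, 3]]),
  ([(0, 1, 0), (0, 2, 0), (0, 3, 0), (0, 4, 0), (1, 5, 0), (2, 6, 0), (3, 7, 0), (1, 2, 1)], Node (Branch 1 6)
    [Node (Cycle 0 [1, 6, 2, 0]) [], Node (Flip 1 2 6) [Goal 26 [0, 1, 3, 2, 4, 5, 6, 7] [0, 1, 2, 3], Node
    (Cycle 0 [1, 2, 0]) []], Goal 42 [0, 1, 2, 3, 4, 5, 6, 7] [0, 1, 2, 3], Goal 42 [0, 1, 2, 3, 4, 5, 6, 7]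
    [0, 1, 3, 2]]),
  ([(0, 1, 0), (0, 2, 0), (0, 3, 0), (0, 4, 0), (1, 5, 0), (2, 6, 0), (3, 7, 0)], Node (Branch 1 2) [Node
    (Cycle 0 [1, 2, 0]) [], Goal 43 [0, 1, 2, 3, 4, 5, 6, 7] [0, 1, 2, 3], Goal 43 [0, 1, 2, 3, 4, 5, 6, 7]
    [0, 2, 1, 3], Goal 43 [0, 1, 2, 3, 4, 5, 6, 7] [0, 3, 1, 2]]),
  ([(0, 1, 0), (0, 2, 0), (0, 3, 0), (0, 4, 0), (1, 5, 0), (1, 6, 0)], Node (Cut 0 [7]) [Goal 1 [0, 1, 2, 3,
    4, 7, 5, 6] [0, 1, 2, 3], Goal 2 [0, 1, 2, 3, 4, 5, 6, 7] [0, 1, 2, 3], Goal 26 [0, 1, 2, 3, 4, 5, 6, 7]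
    [0, 1, 2, 3], Goal 26 [0, 1, 3, 2, 4, 5, 6, 7] [0, 1, 2, 3], Goal 26 [0, 1, 4, 2, 3, 5, 6, 7] [0, 1, 2,
    3], Goal 40 [0, 1, 2, 3, 4, 6, 5, 7] [0, 1, 2, 3], Goal 40 [0, 1, 2, 3, 4, 5, 6, 7] [0, 1, 2, 3]]),
  ([(0, 1, 0), (0, 2, 0), (0, 3, 0), (0, 4, 0), (1, 5, 0), (5, 6, 0)], Node (Cut 0 [7]) [Goal 1 [0, 1, 2, 3,
    4, 7, 5, 6] [0, 1, 2, 3], Goal 40 [0, 1, 2, 3, 4, 7, 5, 6] [0, 1, 2, 3], Goal 27 [0, 1, 2, 3, 4, 5, 6, 7]
    [0, 1, 2, 3], Goal 27 [0, 1, 3, 2, 4, 5, 6, 7] [0, 1, 2, 3], Goal 27 [0, 1, 4, 2, 3, 5, 6, 7] [0, 1, 2,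
    3], Goal 3 [0, 1, 2, 3, 4, 5, 6, 7] [0, 1, 2, 3], Goal 39 [0, 1, 2, 3, 4, 5, 6, 7] [0, 1, 2, 3]]),
  ([(0, 1, 0), (0, 2, 0), (0, 3, 0), (0, 4, 0), (1, 5, 0), (2, 6, 0)], Node (Cut 0 [7]) [Goal 1 [0, 1, 2, 3,
    4, 7, 5, 6] [0, 1, 2, 3], Goal 26 [0, 1, 2, 3, 4, 5, 7, 6] [0, 1, 2, 3], Goal 26 [0, 2, 1, 3, 4, 6, 7, 5]
    [0, 1, 2, 3], Goal 44 [0, 1, 2, 3, 4, 5, 6, 7] [0, 1, 2, 3], Goal 44 [0, 1, 2, 4, 3, 5, 6, 7] [0, 1, 2,
    3], Goal 27 [0, 1, 2, 3, 4, 5, 7, 6] [0, 1, 2, 3], Goal 27 [0, 2, 1, 3, 4, 6, 7, 5] [0, 1, 2, 3]]),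
  ([(0, 1, 0), (0, 2, 0), (0, 3, 0), (0, 4, 0), (1, 5, 0)], Node (Cut 0 [6, 7]) [Goal 1 [0, 1, 2, 3, 4, 6, 5,
    7] [0, 1, 2, 3], Goal 45 [0, 1, 2, 3, 4, 5, 6, 7] [0, 1, 2, 3], Goal 47 [0, 1, 2, 3, 4, 5, 6, 7] [0, 1, 2,
    3], Goal 47 [0, 1, 3, 2, 4, 5, 6, 7] [0, 1, 2, 3], Goal 47 [0, 1, 4, 2, 3, 5, 6, 7] [0, 1, 2, 3], Goal 46
    [0, 1, 2, 3, 4, 5, 6, 7] [0, 1, 2, 3], Goal 1 [0, 1, 2, 3, 4, 7, 5, 6] [0, 1, 2, 3], Goal 45 [0, 1, 2, 3,
    4, 5, 7, 6] [0, 1, 2, 3], Goal 47 [0, 1, 2, 3, 4, 5, 7, 6] [0, 1, 2, 3], Goal 47 [0, 1, 3, 2, 4, 5, 7, 6]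
    [0, 1, 2, 3], Goal 47 [0, 1, 4, 2, 3, 5, 7, 6] [0, 1, 2, 3], Goal 46 [0, 1, 2, 3, 4, 5, 7, 6] [0, 1, 2,
    3]]),
  ([(0, 1, 0), (0, 2, 0), (0, 3, 0), (0, 4, 0)], Node (Cut 0 [5, 6, 7]) [Goal 1 [0, 1, 2, 3, 4, 5, 6, 7] [0,
    1, 2, 3], Goal 48 [0, 1, 2, 3, 4, 5, 6, 7] [0, 1, 2, 3], Goal 48 [0, 2, 1, 3, 4, 5, 6, 7] [0, 1, 2, 3],
    Goal 48 [0, 3, 1, 2, 4, 5, 6, 7] [0, 1, 2, 3], Goal 48 [0, 4, 1, 2, 3, 5, 6, 7] [0, 1, 2, 3], Goal 1 [0,
    1, 2, 3, 4, 6, 5, 7] [0, 1, 2, 3], Goal 48 [0, 1, 2, 3, 4, 6, 5, 7] [0, 1, 2, 3], Goal 48 [0, 2, 1, 3, 4,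
    6, 5, 7] [0, 1, 2, 3], Goal 48 [0, 3, 1, 2, 4, 6, 5, 7] [0, 1, 2, 3], Goal 48 [0, 4, 1, 2, 3, 6, 5, 7] [0,
    1, 2, 3], Goal 1 [0, 1, 2, 3, 4, 7, 5, 6] [0, 1, 2, 3], Goal 48 [0, 1, 2, 3, 4, 7, 5, 6] [0, 1, 2, 3],
    Goal 48 [0, 2, 1, 3, 4, 7, 5, 6] [0, 1, 2, 3], Goal 48 [0, 3, 1, 2, 4, 7, 5, 6] [0, 1, 2, 3], Goal 48 [0,
    4, 1, 2, 3, 7, 5, 6] [0, 1, 2, 3]]),
  ([(0, 1, 0), (0, 2, 0), (0, 3, 0), (2, 5, 0), (0, 4, 1), (0, 5, 1), (3, 4, 1), (0, 6, 2), (2, 4, 2), (4, 5,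
    2), (0, 7, 3), (4, 6, 3)], Node (Branch 1 4) [Node (Flip 2 4 5) [Node (Cycle 0 [1, 4, 2, 0]) [], Node
    (Flip 0 4 5) [Goal 49 [0, 1, 2, 3, 5, 4, 6, 7] [0, 1, 2, 3], Node (Cycle 0 [1, 4, 0]) []]], Node (Flip 0 4
    5) [Goal 49 [4, 0, 1, 3, 5, 2, 6, 7] [1, 0, 2, 3], Node (Flip 0 2 5) [Node (Flip 0 2 4) [Goal 49 [4, 0, 1,
    3, 5, 2, 6, 7] [1, 0, 2, 3], Node (Cut 1 [0]) []], Node (Cut 1 [0]) []]], Node (Flip 0 4 6) [Node (Cut 2
    [0]) [], Goal 49 [4, 0, 1, 2, 5, 3, 6, 7] [2, 0, 1, 3], Goal 49 [4, 0, 1, 2, 5, 3, 6, 7] [2, 0, 1, 3],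
    Node (Cut 2 [0]) [], Node (Cut 0 [4]) [Node (Flip 0 4 7) [Node (Cut 0 [4]) [], Goal 49 [0, 1, 2, 3, 4, 5,
    6, 7] [0, 1, 2, 3]]]], Node (Cut 0 [4]) [Node (Flip 2 4 5) [Node (Flip 0 4 5) [Node (Cut 2 [4]) [], Node
    (Flip 0 2 4) [Node (Cut 2 [4]) [], Goal 49 [0, 1, 2, 3, 4, 5, 6, 7] [0, 1, 2, 3]]], Node (Flip 0 4 5)
    [Goal 49 [0, 1, 2, 3, 5, 4, 6, 7] [0, 1, 2, 3], Goal 49 [0, 1, 2, 3, 4, 5, 6, 7] [0, 1, 2, 3]]]]]),
  ([(0, 1, 0), (0, 2, 0), (0, 3, 0), (2, 5, 0), (0, 4, 1), (0, 5, 1), (0, 6, 2), (2, 4, 2), (4, 5, 2), (0, 7,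
    3), (3, 4, 3), (4, 6, 3)], Node (Branch 1 4) [Node (Flip 2 4 5) [Node (Cycle 0 [1, 4, 2, 0]) [], Node
    (Flip 0 4 5) [Goal 49 [0, 1, 2, 3, 5, 4, 6, 7] [0, 1, 2, 3], Node (Cycle 0 [1, 4, 0]) []]], Goal 50 [0, 3,
    2, 1, 4, 5, 6, 7] [0, 1, 2, 3], Node (Cut 0 [4]) [Node (Flip 0 4 7) [Node (Cut 0 [4]) [], Node (Cut 1 [4])
    [], Node (Cut 0 [4]) [], Node (Cut 1 [4]) [], Goal 49 [0, 1, 2, 3, 4, 5, 6, 7] [0, 1, 2, 3]]], Node (Cut 0
    [4]) [Node (Flip 0 4 7) [Node (Cut 0 [4]) [], Node (Cut 1 [4]) [], Node (Cut 0 [4]) [], Node (Cut 1 [4])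
    [], Goal 49 [0, 1, 2, 3, 4, 5, 6, 7] [0, 1, 2, 3]]]]),
  ([(0, 1, 0), (0, 2, 0), (0, 3, 0), (2, 5, 0), (0, 4, 1), (0, 5, 1), (0, 6, 2), (2, 4, 2), (4, 5, 2), (0, 7,
    3), (4, 6, 3), (5, 6, 3)], Node (Branch 3 4) [Node (Flip 2 4 5) [Node (Cycle 0 [2, 4, 3, 0]) [], Node
    (Flip 0 4 5) [Goal 49 [0, 1, 2, 3, 5, 4, 6, 7] [0, 1, 2, 3], Node (Cycle 0 [3, 4, 0]) []]], Goal 50 [0, 1,
    2, 3, 4, 5, 6, 7] [0, 1, 2, 3], Node (Flip 0 5 6) [Node (Cut 2 [0]) [], Node (Flip 0 4 5) [Goal 49 [4, 0,
    2, 3, 5, 1, 6, 7] [2, 0, 1, 3], Node (Flip 0 2 5) [Node (Cycle 2 [2, 4, 0]) [], Goal 49 [0, 1, 2, 3, 5, 4,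
    6, 7] [0, 1, 2, 3]]], Node (Flip 0 4 5) [Goal 49 [4, 0, 2, 3, 5, 1, 6, 7] [2, 0, 1, 3], Node (Cut 1 [0])
    []], Node (Cut 2 [0]) [], Node (Flip 0 4 6) [Node (Cut 2 [0]) [], Goal 49 [4, 0, 2, 3, 5, 1, 6, 7] [2, 0,
    1, 3], Node (Cut 1 [0]) [], Node (Cut 2 [0]) [], Node (Cut 1 [0]) []]], Goal 51 [0, 1, 2, 3, 4, 5, 6, 7]
    [0, 1, 2, 3]]),
  ([(0, 1, 0), (0, 2, 0), (0, 3, 0), (2, 5, 0), (0, 4, 1), (0, 5, 1), (0, 6, 2), (2, 4, 2), (4, 5, 2), (0, 7,
    3), (5, 6, 3)], Node (Branch 4 6) [Node (Flip 0 4 5) [Node (Flip 0 2 5) [Node (Flip 0 4 6) [Goal 49 [0, 1,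
    3, 5, 6, 2, 4, 7] [0, 1, 2, 3], Node (Cycle 2 [2, 4, 0]) [], Node (Cycle 2 [2, 4, 0]) [], Goal 49 [0, 1,
    3, 4, 5, 2, 6, 7] [0, 1, 2, 3], Node (Cut 1 [0]) []], Goal 49 [0, 1, 2, 3, 5, 4, 6, 7] [0, 1, 2, 3]], Node
    (Flip 0 4 6) [Goal 49 [0, 1, 2, 3, 6, 4, 5, 7] [0, 1, 2, 3], Goal 49 [0, 1, 2, 3, 4, 5, 6, 7] [0, 1, 2,
    3]]], Node (Flip 0 4 6) [Node (Flip 0 4 5) [Node (Cycle 1 [4, 6, 0]) [], Node (Flip 0 2 5) [Node (Cycle 2
    [2, 4, 0]) [], Goal 49 [0, 1, 2, 3, 5, 4, 6, 7] [0, 1, 2, 3]]], Node (Cut 2 [0]) []], Node (Flip 0 4 5)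
    [Node (Flip 0 2 5) [Node (Cycle 2 [2, 4, 6, 0]) [], Goal 49 [0, 1, 2, 3, 5, 4, 6, 7] [0, 1, 2, 3]], Node
    (Cycle 2 [4, 6, 0]) []], Goal 52 [0, 1, 2, 3, 4, 5, 6, 7] [0, 1, 2, 3]]),
  ([(0, 1, 0), (0, 2, 0), (0, 3, 0), (2, 5, 0), (0, 4, 1), (0, 5, 1), (0, 6, 2), (2, 4, 2), (4, 5, 2), (0, 7,
    3)], Node (Branch 5 6) [Node (Flip 0 4 5) [Node (Flip 0 5 6) [Goal 49 [0, 1, 2, 3, 6, 4, 5, 7] [0, 1, 2,
    3], Node (Cycle 0 [2, 5, 0]) []], Node (Flip 5 6 2) [Node (Flip 0 2 6) [Node (Cycle 2 [2, 4, 0]) [], Goal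
    49 [0, 1, 2, 3, 6, 4, 5, 7] [0, 1, 2, 3]], Node (Flip 0 2 6) [Node (Cycle 2 [2, 4, 0]) [], Goal 49 [0, 1,
    2, 3, 6, 4, 5, 7] [0, 1, 2, 3]]]], Node (Flip 0 5 6) [Node (Flip 0 4 5) [Node (Cycle 1 [5, 6, 0]) [], Node
    (Flip 0 2 5) [Node (Cycle 2 [2, 4, 0]) [], Goal 49 [0, 1, 2, 3, 5, 4, 6, 7] [0, 1, 2, 3]]], Node (Cut 2
    [0]) []], Node (Flip 0 2 5) [Node (Flip 0 2 4) [Node (Cycle 2 [4, 5, 6, 0]) [], Node (Flip 0 2 5) [Node
    (Cycle 2 [5, 6, 0]) [], Goal 49 [0, 1, 2, 3, 5, 4, 6, 7] [0, 1, 2, 3]]], Goal 49 [0, 1, 2, 3, 5, 4, 6, 7]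
    [0, 1, 2, 3]], Goal 53 [0, 1, 2, 3, 4, 5, 6, 7] [0, 1, 2, 3]]),
  ([(0, 1, 0), (0, 2, 0), (0, 3, 0), (2, 5, 0), (0, 4, 1), (0, 5, 1), (1, 2, 1), (1, 5, 1), (4, 5, 2), (2, 4,
    3)], Node (Branch 1 4) [Node (Flip 0 1 4) [Node (Cycle 1 [1, 5, 0]) [], Goal 49 [0, 1, 2, 3, 4, 5, 6, 7]
    [0, 1, 2, 3]], Node (Cycle 1 [4, 1, 5, 0]) [], Node (Flip 1 4 5) [Node (Flip 0 2 5) [Node (Cycle 1 [2, 1,
    4, 0]) [], Goal 49 [0, 1, 2, 3, 5, 4, 6, 7] [0, 1, 2, 3]], Node (Cycle 1 [4, 5, 0]) []], Node (Flip 1 2 4)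
    [Node (Cycle 1 [4, 1, 5, 0]) [], Node (Flip 0 2 5) [Node (Cycle 1 [2, 4, 0]) [], Goal 49 [0, 1, 2, 3, 5,
    4, 6, 7] [0, 1, 2, 3]]]]),
  ([(0, 1, 0), (0, 2, 0), (0, 3, 0), (2, 5, 0), (0, 4, 1), (0, 5, 1), (1, 5, 1), (4, 5, 2), (1, 2, 3), (1, 3,
    3), (2, 4, 3), (3, 5, 3)], Node (Branch 1 4) [Node (Flip 0 1 4) [Node (Cycle 1 [1, 5, 0]) [], Goal 49 [0,
    1, 2, 3, 4, 5, 6, 7] [0, 1, 2, 3]], Node (Cycle 1 [4, 1, 5, 0]) [], Node (Flip 1 4 5) [Node (Flip 1 2 5)
    [Node (Flip 0 1 5) [Node (Cycle 1 [1, 4, 0]) [], Goal 49 [0, 1, 2, 3, 5, 4, 6, 7] [0, 1, 2, 3]], Node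
    (Cycle 3 [3, 5, 1]) [], Node (Flip 0 1 5) [Node (Cycle 1 [1, 4, 0]) [], Goal 49 [0, 1, 2, 3, 5, 4, 6, 7]
    [0, 1, 2, 3]], Node (Cycle 0 [1, 2, 0]) [], Node (Cycle 0 [1, 2, 0]) []], Node (Cycle 1 [4, 5, 0]) []],
    Node (Cycle 3 [2, 4, 1]) []]),
  ([(0, 1, 0), (0, 2, 0), (0, 3, 0), (2, 5, 0), (0, 4, 1), (0, 5, 1), (1, 5, 1), (2, 3, 2), (4, 5, 2), (1, 2,
    3), (1, 3, 3), (2, 4, 3)], Node (Branch 3 5) [Node (Cycle 0 [2, 5, 3, 0]) [], Node (Flip 0 1 5) [Node
    (Cycle 0 [2, 5, 0]) [], Node (Flip 0 3 5) [Node (Cycle 0 [2, 5, 0]) [], Goal 49 [0, 1, 3, 4, 5, 2, 6, 7]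
    [1, 0, 2, 3]]], Node (Flip 2 3 5) [Node (Cycle 0 [2, 3, 0]) [], Node (Flip 0 3 5) [Node (Branch 3 4) [Node
    (Flip 0 3 4) [Goal 49 [0, 1, 2, 4, 5, 3, 6, 7] [0, 1, 2, 3], Node (Cycle 0 [3, 5, 0]) []], Node (Cycle 1
    [3, 4, 0]) [], Node (Cycle 2 [3, 4, 5, 2]) [], Node (Cycle 3 [2, 4, 3, 1]) []], Goal 49 [0, 1, 2, 3, 5, 4,
    6, 7] [0, 1, 2, 3]]], Goal 56 [0, 1, 2, 3, 4, 5, 6, 7] [0, 1, 2, 3]]),
  ([(0, 1, 0), (0, 2, 0), (0, 3, 0), (2, 5, 0), (0, 4, 1), (0, 5, 1), (1, 5, 1), (0, 6, 2), (2, 3, 2), (4, 5,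
    2), (1, 3, 3), (2, 4, 3)], Node (Branch 1 2) [Node (Cycle 0 [1, 2, 0]) [], Goal 55 [0, 1, 2, 3, 4, 5, 6,
    7] [0, 1, 2, 3], Node (Flip 0 1 2) [Node (Flip 0 2 3) [Node (Cycle 0 [1, 2, 0]) [], Node (Flip 0 4 5)
    [Goal 49 [0, 2, 3, 5, 6, 1, 4, 7] [2, 0, 1, 3], Goal 49 [0, 2, 3, 4, 6, 1, 5, 7] [2, 0, 1, 3]]], Node
    (Flip 0 2 3) [Goal 49 [2, 0, 1, 3, 5, 4, 6, 7] [0, 1, 2, 3], Node (Flip 0 4 5) [Goal 49 [0, 1, 2, 5, 6, 3,
    4, 7] [2, 0, 1, 3], Goal 49 [0, 1, 2, 4, 6, 3, 5, 7] [2, 0, 1, 3]]]], Goal 57 [0, 1, 2, 3, 4, 5, 6, 7] [0,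
    1, 2, 3]]),
  ([(0, 1, 0), (0, 2, 0), (0, 3, 0), (2, 5, 0), (0, 4, 1), (0, 5, 1), (1, 5, 1), (0, 6, 2), (2, 3, 2), (4, 5,
    2), (2, 4, 3)], Node (Branch 1 3) [Node (Cycle 0 [1, 3, 0]) [], Node (Flip 0 1 3) [Node (Flip 0 1 5) [Node
    (Cycle 0 [2, 5, 0]) [], Goal 49 [0, 1, 3, 4, 5, 2, 6, 7] [1, 0, 2, 3]], Node (Cycle 1 [1, 5, 0]) []], Node
    (Flip 0 1 3) [Node (Flip 0 2 3) [Node (Cycle 0 [1, 3, 0]) [], Node (Flip 0 4 5) [Goal 49 [0, 2, 3, 5, 6,
    1, 4, 7] [2, 0, 1, 3], Goal 49 [0, 2, 3, 4, 6, 1, 5, 7] [2, 0, 1, 3]]], Node (Flip 0 2 3) [Node (Flip 0 4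
    5) [Goal 49 [0, 1, 3, 5, 6, 2, 4, 7] [2, 0, 1, 3], Goal 49 [0, 1, 3, 4, 6, 2, 5, 7] [2, 0, 1, 3]], Node
    (Flip 0 4 5) [Goal 49 [0, 1, 2, 5, 6, 3, 4, 7] [2, 0, 1, 3], Goal 49 [0, 1, 2, 4, 6, 3, 5, 7] [2, 0, 1,
    3]]]], Goal 58 [0, 1, 2, 3, 4, 5, 6, 7] [0, 1, 2, 3]]),
  ([(0, 1, 0), (0, 2, 0), (0, 3, 0), (2, 5, 0), (5, 7, 0), (0, 4, 1), (0, 5, 1), (1, 5, 1), (0, 6, 2), (3, 4,
    2), (4, 5, 2), (0, 7, 3), (2, 3, 3), (2, 4, 3), (3, 5, 3)], Node (Branch 3 7) [Node (Cycle 0 [2, 5, 7, 3,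
    0]) [], Node (Flip 0 1 5) [Node (Cycle 0 [2, 5, 0]) [], Node (Flip 0 3 7) [Node (Cut 3 [0]) [], Node
    (Cycle 0 [2, 5, 7, 0]) [], Goal 49 [0, 1, 4, 5, 7, 2, 3, 6] [1, 0, 2, 3], Node (Cycle 0 [2, 5, 7, 0]) [],
    Goal 49 [0, 1, 3, 4, 5, 2, 6, 7] [1, 0, 2, 3]]], Node (Flip 0 4 5) [Node (Flip 0 2 5) [Node (Flip 0 1 5)
    [Node (Cycle 1 [4, 5, 0]) [], Goal 49 [5, 0, 1, 2, 7, 3, 4, 6] [0, 1, 2, 3]], Goal 49 [0, 1, 2, 3, 5, 4,
    6, 7] [0, 1, 2, 3]], Node (Cut 2 [5]) [Node (Flip 0 5 6) [Node (Flip 0 5 7) [Node (Cut 3 [0]) [], Node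
    (Cycle 2 [4, 3, 7, 0]) [], Goal 49 [0, 1, 2, 3, 7, 4, 5, 6] [0, 1, 2, 3], Node (Cycle 0 [2, 5, 0]) [],
    Node (Cycle 0 [2, 5, 0]) []], Node (Cut 1 [0]) []]]], Node (Flip 0 2 4) [Node (Flip 3 4 5) [Node (Cycle 3
    [4, 3, 7, 0]) [], Node (Flip 0 5 7) [Goal 49 [0, 1, 2, 3, 7, 4, 5, 6] [0, 1, 2, 3], Node (Cycle 3 [4, 5,
    0]) [], Node (Cycle 3 [4, 5, 0]) [], Node (Cycle 0 [2, 5, 0]) [], Node (Cycle 0 [2, 5, 0]) []]], Node
    (Flip 0 2 5) [Goal 49 [0, 1, 3, 4, 5, 2, 6, 7] [0, 1, 2, 3], Goal 49 [0, 1, 2, 3, 4, 5, 6, 7] [0, 1, 2,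
    3]], Node (Flip 0 2 5) [Node (Flip 0 2 4) [Goal 49 [0, 1, 3, 4, 5, 2, 6, 7] [0, 1, 2, 3], Node (Cycle 3
    [2, 3, 7, 0]) [], Node (Cycle 3 [2, 3, 7, 0]) [], Goal 49 [0, 1, 2, 3, 5, 4, 6, 7] [0, 1, 2, 3], Node (Cut
    1 [0]) []], Node (Flip 0 2 4) [Node (Cycle 3 [2, 3, 7, 0]) [], Goal 49 [0, 1, 2, 3, 4, 5, 6, 7] [0, 1, 2,
    3]]], Node (Cycle 3 [2, 3, 7, 0]) [], Node (Cycle 3 [2, 3, 7, 0]) []]]),
  ([(0, 1, 0), (0, 2, 0), (0, 3, 0), (2, 5, 0), (0, 4, 1), (0, 5, 1), (1, 5, 1), (0, 6, 2), (3, 4, 2), (4, 5,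
    2), (0, 7, 3), (2, 3, 3), (2, 4, 3), (3, 5, 3)], Node (Branch 5 7) [Goal 60 [0, 1, 2, 3, 4, 5, 6, 7] [0,
    1, 2, 3], Node (Flip 0 4 5) [Node (Flip 0 2 5) [Node (Cut 2 [5]) [Node (Flip 0 2 5) [Node (Cycle 2 [5, 6,
    0]) [], Goal 49 [0, 1, 2, 3, 5, 4, 6, 7] [0, 1, 2, 3]]], Goal 49 [0, 1, 2, 3, 5, 4, 6, 7] [0, 1, 2, 3]],
    Goal 49 [5, 0, 1, 4, 7, 2, 3, 6] [1, 0, 2, 3]], Node (Flip 2 3 5) [Node (Cycle 0 [2, 3, 0]) [], Node (Flip
    3 4 5) [Node (Cut 0 [5]) [Node (Flip 0 5 6) [Node (Cut 0 [5]) [], Goal 49 [5, 0, 3, 4, 7, 1, 2, 6] [2, 0,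
    1, 3], Node (Cut 0 [5]) [], Node (Cut 2 [0]) [], Goal 49 [0, 1, 2, 3, 5, 4, 6, 7] [0, 1, 2, 3]]], Node
    (Flip 0 4 5) [Goal 49 [0, 1, 2, 3, 5, 4, 6, 7] [0, 1, 2, 3], Goal 49 [0, 1, 2, 3, 4, 5, 6, 7] [0, 1, 2,
    3]]]], Node (Flip 0 4 5) [Node (Flip 0 2 5) [Node (Cut 2 [5]) [Node (Flip 0 2 5) [Node (Cycle 2 [5, 6, 0])
    [], Goal 49 [0, 1, 2, 3, 5, 4, 6, 7] [0, 1, 2, 3]]], Goal 49 [0, 1, 2, 3, 5, 4, 6, 7] [0, 1, 2, 3]], Node
    (Flip 2 4 5) [Node (Cut 2 [5]) [Node (Flip 0 4 5) [Node (Cut 1 [0]) [], Node (Cycle 2 [5, 6, 0]) [], Goal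
    49 [0, 1, 2, 3, 5, 4, 6, 7] [0, 1, 2, 3], Node (Cycle 2 [5, 6, 0]) [], Node (Cut 0 [5]) []]], Node (Cycle
    3 [3, 5, 2]) [], Node (Flip 0 5 7) [Goal 49 [5, 0, 3, 4, 7, 1, 2, 6] [3, 0, 1, 2], Node (Cut 1 [0]) []],
    Node (Cycle 3 [3, 5, 2]) [], Node (Flip 0 5 7) [Goal 49 [5, 0, 3, 4, 7, 1, 2, 6] [3, 0, 1, 2], Node (Cut 1
    [0]) []]]]]),
  ([(0, 1, 0), (0, 2, 0), (0, 3, 0), (2, 5, 0), (0, 4, 1), (0, 5, 1), (1, 5, 1), (0, 6, 2), (3, 4, 2), (4, 5,
    2), (0, 7, 3), (2, 3, 3), (2, 4, 3)], Node (Branch 3 5) [Node (Cycle 0 [2, 5, 3, 0]) [], Node (Flip 0 1 5)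
    [Node (Cycle 0 [2, 5, 0]) [], Node (Flip 0 3 5) [Node (Cycle 0 [2, 5, 0]) [], Goal 49 [0, 1, 3, 4, 5, 2,
    6, 7] [1, 0, 2, 3]]], Node (Cycle 2 [4, 5, 3]) [], Goal 61 [0, 1, 2, 3, 4, 5, 6, 7] [0, 1, 2, 3]]),
  ([(0, 1, 0), (0, 2, 0), (0, 3, 0), (2, 5, 0), (0, 4, 1), (0, 5, 1), (1, 5, 1), (0, 6, 2), (4, 5, 2), (0, 7,
    3), (2, 3, 3), (2, 4, 3)], Node (Branch 3 4) [Node (Flip 0 2 5) [Node (Flip 2 3 4) [Node (Flip 0 2 4)
    [Goal 49 [0, 1, 3, 4, 5, 2, 6, 7] [0, 1, 2, 3], Node (Cycle 0 [2, 5, 0]) []], Node (Cycle 0 [3, 2, 5, 0])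
    []], Goal 49 [0, 1, 2, 3, 5, 4, 6, 7] [0, 1, 2, 3]], Node (Flip 2 3 4) [Node (Flip 0 2 5) [Node (Cycle 1
    [2, 4, 0]) [], Goal 49 [0, 1, 2, 3, 5, 4, 6, 7] [0, 1, 2, 3]], Node (Flip 0 1 5) [Node (Cycle 0 [2, 5, 0])
    [], Node (Flip 0 2 3) [Goal 49 [0, 1, 3, 4, 5, 2, 6, 7] [1, 0, 2, 3], Goal 49 [0, 1, 2, 4, 5, 3, 6, 7] [1,
    0, 2, 3]]]], Goal 62 [0, 1, 2, 3, 4, 5, 6, 7] [0, 1, 2, 3], Node (Cycle 3 [3, 4, 2]) []]),
  ([(0, 1, 0), (0, 2, 0), (0, 3, 0), (2, 5, 0), (0, 4, 1), (0, 5, 1), (1, 5, 1), (0, 6, 2), (4, 5, 2), (0, 7,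
    3), (2, 4, 3)], Node (Branch 2 3) [Node (Cycle 0 [2, 3, 0]) [], Node (Flip 0 1 5) [Node (Cycle 0 [2, 5,
    0]) [], Node (Flip 0 2 3) [Goal 49 [0, 1, 3, 4, 5, 2, 6, 7] [1, 0, 2, 3], Goal 49 [0, 1, 2, 4, 5, 3, 6, 7]
    [1, 0, 2, 3]]], Goal 59 [0, 1, 2, 3, 4, 5, 6, 7] [0, 1, 2, 3], Goal 63 [0, 1, 2, 3, 4, 5, 6, 7] [0, 1, 2,
    3]]),
  ([(0, 1, 0), (0, 2, 0), (0, 3, 0), (2, 5, 0), (0, 4, 1), (0, 5, 1), (1, 3, 1), (1, 5, 2), (2, 7, 2), (4, 5,
    2), (2, 3, 3), (2, 4, 3), (3, 5, 3)], Node (Branch 1 2) [Node (Cycle 0 [1, 2, 0]) [], Node (Flip 0 1 2)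
    [Node (Flip 0 1 3) [Goal 49 [0, 2, 3, 4, 5, 1, 6, 7] [1, 0, 2, 3], Goal 49 [0, 1, 2, 4, 5, 3, 6, 7] [1, 0,
    2, 3]], Node (Flip 0 1 3) [Node (Cycle 0 [1, 2, 0]) [], Goal 49 [0, 1, 3, 4, 5, 2, 6, 7] [1, 0, 2, 3]]],
    Node (Flip 1 2 5) [Node (Flip 2 4 5) [Node (Cycle 3 [3, 5, 2]) [], Goal 49 [2, 1, 4, 5, 7, 0, 3, 6] [2, 0,
    1, 3]], Node (Cycle 0 [1, 2, 0]) []], Node (Flip 2 3 5) [Node (Cycle 0 [2, 3, 0]) [], Goal 49 [2, 1, 3, 4,
    5, 0, 6, 7] [3, 0, 1, 2]]]),
  ([(0, 1, 0), (0, 2, 0), (0, 3, 0), (2, 5, 0), (0, 4, 1), (0, 5, 1), (1, 3, 1), (0, 6, 2), (1, 5, 2), (4, 5,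
    2), (0, 7, 3), (2, 3, 3), (2, 4, 3), (3, 5, 3)], Node (Branch 2 7) [Node (Flip 0 2 7) [Node (Flip 2 3 5)
    [Node (Cycle 0 [3, 2, 7, 0]) [], Goal 49 [2, 0, 3, 4, 5, 1, 6, 7] [3, 0, 1, 2]], Node (Cut 3 [0]) []],
    Node (Flip 0 1 3) [Node (Flip 2 3 5) [Node (Cycle 0 [1, 3, 2, 0]) [], Node (Flip 0 2 7) [Node (Cut 3 [0])
    [], Goal 49 [2, 0, 3, 4, 5, 1, 6, 7] [3, 0, 1, 2], Goal 49 [0, 3, 4, 5, 7, 1, 2, 6] [1, 0, 2, 3], Node
    (Cut 3 [0]) [], Goal 49 [0, 2, 3, 4, 5, 1, 6, 7] [1, 0, 2, 3]]], Node (Flip 2 3 5) [Node (Cycle 0 [2, 3,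
    0]) [], Node (Flip 0 2 7) [Node (Cut 3 [0]) [], Goal 49 [2, 0, 3, 4, 5, 1, 6, 7] [3, 0, 1, 2], Goal 49 [0,
    1, 4, 5, 7, 2, 3, 6] [1, 0, 2, 3], Node (Cut 3 [0]) [], Goal 49 [0, 1, 2, 4, 5, 3, 6, 7] [1, 0, 2, 3]]]],
    Goal 65 [0, 1, 2, 3, 4, 5, 6, 7] [0, 1, 2, 3], Node (Flip 2 3 5) [Node (Cycle 0 [2, 3, 0]) [], Goal 49 [2,
    3, 4, 5, 7, 0, 1, 6] [3, 0, 1, 2]]]),
  ([(0, 1, 0), (0, 2, 0), (0, 3, 0), (2, 5, 0), (0, 4, 1), (0, 5, 1), (1, 3, 1), (0, 6, 2), (1, 5, 2), (4, 5,
    2), (0, 7, 3), (2, 4, 3), (3, 5, 3)], Node (Branch 2 3) [Node (Cycle 0 [2, 3, 0]) [], Node (Flip 0 1 3)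
    [Node (Flip 0 2 3) [Node (Cycle 0 [1, 3, 0]) [], Goal 49 [0, 2, 3, 4, 5, 1, 6, 7] [1, 0, 2, 3]], Node
    (Flip 0 2 3) [Goal 49 [0, 1, 3, 4, 5, 2, 6, 7] [1, 0, 2, 3], Goal 49 [0, 1, 2, 4, 5, 3, 6, 7] [1, 0, 2,
    3]]], Node (Flip 0 2 3) [Node (Flip 0 4 5) [Node (Flip 0 1 5) [Node (Cycle 0 [2, 5, 0]) [], Goal 49 [0, 1,
    3, 5, 6, 2, 4, 7] [2, 0, 1, 3]], Node (Flip 0 1 5) [Node (Cut 1 [0]) [], Node (Cycle 0 [2, 5, 0]) [], Goal
    49 [0, 3, 4, 5, 6, 1, 2, 7] [2, 0, 1, 3], Node (Cycle 0 [2, 5, 0]) [], Goal 49 [0, 1, 3, 4, 6, 2, 5, 7]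
    [2, 0, 1, 3]]], Node (Flip 0 4 5) [Node (Flip 0 1 5) [Node (Cycle 0 [3, 2, 5, 0]) [], Goal 49 [0, 1, 2, 5,
    6, 3, 4, 7] [2, 0, 1, 3]], Node (Flip 0 1 5) [Node (Cut 1 [0]) [], Node (Cycle 0 [3, 2, 5, 0]) [], Goal 49
    [0, 2, 4, 5, 6, 1, 3, 7] [2, 0, 1, 3], Node (Cycle 0 [3, 2, 5, 0]) [], Goal 49 [0, 1, 2, 4, 6, 3, 5, 7]
    [2, 0, 1, 3]]]], Goal 66 [0, 1, 2, 3, 4, 5, 6, 7] [0, 1, 2, 3]]),
  ([(0, 1, 0), (0, 2, 0), (0, 3, 0), (2, 5, 0), (0, 4, 1), (0, 5, 1), (2, 3, 1), (0, 6, 2), (1, 5, 2), (3, 4,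
    2), (4, 5, 2), (0, 7, 3), (1, 3, 3), (2, 4, 3), (3, 5, 3)], Node (Branch 1 4) [Goal 54 [0, 2, 1, 3, 5, 4,
    6, 7] [0, 1, 2, 3], Node (Flip 0 2 3) [Node (Flip 1 4 5) [Node (Flip 0 1 5) [Node (Cycle 0 [2, 5, 0]) [],
    Goal 49 [0, 1, 3, 4, 5, 2, 6, 7] [1, 0, 2, 3]], Node (Cycle 1 [4, 5, 0]) []], Node (Flip 1 4 5) [Node
    (Flip 0 1 5) [Node (Cycle 0 [3, 2, 5, 0]) [], Goal 49 [0, 1, 2, 4, 5, 3, 6, 7] [1, 0, 2, 3]], Node (Cycle
    1 [4, 5, 0]) []]], Node (Cycle 2 [4, 5, 1]) [], Node (Flip 2 3 4) [Node (Cycle 3 [3, 4, 1]) [], Node (Flip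
    0 2 5) [Node (Cycle 1 [2, 4, 0]) [], Goal 49 [0, 1, 2, 3, 5, 4, 6, 7] [0, 1, 2, 3]], Node (Flip 2 3 5)
    [Node (Cycle 0 [2, 3, 0]) [], Node (Flip 0 3 5) [Node (Cycle 1 [3, 4, 0]) [], Goal 49 [0, 1, 2, 3, 5, 4,
    6, 7] [0, 1, 2, 3]]], Node (Cycle 3 [3, 4, 1]) [], Node (Flip 2 3 5) [Node (Flip 0 3 5) [Node (Cycle 1 [3,
    4, 0]) [], Goal 49 [0, 1, 2, 3, 5, 4, 6, 7] [0, 1, 2, 3]], Node (Cycle 0 [2, 3, 0]) [], Node (Cycle 0 [2,
    3, 0]) [], Node (Cycle 3 [3, 2, 4, 1]) [], Node (Cycle 3 [3, 2, 4, 1]) []]]]),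
  ([(0, 1, 0), (0, 2, 0), (0, 3, 0), (2, 5, 0), (0, 4, 1), (0, 5, 1), (2, 3, 1), (0, 6, 2), (1, 5, 2), (4, 5,
    2), (0, 7, 3), (1, 3, 3), (2, 4, 3), (3, 5, 3)], Node (Branch 3 4) [Node (Flip 0 2 5) [Node (Flip 0 3 4)
    [Node (Cycle 1 [2, 3, 0]) [], Goal 49 [0, 1, 3, 4, 5, 2, 6, 7] [0, 1, 2, 3]], Goal 49 [0, 1, 2, 3, 5, 4,
    6, 7] [0, 1, 2, 3]], Node (Flip 0 2 5) [Node (Cycle 1 [2, 3, 4, 0]) [], Goal 49 [0, 1, 2, 3, 5, 4, 6, 7]
    [0, 1, 2, 3]], Goal 68 [0, 1, 2, 3, 4, 5, 6, 7] [0, 1, 2, 3], Node (Flip 5 1 4) [Node (Flip 2 3 4) [Goal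
    49 [3, 1, 2, 4, 5, 0, 6, 7] [3, 0, 1, 2], Node (Branch 4 5) [Node (Flip 0 4 5) [Node (Cycle 0 [2, 5, 0])
    [], Goal 49 [0, 1, 2, 3, 4, 5, 6, 7] [0, 1, 2, 3]], Node (Cycle 1 [4, 5, 0]) [], Node (Cycle 2 [4, 5, 1])
    [], Node (Cycle 3 [3, 5, 4, 2]) []]], Node (Flip 0 2 3) [Node (Branch 1 5) [Node (Cycle 0 [1, 5, 2, 0])
    [], Node (Flip 0 1 5) [Node (Cycle 0 [2, 5, 0]) [], Goal 49 [0, 1, 3, 4, 5, 2, 6, 7] [1, 0, 2, 3]], Node
    (Cycle 2 [4, 5, 1]) [], Node (Cycle 3 [3, 5, 1]) []], Node (Branch 1 5) [Node (Cycle 0 [1, 5, 2, 3, 0])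
    [], Node (Flip 0 1 5) [Node (Cycle 0 [3, 2, 5, 0]) [], Goal 49 [0, 1, 2, 4, 5, 3, 6, 7] [1, 0, 2, 3]],
    Node (Cycle 2 [4, 5, 1]) [], Node (Cycle 3 [3, 5, 1]) []]]]]),
  ([(0, 1, 0), (0, 2, 0), (0, 3, 0), (2, 5, 0), (0, 4, 1), (0, 5, 1), (1, 5, 2), (4, 5, 2), (1, 3, 3), (2, 3,
    3), (2, 4, 3)], Node (Branch 1 2) [Node (Cycle 0 [1, 2, 0]) [], Node (Flip 0 2 5) [Node (Branch 1 4) [Node
    (Flip 0 1 4) [Node (Cycle 1 [1, 2, 0]) [], Goal 49 [0, 1, 3, 4, 5, 2, 6, 7] [0, 1, 2, 3]], Node (Cycle 1
    [2, 1, 4, 0]) [], Node (Cycle 2 [4, 5, 1]) [], Node (Cycle 3 [3, 2, 4, 1]) []], Goal 49 [0, 1, 2, 3, 5, 4,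
    6, 7] [0, 1, 2, 3]], Node (Flip 1 2 5) [Node (Flip 0 1 5) [Node (Branch 1 4) [Node (Flip 0 1 4) [Goal 49
    [0, 2, 3, 4, 5, 1, 6, 7] [0, 1, 2, 3], Node (Cycle 0 [1, 5, 0]) []], Node (Cycle 1 [1, 4, 0]) [], Node
    (Cycle 2 [2, 5, 4, 1]) [], Node (Cycle 3 [3, 2, 4, 1]) []], Goal 49 [0, 1, 2, 3, 5, 4, 6, 7] [0, 1, 2,
    3]], Node (Cycle 0 [1, 2, 0]) []], Node (Cycle 3 [2, 3, 1]) []]),
  ([(0, 1, 0), (0, 2, 0), (0, 3, 0), (2, 5, 0), (0, 4, 1), (0, 5, 1), (0, 6, 2), (1, 5, 2), (4, 5, 2), (0, 7,
    3), (1, 3, 3), (2, 4, 3), (3, 5, 3)], Node (Branch 2 3) [Node (Cycle 0 [2, 3, 0]) [], Goal 69 [0, 1, 2, 3,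
    4, 5, 6, 7] [0, 1, 2, 3], Node (Flip 0 2 3) [Node (Flip 0 4 5) [Node (Flip 0 1 5) [Node (Cycle 0 [2, 5,
    0]) [], Goal 49 [0, 1, 3, 5, 6, 2, 4, 7] [2, 0, 1, 3]], Node (Flip 0 1 5) [Node (Cut 1 [0]) [], Node
    (Cycle 0 [2, 5, 0]) [], Goal 49 [0, 3, 4, 5, 6, 1, 2, 7] [2, 0, 1, 3], Node (Cycle 0 [2, 5, 0]) [], Goal
    49 [0, 1, 3, 4, 6, 2, 5, 7] [2, 0, 1, 3]]], Node (Flip 0 4 5) [Node (Flip 0 1 5) [Node (Cycle 0 [3, 2, 5,
    0]) [], Goal 49 [0, 1, 2, 5, 6, 3, 4, 7] [2, 0, 1, 3]], Node (Flip 0 1 5) [Node (Cut 1 [0]) [], Node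
    (Cycle 0 [3, 2, 5, 0]) [], Goal 49 [0, 2, 4, 5, 6, 1, 3, 7] [2, 0, 1, 3], Node (Cycle 0 [3, 2, 5, 0]) [],
    Goal 49 [0, 1, 2, 4, 6, 3, 5, 7] [2, 0, 1, 3]]]], Goal 70 [0, 1, 2, 3, 4, 5, 6, 7] [0, 1, 2, 3]]),
  ([(0, 1, 0), (0, 2, 0), (0, 3, 0), (2, 5, 0), (0, 4, 1), (0, 5, 1), (0, 6, 2), (1, 5, 2), (4, 5, 2), (0, 7,
    3), (2, 4, 3), (3, 5, 3)], Node (Branch 1 3) [Node (Cycle 0 [1, 3, 0]) [], Goal 67 [0, 1, 2, 3, 4, 5, 6,
    7] [0, 1, 2, 3], Node (Flip 0 4 5) [Node (Flip 0 1 3) [Node (Flip 0 1 5) [Node (Cycle 0 [2, 5, 0]) [],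
    Goal 49 [0, 1, 3, 5, 6, 2, 4, 7] [2, 0, 1, 3]], Node (Cycle 2 [1, 5, 0]) []], Node (Flip 0 1 5) [Node (Cut
    1 [0]) [], Node (Cycle 0 [2, 5, 0]) [], Node (Flip 0 1 3) [Goal 49 [0, 3, 4, 5, 6, 1, 2, 7] [2, 0, 1, 3],
    Node (Cycle 0 [1, 5, 2, 0]) [], Node (Cycle 0 [1, 5, 2, 0]) [], Goal 49 [0, 1, 4, 5, 6, 2, 3, 7] [2, 0, 1,
    3], Node (Cut 1 [0]) []], Node (Cycle 0 [2, 5, 0]) [], Node (Flip 0 1 3) [Node (Cycle 0 [1, 5, 2, 0]) [],
    Goal 49 [0, 1, 3, 4, 6, 2, 5, 7] [2, 0, 1, 3]]]], Goal 71 [0, 1, 2, 3, 4, 5, 6, 7] [0, 1, 2, 3]]),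
  ([(0, 1, 0), (0, 2, 0), (0, 3, 0), (2, 5, 0), (0, 4, 1), (0, 5, 1), (0, 6, 2), (1, 5, 2), (4, 5, 2), (0, 7,
    3), (2, 4, 3)], Node (Branch 3 5) [Node (Cycle 0 [2, 5, 3, 0]) [], Goal 64 [0, 3, 2, 1, 4, 5, 6, 7] [0, 1,
    2, 3], Node (Flip 0 4 5) [Node (Flip 0 1 5) [Node (Cycle 0 [2, 5, 0]) [], Node (Flip 0 3 5) [Node (Cycle 0
    [2, 5, 0]) [], Goal 49 [0, 1, 3, 5, 6, 2, 4, 7] [2, 0, 1, 3]]], Node (Flip 0 1 5) [Node (Cut 1 [0]) [],
    Node (Cycle 0 [2, 5, 0]) [], Node (Flip 0 3 5) [Node (Cycle 0 [2, 5, 0]) [], Goal 49 [0, 3, 4, 5, 6, 1, 2,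
    7] [2, 0, 1, 3]], Node (Cycle 0 [2, 5, 0]) [], Node (Flip 0 3 5) [Node (Cut 1 [0]) [], Node (Cycle 0 [2,
    5, 0]) [], Goal 49 [0, 1, 4, 5, 6, 2, 3, 7] [2, 0, 1, 3], Node (Cycle 0 [2, 5, 0]) [], Goal 49 [0, 1, 3,
    4, 6, 2, 5, 7] [2, 0, 1, 3]]]], Goal 72 [0, 1, 2, 3, 4, 5, 6, 7] [0, 1, 2, 3]]),
  ([(0, 1, 0), (0, 2, 0), (0, 3, 0), (2, 5, 0), (0, 4, 1), (0, 5, 1), (0, 6, 2), (4, 5, 2), (0, 7, 3), (1, 5,
    3), (2, 4, 3), (3, 5, 3)], Node (Branch 5 6) [Node (Flip 0 2 5) [Node (Flip 0 1 5) [Node (Flip 0 3 5)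
    [Node (Cycle 0 [1, 5, 0]) [], Goal 49 [5, 1, 2, 3, 6, 0, 4, 7] [0, 1, 2, 3]], Goal 49 [5, 0, 1, 2, 6, 3,
    4, 7] [0, 1, 2, 3]], Goal 49 [0, 1, 2, 3, 5, 4, 6, 7] [0, 1, 2, 3]], Node (Flip 0 5 6) [Node (Flip 2 4 5)
    [Node (Flip 0 4 5) [Node (Cut 2 [0]) [], Node (Cycle 1 [5, 6, 0]) [], Goal 49 [0, 1, 2, 3, 5, 4, 6, 7] [0,
    1, 2, 3], Node (Cycle 1 [5, 6, 0]) [], Goal 49 [0, 1, 2, 3, 4, 5, 6, 7] [0, 1, 2, 3]], Node (Cut 0 [5])
    [Node (Flip 0 5 7) [Node (Cut 0 [5]) [], Goal 49 [5, 0, 1, 2, 3, 4, 6, 7] [3, 0, 1, 2], Node (Cut 0 [5])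
    [], Node (Cut 3 [0]) [], Node (Cut 2 [0]) []]], Node (Cut 0 [5]) [Node (Flip 0 5 7) [Node (Cut 0 [5]) [],
    Goal 49 [5, 0, 1, 3, 4, 2, 6, 7] [3, 0, 1, 2], Node (Cut 0 [5]) [], Node (Cut 3 [0]) [], Node (Cut 2 [0])
    []]], Node (Flip 0 4 5) [Node (Cut 2 [0]) [], Node (Cycle 1 [5, 6, 0]) [], Goal 49 [0, 1, 2, 3, 5, 4, 6,
    7] [0, 1, 2, 3], Node (Cycle 1 [5, 6, 0]) [], Goal 49 [0, 1, 2, 3, 4, 5, 6, 7] [0, 1, 2, 3]], Node (Cut 2
    [0, 5]) [Node (Flip 0 5 7) [Goal 49 [5, 0, 1, 3, 4, 2, 6, 7] [3, 0, 1, 2], Node (Cut 3 [0]) []]]], Node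
    (Cut 2 [0]) []], Node (Flip 0 4 5) [Node (Cycle 2 [5, 6, 0]) [], Node (Flip 2 4 5) [Node (Flip 0 4 5)
    [Node (Cut 1 [0]) [], Node (Cycle 2 [5, 6, 0]) [], Goal 49 [0, 1, 2, 3, 5, 4, 6, 7] [0, 1, 2, 3], Node
    (Cycle 2 [5, 6, 0]) [], Goal 49 [0, 1, 2, 3, 4, 5, 6, 7] [0, 1, 2, 3]], Node (Cut 0 [5]) [Node (Flip 0 5
    7) [Node (Cut 0 [5]) [], Goal 49 [5, 0, 1, 2, 3, 4, 6, 7] [3, 0, 1, 2], Node (Cut 0 [5]) [], Node (Cut 3
    [0]) [], Node (Cut 1 [0]) []]], Node (Cut 0 [5]) [Node (Flip 0 5 7) [Node (Cut 0 [5]) [], Goal 49 [5, 0,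
    1, 3, 4, 2, 6, 7] [3, 0, 1, 2], Node (Cut 0 [5]) [], Node (Cut 3 [0]) [], Node (Cut 1 [0]) []]], Node
    (Flip 0 4 5) [Node (Cut 1 [0]) [], Node (Cycle 2 [5, 6, 0]) [], Goal 49 [0, 1, 2, 3, 5, 4, 6, 7] [0, 1, 2,
    3], Node (Cycle 2 [5, 6, 0]) [], Goal 49 [0, 1, 2, 3, 4, 5, 6, 7] [0, 1, 2, 3]], Node (Cut 1 [0, 5]) [Node
    (Flip 0 5 7) [Goal 49 [5, 0, 1, 3, 4, 2, 6, 7] [3, 0, 1, 2], Node (Cut 3 [0]) []]]]], Node (Flip 2 4 5)
    [Node (Flip 0 4 5) [Goal 49 [0, 1, 2, 3, 5, 4, 6, 7] [0, 1, 2, 3], Goal 49 [0, 1, 2, 3, 4, 5, 6, 7] [0, 1,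
    2, 3]], Goal 49 [5, 1, 2, 3, 6, 0, 4, 7] [3, 0, 1, 2], Goal 49 [5, 1, 3, 4, 6, 0, 2, 7] [3, 0, 1, 2], Goal
    49 [5, 1, 2, 3, 6, 0, 4, 7] [3, 0, 1, 2], Goal 49 [5, 1, 3, 4, 6, 0, 2, 7] [3, 0, 1, 2]]]),
  ([(0, 1, 0), (0, 2, 0), (0, 3, 0), (2, 5, 0), (0, 4, 1), (0, 5, 1), (0, 6, 2), (4, 5, 2), (0, 7, 3), (1, 5,
    3), (2, 4, 3)], Node (Branch 3 5) [Node (Cycle 0 [2, 5, 3, 0]) [], Goal 64 [0, 3, 2, 1, 4, 5, 6, 7] [0, 1,
    2, 3], Goal 72 [0, 3, 2, 1, 4, 5, 6, 7] [0, 1, 2, 3], Goal 74 [0, 1, 2, 3, 4, 5, 6, 7] [0, 1, 2, 3]]),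
  ([(0, 1, 0), (0, 2, 0), (0, 3, 0), (2, 5, 0), (0, 4, 1), (0, 5, 1), (0, 6, 2), (4, 5, 2), (0, 7, 3), (2, 4,
    3)], Node (Branch 1 5) [Node (Cycle 0 [1, 5, 2, 0]) [], Goal 64 [0, 1, 2, 3, 4, 5, 6, 7] [0, 1, 2, 3],
    Goal 73 [0, 1, 2, 3, 4, 5, 6, 7] [0, 1, 2, 3], Goal 75 [0, 1, 2, 3, 4, 5, 6, 7] [0, 1, 2, 3]]),
  ([(0, 1, 0), (0, 2, 0), (0, 3, 0), (2, 5, 0), (0, 4, 1), (0, 5, 1), (0, 6, 2), (4, 5, 2), (0, 7, 3)], Node
    (Branch 2 4) [Node (Flip 0 2 4) [Node (Flip 0 2 5) [Goal 49 [0, 1, 3, 4, 5, 2, 6, 7] [0, 1, 2, 3], Node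
    (Cycle 0 [2, 4, 0]) []], Goal 49 [0, 1, 2, 3, 4, 5, 6, 7] [0, 1, 2, 3]], Node (Flip 0 2 5) [Node (Cycle 1
    [2, 4, 0]) [], Goal 49 [0, 1, 2, 3, 5, 4, 6, 7] [0, 1, 2, 3]], Goal 54 [0, 1, 2, 3, 4, 5, 6, 7] [0, 1, 2,
    3], Goal 76 [0, 1, 2, 3, 4, 5, 6, 7] [0, 1, 2, 3]]),
  ([(0, 1, 0), (0, 2, 0), (0, 3, 0), (0, 4, 1), (0, 5, 1), (2, 5, 1), (3, 5, 1), (0, 6, 2), (4, 5, 2), (0, 7,
    3), (5, 7, 3)], Node (Branch 1 5) [Goal 77 [0, 2, 1, 3, 4, 5, 6, 7] [0, 1, 2, 3], Goal 49 [5, 0, 1, 2, 3,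
    4, 6, 7] [1, 0, 2, 3], Node (Flip 0 4 5) [Node (Cut 0 [5]) [Node (Flip 0 5 6) [Node (Cut 0 [5]) [], Goal
    49 [0, 1, 2, 3, 5, 4, 6, 7] [0, 1, 2, 3]]], Goal 49 [5, 0, 2, 3, 4, 1, 6, 7] [1, 0, 2, 3]], Node (Flip 0 4
    5) [Node (Cut 0 [5]) [Node (Flip 0 5 6) [Node (Cut 0 [5]) [], Goal 49 [0, 1, 2, 3, 5, 4, 6, 7] [0, 1, 2,
    3]]], Goal 49 [5, 0, 2, 3, 4, 1, 6, 7] [1, 0, 2, 3]]]),
  ([(0, 1, 0), (0, 2, 0), (0, 3, 0), (0, 4, 1), (0, 5, 1), (2, 5, 1), (3, 5, 1), (0, 6, 2), (4, 5, 2), (0, 7,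
    3)], Node (Branch 5 7) [Node (Flip 0 4 5) [Node (Flip 0 5 7) [Node (Cut 3 [0]) [], Node (Flip 0 4 5) [Goal
    49 [5, 0, 2, 3, 4, 1, 6, 7] [1, 0, 2, 3], Node (Cut 3 [0]) []], Goal 49 [0, 1, 2, 3, 7, 4, 5, 6] [0, 1, 2,
    3], Node (Cut 3 [0]) [], Goal 49 [0, 1, 2, 3, 5, 4, 6, 7] [0, 1, 2, 3]], Goal 49 [5, 0, 2, 3, 4, 1, 6, 7]
    [1, 0, 2, 3]], Goal 49 [5, 0, 2, 3, 7, 1, 4, 6] [1, 0, 2, 3], Node (Flip 0 4 5) [Node (Flip 0 5 7) [Node
    (Flip 0 4 5) [Goal 49 [5, 0, 2, 3, 4, 1, 6, 7] [1, 0, 2, 3], Node (Cut 3 [0]) []], Node (Cut 3 [0]) []],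
    Goal 49 [5, 0, 2, 3, 4, 1, 6, 7] [1, 0, 2, 3]], Goal 78 [0, 1, 2, 3, 4, 5, 6, 7] [0, 1, 2, 3]]),
  ([(0, 1, 0), (0, 2, 0), (0, 3, 0), (0, 4, 1), (0, 5, 1), (2, 5, 1), (0, 6, 2), (2, 4, 2), (3, 5, 2), (4, 5,
    2), (0, 7, 3), (1, 5, 3)], Node (Branch 5 6) [Node (Flip 2 4 5) [Node (Flip 0 5 6) [Node (Cut 2 [0]) [],
    Goal 49 [5, 0, 2, 3, 4, 1, 6, 7] [2, 0, 1, 3], Goal 49 [0, 1, 2, 3, 6, 4, 5, 7] [0, 1, 2, 3], Node (Cut 2
    [0]) [], Goal 49 [0, 1, 2, 3, 5, 4, 6, 7] [0, 1, 2, 3]], Node (Cycle 1 [4, 5, 0]) []], Node (Flip 0 5 6)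
    [Node (Flip 2 4 5) [Goal 49 [5, 0, 2, 3, 4, 1, 6, 7] [2, 0, 1, 3], Node (Cycle 1 [4, 5, 6, 0]) []], Node
    (Cut 2 [0]) []], Node (Cut 0 [5]) [Goal 77 [5, 3, 6, 4, 2, 0, 7, 1] [2, 1, 0, 3]], Node (Flip 2 4 5) [Node
    (Cut 0 [5]) [Node (Flip 0 5 7) [Node (Cut 0 [5]) [], Node (Cut 1 [5]) [], Node (Cut 0 [5]) [], Node (Cut 1
    [5]) [], Goal 49 [0, 1, 2, 3, 5, 4, 6, 7] [0, 1, 2, 3]]], Node (Cycle 1 [4, 5, 0]) []]]),
  ([(0, 1, 0), (0, 2, 0), (0, 3, 0), (0, 4, 1), (0, 5, 1), (2, 5, 1), (0, 6, 2), (2, 4, 2), (3, 5, 2), (4, 5,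
    2), (0, 7, 3)], Node (Branch 1 5) [Goal 77 [0, 2, 1, 3, 4, 5, 6, 7] [0, 1, 2, 3], Goal 79 [0, 3, 1, 2, 4,
    5, 6, 7] [0, 1, 2, 3], Node (Flip 2 4 5) [Goal 49 [5, 1, 2, 3, 4, 0, 6, 7] [2, 0, 1, 3], Node (Cycle 1 [4,
    5, 0]) []], Goal 80 [0, 1, 2, 3, 4, 5, 6, 7] [0, 1, 2, 3]]),
  ([(0, 1, 0), (0, 2, 0), (0, 3, 0), (5, 6, 0), (0, 4, 1), (0, 5, 1), (2, 5, 1), (0, 6, 2), (2, 4, 2), (4, 5,
    2), (0, 7, 3), (1, 5, 3), (3, 5, 3)], Node (Branch 1 3) [Node (Cycle 0 [1, 3, 0]) [], Node (Flip 0 4 5)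
    [Node (Flip 0 5 6) [Goal 49 [0, 1, 2, 3, 6, 4, 5, 7] [0, 1, 2, 3], Goal 49 [0, 1, 2, 3, 5, 4, 6, 7] [0, 1,
    2, 3]], Node (Flip 1 3 5) [Goal 49 [5, 0, 1, 2, 4, 3, 6, 7] [1, 0, 2, 3], Goal 49 [5, 0, 2, 3, 4, 1, 6, 7]
    [1, 0, 2, 3]]], Node (Flip 0 5 6) [Node (Cut 2 [0]) [], Node (Flip 2 4 5) [Node (Flip 1 3 5) [Goal 49 [5,
    0, 1, 2, 4, 3, 6, 7] [2, 0, 1, 3], Goal 49 [5, 0, 2, 3, 4, 1, 6, 7] [2, 0, 1, 3]], Node (Flip 0 5 6) [Goal
    49 [0, 1, 2, 3, 6, 4, 5, 7] [0, 1, 2, 3], Node (Cycle 1 [4, 5, 0]) [], Node (Cycle 1 [4, 5, 0]) [], Goal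
    49 [0, 1, 2, 3, 5, 4, 6, 7] [0, 1, 2, 3], Node (Cut 2 [0]) []]], Goal 49 [0, 1, 2, 3, 6, 4, 5, 7] [0, 1,
    2, 3], Node (Cut 2 [0]) [], Goal 49 [0, 1, 2, 3, 5, 4, 6, 7] [0, 1, 2, 3]], Node (Cycle 3 [3, 5, 1]) []]),
  ([(0, 1, 0), (0, 2, 0), (0, 3, 0), (0, 4, 1), (0, 5, 1), (2, 5, 1), (0, 6, 2), (2, 4, 2), (4, 5, 2), (0, 7,
    3), (1, 5, 3), (3, 5, 3)], Node (Branch 5 6) [Goal 82 [0, 1, 2, 3, 4, 5, 6, 7] [0, 1, 2, 3], Node (Flip 0
    4 5) [Node (Cut 0 [5]) [Node (Flip 0 5 7) [Node (Cut 0 [5]) [], Node (Cut 2 [5]) [], Node (Cut 0 [5]) [],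
    Node (Cut 2 [5]) [], Goal 49 [0, 1, 2, 3, 5, 4, 6, 7] [0, 1, 2, 3]]], Goal 49 [5, 0, 2, 4, 6, 1, 3, 7] [1,
    0, 2, 3]], Node (Flip 2 4 5) [Node (Cut 0 [5]) [Node (Flip 0 5 7) [Node (Cut 0 [5]) [], Node (Cut 1 [5])
    [], Node (Cut 0 [5]) [], Node (Cut 1 [5]) [], Goal 49 [0, 1, 2, 3, 5, 4, 6, 7] [0, 1, 2, 3]]], Node (Cycle
    1 [4, 5, 0]) []], Node (Flip 2 4 5) [Node (Cut 0 [5]) [Node (Flip 0 5 7) [Node (Cut 0 [5]) [], Node (Cut 1
    [5]) [], Node (Cut 0 [5]) [], Node (Cut 1 [5]) [], Goal 49 [0, 1, 2, 3, 5, 4, 6, 7] [0, 1, 2, 3]]], Node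
    (Cycle 1 [4, 5, 0]) []]]),
  ([(0, 1, 0), (0, 2, 0), (0, 3, 0), (0, 4, 1), (0, 5, 1), (2, 5, 1), (0, 6, 2), (2, 4, 2), (4, 5, 2), (0, 7,
    3), (3, 5, 3)], Node (Branch 1 5) [Goal 77 [0, 2, 1, 3, 4, 5, 6, 7] [0, 1, 2, 3], Goal 79 [0, 3, 1, 2, 4,
    5, 6, 7] [0, 1, 2, 3], Goal 80 [0, 3, 2, 1, 4, 5, 6, 7] [0, 1, 2, 3], Goal 83 [0, 1, 2, 3, 4, 5, 6, 7] [0,
    1, 2, 3]]),
  ([(0, 1, 0), (0, 2, 0), (0, 3, 0), (0, 4, 1), (0, 5, 1), (2, 5, 1), (0, 6, 2), (2, 4, 2), (4, 5, 2), (0, 7,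
    3)], Node (Branch 3 5) [Goal 77 [0, 1, 3, 2, 4, 5, 6, 7] [0, 1, 2, 3], Goal 79 [0, 1, 2, 3, 4, 5, 6, 7]
    [0, 1, 2, 3], Goal 81 [0, 1, 2, 3, 4, 5, 6, 7] [0, 1, 2, 3], Goal 84 [0, 1, 2, 3, 4, 5, 6, 7] [0, 1, 2,
    3]]),
  ([(0, 1, 0), (0, 2, 0), (0, 3, 0), (0, 4, 1), (0, 5, 1), (2, 5, 1), (0, 6, 2), (1, 5, 2), (3, 5, 2), (4, 5,
    2), (0, 7, 3), (2, 4, 3), (3, 4, 3)], Node (Branch 1 4) [Goal 54 [0, 2, 1, 3, 5, 4, 6, 7] [0, 1, 2, 3],
    Goal 83 [0, 2, 1, 3, 5, 4, 6, 7] [0, 1, 2, 3], Node (Cycle 2 [4, 5, 1]) [], Node (Flip 0 4 5) [Node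
    (Branch 1 3) [Node (Cycle 0 [1, 3, 0]) [], Node (Flip 0 1 3) [Node (Branch 2 3) [Node (Cycle 0 [1, 3, 2,
    0]) [], Node (Cycle 1 [3, 2, 5, 4, 0]) [], Node (Flip 2 3 5) [Goal 49 [5, 0, 1, 2, 3, 4, 6, 7] [2, 0, 1,
    3], Node (Cycle 1 [3, 5, 4, 0]) []], Node (Cycle 3 [3, 4, 2]) []], Node (Branch 1 2) [Node (Cycle 0 [2, 1,
    3, 0]) [], Node (Cycle 1 [1, 2, 5, 4, 0]) [], Node (Flip 1 2 5) [Node (Cycle 1 [1, 5, 4, 0]) [], Goal 49
    [5, 0, 1, 2, 3, 4, 6, 7] [2, 0, 1, 3]], Node (Cycle 3 [2, 4, 1]) []]], Node (Cycle 2 [3, 5, 1]) [], Node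
    (Cycle 3 [3, 4, 1]) []], Node (Branch 1 3) [Node (Cycle 0 [1, 3, 0]) [], Node (Flip 1 3 5) [Goal 49 [5, 0,
    1, 2, 4, 3, 6, 7] [1, 0, 2, 3], Goal 49 [5, 0, 2, 3, 4, 1, 6, 7] [1, 0, 2, 3]], Node (Cycle 2 [3, 5, 1])
    [], Node (Cycle 3 [3, 4, 1]) []]]]),
  ([(0, 1, 0), (0, 2, 0), (0, 3, 0), (0, 4, 1), (0, 5, 1), (2, 5, 1), (0, 6, 2), (3, 5, 2), (4, 5, 2), (0, 7,
    3), (1, 5, 3), (2, 4, 3), (3, 4, 3)], Node (Branch 5 7) [Node (Flip 3 4 5) [Node (Flip 2 4 5) [Node (Cycle
    1 [4, 5, 0]) [], Node (Flip 0 5 7) [Node (Cut 3 [0]) [], Goal 49 [5, 0, 1, 2, 3, 4, 6, 7] [3, 0, 1, 2],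
    Goal 49 [0, 1, 2, 3, 7, 4, 5, 6] [0, 1, 2, 3], Node (Cut 3 [0]) [], Goal 49 [0, 1, 2, 3, 5, 4, 6, 7] [0,
    1, 2, 3]], Node (Flip 0 5 7) [Node (Cut 3 [0]) [], Goal 49 [5, 0, 1, 3, 4, 2, 6, 7] [3, 0, 1, 2], Goal 49
    [0, 1, 2, 3, 7, 4, 5, 6] [0, 1, 2, 3], Node (Cut 3 [0]) [], Goal 49 [0, 1, 2, 3, 5, 4, 6, 7] [0, 1, 2,
    3]], Node (Cycle 1 [4, 5, 0]) [], Node (Flip 0 5 7) [Node (Cut 3 [0]) [], Goal 49 [5, 0, 1, 3, 4, 2, 6, 7]
    [3, 0, 1, 2], Goal 49 [0, 1, 2, 3, 7, 4, 5, 6] [0, 1, 2, 3], Node (Cut 3 [0]) [], Goal 49 [0, 1, 2, 3, 5,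
    4, 6, 7] [0, 1, 2, 3]]], Node (Flip 2 4 5) [Node (Flip 0 5 7) [Node (Cut 3 [0]) [], Goal 49 [5, 0, 1, 2,
    4, 3, 6, 7] [3, 0, 1, 2], Goal 49 [0, 1, 2, 3, 7, 4, 5, 6] [0, 1, 2, 3], Node (Cut 3 [0]) [], Goal 49 [0,
    1, 2, 3, 5, 4, 6, 7] [0, 1, 2, 3]], Node (Cycle 1 [4, 5, 0]) []]], Node (Cut 0 [5]) [Goal 73 [5, 2, 0, 7,
    3, 4, 1, 6] [1, 2, 3, 0]], Node (Cut 0 [5]) [Node (Flip 0 5 6) [Node (Cut 0 [5]) [], Goal 49 [5, 0, 3, 4,
    7, 1, 2, 6] [2, 0, 1, 3], Node (Cut 0 [5]) [], Node (Cut 2 [0]) [], Goal 49 [0, 1, 2, 3, 5, 4, 6, 7] [0,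
    1, 2, 3]]], Node (Flip 3 4 5) [Node (Flip 2 4 5) [Node (Cycle 1 [4, 5, 0]) [], Goal 49 [5, 1, 2, 3, 7, 0,
    4, 6] [3, 0, 1, 2], Goal 49 [5, 1, 3, 4, 7, 0, 2, 6] [3, 0, 1, 2], Node (Cycle 1 [4, 5, 0]) [], Goal 49
    [5, 1, 3, 4, 7, 0, 2, 6] [3, 0, 1, 2]], Node (Flip 2 4 5) [Goal 49 [5, 1, 2, 4, 7, 0, 3, 6] [3, 0, 1, 2],
    Node (Cycle 1 [4, 5, 0]) []]]]),
  ([(0, 1, 0), (0, 2, 0), (0, 3, 0), (0, 4, 1), (0, 5, 1), (2, 5, 1), (0, 6, 2), (3, 5, 2), (4, 5, 2), (0, 7,
    3), (2, 4, 3), (3, 4, 3)], Node (Branch 1 5) [Goal 77 [0, 2, 1, 3, 4, 5, 6, 7] [0, 1, 2, 3], Goal 79 [0,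
    3, 1, 2, 4, 5, 6, 7] [0, 1, 2, 3], Goal 86 [0, 1, 2, 3, 4, 5, 6, 7] [0, 1, 2, 3], Goal 87 [0, 1, 2, 3, 4,
    5, 6, 7] [0, 1, 2, 3]]),
  ([(0, 1, 0), (0, 2, 0), (0, 3, 0), (0, 4, 1), (0, 5, 1), (2, 5, 1), (0, 6, 2), (3, 5, 2), (4, 5, 2), (0, 7,
    3), (2, 4, 3)], Node (Branch 3 4) [Goal 54 [0, 1, 3, 2, 5, 4, 6, 7] [0, 1, 2, 3], Goal 84 [0, 1, 3, 2, 5,
    4, 6, 7] [0, 1, 2, 3], Node (Cycle 2 [4, 5, 3]) [], Goal 88 [0, 1, 2, 3, 4, 5, 6, 7] [0, 1, 2, 3]]),
  ([(0, 1, 0), (0, 2, 0), (0, 3, 0), (0, 4, 1), (0, 5, 1), (2, 5, 1), (0, 6, 2), (4, 5, 2), (0, 7, 3), (1, 5,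
    3), (2, 4, 3), (3, 5, 3)], Node (Branch 5 6) [Node (Flip 0 4 5) [Node (Flip 0 5 6) [Goal 49 [0, 1, 2, 3,
    6, 4, 5, 7] [0, 1, 2, 3], Goal 49 [0, 1, 2, 3, 5, 4, 6, 7] [0, 1, 2, 3]], Node (Flip 2 4 5) [Node (Cut 2
    [5]) [Node (Flip 0 5 7) [Node (Cut 2 [5]) [], Goal 49 [5, 0, 1, 2, 3, 4, 6, 7] [3, 0, 1, 2], Node (Cut 1
    [0]) [], Node (Cut 3 [0]) [], Node (Cut 1 [0]) []]], Node (Cut 2 [5]) [Node (Flip 0 5 7) [Node (Cut 2 [5])
    [], Goal 49 [5, 0, 1, 3, 4, 2, 6, 7] [3, 0, 1, 2], Node (Cut 1 [0]) [], Node (Cut 3 [0]) [], Node (Cut 1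
    [0]) []]]]], Node (Flip 0 4 5) [Node (Cut 0 [5]) [Node (Flip 0 5 7) [Node (Cut 0 [5]) [], Node (Cut 2 [5])
    [], Node (Cut 0 [5]) [], Node (Cut 2 [5]) [], Goal 49 [0, 1, 2, 3, 5, 4, 6, 7] [0, 1, 2, 3]]], Goal 49 [5,
    0, 2, 4, 6, 1, 3, 7] [1, 0, 2, 3]], Node (Flip 2 4 5) [Node (Cycle 1 [4, 5, 0]) [], Node (Cut 0 [5]) [Node
    (Flip 0 5 7) [Node (Cut 0 [5]) [], Node (Cut 1 [5]) [], Node (Cut 0 [5]) [], Node (Cut 1 [5]) [], Goal 49
    [0, 1, 2, 3, 5, 4, 6, 7] [0, 1, 2, 3]]], Node (Cut 0 [5]) [Node (Flip 0 5 7) [Node (Cut 0 [5]) [], Node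
    (Cut 1 [5]) [], Node (Cut 0 [5]) [], Node (Cut 1 [5]) [], Goal 49 [0, 1, 2, 3, 5, 4, 6, 7] [0, 1, 2, 3]]],
    Node (Cycle 1 [4, 5, 0]) [], Node (Cut 0 [5]) [Node (Flip 0 5 7) [Node (Cut 0 [5]) [], Goal 49 [5, 0, 1,
    3, 4, 2, 6, 7] [3, 0, 1, 2], Node (Cut 0 [5]) [], Node (Cut 3 [0]) [], Goal 49 [0, 1, 2, 3, 5, 4, 6, 7]
    [0, 1, 2, 3]]]], Node (Flip 2 4 5) [Node (Cycle 1 [4, 5, 0]) [], Goal 49 [5, 1, 2, 3, 6, 0, 4, 7] [3, 0,
    1, 2], Goal 49 [5, 1, 3, 4, 6, 0, 2, 7] [3, 0, 1, 2], Node (Cycle 1 [4, 5, 0]) [], Goal 49 [5, 1, 3, 4, 6,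
    0, 2, 7] [3, 0, 1, 2]]]),
  ([(0, 1, 0), (0, 2, 0), (0, 3, 0), (0, 4, 1), (0, 5, 1), (2, 5, 1), (0, 6, 2), (4, 5, 2), (0, 7, 3), (2, 4,
    3), (3, 5, 3)], Node (Branch 1 5) [Goal 77 [0, 2, 1, 3, 4, 5, 6, 7] [0, 1, 2, 3], Goal 79 [0, 3, 1, 2, 4,
    5, 6, 7] [0, 1, 2, 3], Goal 89 [0, 3, 2, 1, 4, 5, 6, 7] [0, 1, 2, 3], Goal 90 [0, 1, 2, 3, 4, 5, 6, 7] [0,
    1, 2, 3]]),
  ([(0, 1, 0), (0, 2, 0), (0, 3, 0), (0, 4, 1), (0, 5, 1), (2, 5, 1), (0, 6, 2), (4, 5, 2), (0, 7, 3), (2, 4,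
    3)], Node (Branch 3 5) [Goal 77 [0, 1, 3, 2, 4, 5, 6, 7] [0, 1, 2, 3], Goal 79 [0, 1, 2, 3, 4, 5, 6, 7]
    [0, 1, 2, 3], Goal 89 [0, 1, 2, 3, 4, 5, 6, 7] [0, 1, 2, 3], Goal 91 [0, 1, 2, 3, 4, 5, 6, 7] [0, 1, 2,
    3]]),
  ([(0, 1, 0), (0, 2, 0), (0, 3, 0), (0, 4, 1), (0, 5, 1), (2, 5, 1), (0, 6, 2), (4, 5, 2), (0, 7, 3)], Node
    (Branch 2 4) [Goal 77 [0, 1, 2, 3, 5, 4, 6, 7] [0, 1, 2, 3], Node (Cycle 1 [4, 2, 5, 0]) [], Goal 85 [0,
    1, 2, 3, 4, 5, 6, 7] [0, 1, 2, 3], Goal 92 [0, 1, 2, 3, 4, 5, 6, 7] [0, 1, 2, 3]]),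
  ([(0, 1, 0), (0, 2, 0), (0, 3, 0), (0, 4, 1), (0, 5, 1), (0, 6, 2), (2, 5, 2), (3, 5, 2), (4, 5, 2), (0, 7,
    3), (5, 6, 3)], Node (Branch 1 5) [Goal 77 [0, 2, 1, 3, 4, 5, 6, 7] [0, 1, 2, 3], Goal 93 [0, 2, 1, 3, 4,
    5, 6, 7] [0, 1, 2, 3], Goal 49 [5, 1, 2, 3, 4, 0, 6, 7] [2, 0, 1, 3], Node (Flip 0 5 6) [Node (Cut 2 [0])
    [], Goal 49 [5, 0, 2, 3, 4, 1, 6, 7] [2, 0, 1, 3], Goal 49 [5, 0, 2, 3, 4, 1, 6, 7] [2, 0, 1, 3], Node
    (Cut 2 [0]) [], Node (Cut 0 [5]) [Node (Flip 0 5 7) [Node (Cut 0 [5]) [], Goal 49 [0, 1, 2, 3, 5, 4, 6, 7]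
    [0, 1, 2, 3]]]]]),
  ([(0, 1, 0), (0, 2, 0), (0, 3, 0), (0, 4, 1), (0, 5, 1), (0, 6, 2), (2, 5, 2), (3, 5, 2), (4, 5, 2), (0, 7,
    3)], Node (Branch 5 6) [Node (Flip 0 5 6) [Node (Cut 2 [0]) [], Goal 49 [5, 0, 2, 3, 4, 1, 6, 7] [2, 0, 1,
    3], Goal 49 [0, 1, 2, 3, 6, 4, 5, 7] [0, 1, 2, 3], Node (Cut 2 [0]) [], Goal 49 [0, 1, 2, 3, 5, 4, 6, 7]
    [0, 1, 2, 3]], Node (Flip 0 5 6) [Goal 49 [5, 0, 2, 3, 4, 1, 6, 7] [2, 0, 1, 3], Node (Cut 2 [0]) []],
    Goal 49 [5, 2, 3, 4, 6, 0, 1, 7] [2, 0, 1, 3], Goal 94 [0, 1, 2, 3, 4, 5, 6, 7] [0, 1, 2, 3]]),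
  ([(0, 1, 0), (0, 2, 0), (0, 3, 0), (0, 4, 1), (0, 5, 1), (0, 6, 2), (2, 5, 2), (4, 5, 2), (0, 7, 3), (1, 5,
    3), (2, 4, 3), (3, 5, 3)], Node (Branch 5 6) [Node (Flip 0 4 5) [Node (Flip 0 5 6) [Goal 49 [0, 1, 2, 3,
    6, 4, 5, 7] [0, 1, 2, 3], Goal 49 [0, 1, 2, 3, 5, 4, 6, 7] [0, 1, 2, 3]], Node (Flip 2 4 5) [Node (Flip 0
    5 6) [Goal 49 [0, 1, 2, 3, 6, 4, 5, 7] [0, 1, 2, 3], Node (Cycle 2 [4, 5, 0]) [], Node (Cycle 2 [4, 5, 0])
    [], Goal 49 [0, 1, 2, 3, 5, 4, 6, 7] [0, 1, 2, 3], Node (Cut 1 [0]) []], Node (Cut 2 [5]) [Node (Flip 0 5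
    7) [Node (Cut 2 [5]) [], Goal 49 [5, 0, 1, 2, 3, 4, 6, 7] [3, 0, 1, 2], Node (Cut 1 [0]) [], Node (Cut 3
    [0]) [], Node (Cut 1 [0]) []]], Node (Cut 2 [5]) [Node (Flip 0 5 7) [Node (Cut 2 [5]) [], Goal 49 [5, 0,
    1, 3, 4, 2, 6, 7] [3, 0, 1, 2], Node (Cut 1 [0]) [], Node (Cut 3 [0]) [], Node (Cut 1 [0]) []]], Node
    (Flip 0 5 6) [Goal 49 [0, 1, 2, 3, 6, 4, 5, 7] [0, 1, 2, 3], Node (Cycle 2 [4, 5, 0]) [], Node (Cycle 2
    [4, 5, 0]) [], Goal 49 [0, 1, 2, 3, 5, 4, 6, 7] [0, 1, 2, 3], Node (Cut 1 [0]) []], Node (Cut 1 [0, 5])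
    [Node (Flip 0 5 7) [Goal 49 [5, 0, 1, 3, 4, 2, 6, 7] [3, 0, 1, 2], Node (Cut 3 [0]) []]]]], Node (Flip 2 4
    5) [Node (Cut 0 [5]) [Node (Flip 0 5 7) [Node (Cut 0 [5]) [], Goal 49 [5, 0, 1, 2, 3, 4, 6, 7] [3, 0, 1,
    2], Node (Cut 0 [5]) [], Node (Cut 3 [0]) [], Goal 49 [0, 1, 2, 3, 5, 4, 6, 7] [0, 1, 2, 3]]], Node (Cut 0
    [5]) [Node (Flip 0 5 7) [Node (Cut 0 [5]) [], Goal 49 [5, 0, 1, 3, 4, 2, 6, 7] [3, 0, 1, 2], Node (Cut 0
    [5]) [], Node (Cut 3 [0]) [], Goal 49 [0, 1, 2, 3, 5, 4, 6, 7] [0, 1, 2, 3]]]], Node (Flip 2 4 5) [Node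
    (Cut 0 [5]) [Node (Flip 0 5 7) [Node (Cut 0 [5]) [], Node (Cut 1 [5]) [], Node (Cut 0 [5]) [], Node (Cut 1
    [5]) [], Goal 49 [0, 1, 2, 3, 5, 4, 6, 7] [0, 1, 2, 3]]], Node (Cut 0 [5]) [Node (Flip 0 5 7) [Node (Cut 0
    [5]) [], Node (Cut 1 [5]) [], Node (Cut 0 [5]) [], Node (Cut 1 [5]) [], Goal 49 [0, 1, 2, 3, 5, 4, 6, 7]
    [0, 1, 2, 3]]]], Node (Flip 2 4 5) [Goal 49 [5, 1, 2, 3, 6, 0, 4, 7] [3, 0, 1, 2], Goal 49 [5, 1, 3, 4, 6,
    0, 2, 7] [3, 0, 1, 2]]]),
  ([(0, 1, 0), (0, 2, 0), (0, 3, 0), (0, 4, 1), (0, 5, 1), (0, 6, 2), (2, 5, 2), (4, 5, 2), (0, 7, 3), (2, 4,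
    3), (3, 5, 3)], Node (Branch 1 5) [Goal 77 [0, 2, 1, 3, 4, 5, 6, 7] [0, 1, 2, 3], Goal 93 [0, 2, 1, 3, 4,
    5, 6, 7] [0, 1, 2, 3], Goal 95 [0, 3, 1, 2, 4, 5, 6, 7] [0, 1, 2, 3], Goal 96 [0, 1, 2, 3, 4, 5, 6, 7] [0,
    1, 2, 3]]),
  ([(0, 1, 0), (0, 2, 0), (0, 3, 0), (0, 4, 1), (0, 5, 1), (0, 6, 2), (2, 5, 2), (4, 5, 2), (0, 7, 3), (2, 4,
    3)], Node (Branch 3 5) [Goal 77 [0, 1, 3, 2, 4, 5, 6, 7] [0, 1, 2, 3], Goal 93 [0, 1, 3, 2, 4, 5, 6, 7]
    [0, 1, 2, 3], Goal 95 [0, 1, 2, 3, 4, 5, 6, 7] [0, 1, 2, 3], Goal 97 [0, 1, 2, 3, 4, 5, 6, 7] [0, 1, 2,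
    3]]),
  ([(0, 1, 0), (0, 2, 0), (0, 3, 0), (0, 4, 1), (0, 5, 1), (0, 6, 2), (2, 5, 2), (4, 5, 2), (0, 7, 3)], Node
    (Branch 2 4) [Goal 54 [0, 1, 2, 3, 5, 4, 6, 7] [0, 1, 2, 3], Goal 85 [0, 1, 2, 3, 5, 4, 6, 7] [0, 1, 2,
    3], Node (Cycle 2 [4, 5, 2]) [], Goal 98 [0, 1, 2, 3, 4, 5, 6, 7] [0, 1, 2, 3]]),
  ([(0, 1, 0), (0, 2, 0), (0, 3, 0), (0, 4, 1), (0, 5, 1), (0, 6, 2), (4, 5, 2), (0, 7, 3), (2, 5, 3), (3, 4,
    3), (3, 5, 3)], Node (Branch 2 4) [Goal 75 [0, 3, 2, 1, 5, 4, 6, 7] [0, 1, 2, 3], Goal 91 [0, 1, 2, 3, 5,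
    4, 6, 7] [0, 1, 2, 3], Goal 97 [0, 1, 2, 3, 5, 4, 6, 7] [0, 1, 2, 3], Node (Cycle 3 [4, 3, 5, 2]) []]),
  ([(0, 1, 0), (0, 2, 0), (0, 3, 0), (0, 4, 1), (0, 5, 1), (0, 6, 2), (4, 5, 2), (0, 7, 3), (2, 5, 3), (3, 5,
    3)], Node (Branch 3 4) [Goal 76 [0, 1, 3, 2, 5, 4, 6, 7] [0, 1, 2, 3], Goal 92 [0, 1, 3, 2, 5, 4, 6, 7]
    [0, 1, 2, 3], Goal 98 [0, 1, 3, 2, 5, 4, 6, 7] [0, 1, 2, 3], Goal 100 [0, 1, 2, 3, 4, 5, 6, 7] [0, 1, 2,
    3]]),
  ([(0, 1, 0), (0, 2, 0), (0, 3, 0), (0, 4, 1), (0, 5, 1), (0, 6, 2), (4, 5, 2), (0, 7, 3), (2, 5, 3)], Node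
    (Branch 3 5) [Goal 77 [0, 1, 3, 2, 4, 5, 6, 7] [0, 1, 2, 3], Goal 93 [0, 1, 3, 2, 4, 5, 6, 7] [0, 1, 2,
    3], Goal 99 [0, 1, 3, 2, 4, 5, 6, 7] [0, 1, 2, 3], Goal 101 [0, 1, 2, 3, 4, 5, 6, 7] [0, 1, 2, 3]]),
  ([(0, 1, 0), (0, 2, 0), (0, 3, 0), (0, 4, 1), (0, 5, 1), (0, 6, 2), (4, 5, 2), (0, 7, 3)], Node (Branch 2 5)
    [Goal 77 [0, 1, 2, 3, 4, 5, 6, 7] [0, 1, 2, 3], Goal 93 [0, 1, 2, 3, 4, 5, 6, 7] [0, 1, 2, 3], Goal 99 [0,
    1, 2, 3, 4, 5, 6, 7] [0, 1, 2, 3], Goal 102 [0, 1, 2, 3, 4, 5, 6, 7] [0, 1, 2, 3]]),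
  ([(0, 1, 0), (0, 2, 0), (0, 3, 0), (0, 4, 1), (0, 5, 1), (0, 6, 2), (0, 7, 3)], Node (Branch 4 5) [Node
    (Flip 0 4 5) [Goal 49 [0, 1, 2, 3, 5, 4, 6, 7] [0, 1, 2, 3], Goal 49 [0, 1, 2, 3, 4, 5, 6, 7] [0, 1, 2,
    3]], Node (Cycle 1 [4, 5, 0]) [], Goal 103 [0, 1, 2, 3, 4, 5, 6, 7] [0, 1, 2, 3], Goal 103 [0, 1, 2, 3, 4,
    5, 7, 6] [0, 1, 3, 2]]),
  ([(0, 1, 0), (0, 2, 0), (0, 3, 0), (0, 4, 1), (0, 5, 2), (0, 6, 3)], Node (Branch 0 7) [Goal 49 [0, 1, 2, 3,
    7, 4, 5, 6] [0, 1, 2, 3], Goal 104 [0, 1, 2, 3, 4, 7, 5, 6] [0, 1, 2, 3], Goal 104 [0, 1, 2, 3, 5, 7, 4,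
    6] [0, 2, 1, 3], Goal 104 [0, 1, 2, 3, 6, 7, 4, 5] [0, 3, 1, 2]]),
  ([(0, 1, 0), (0, 2, 0), (0, 3, 0), (0, 4, 1), (0, 5, 2)], Node (Cut 3 [0]) [Goal 105 [0, 1, 2, 3, 4, 5, 6,
    7] [0, 1, 2, 3], Goal 105 [0, 1, 2, 3, 4, 5, 7, 6] [0, 1, 2, 3]]),
  ([(0, 1, 0), (0, 2, 0), (0, 3, 0), (0, 4, 1)], Node (Cut 2 [0]) [Goal 106 [0, 1, 2, 3, 4, 5, 6, 7] [0, 1, 2,
    3], Goal 106 [0, 1, 2, 3, 4, 6, 5, 7] [0, 1, 2, 3], Goal 106 [0, 1, 2, 3, 4, 7, 5, 6] [0, 1, 2, 3]]),
  ([(0, 1, 0), (0, 2, 0), (0, 3, 0)], Node (Cut 1 [0]) [Goal 107 [0, 1, 2, 3, 4, 5, 6, 7] [0, 1, 2, 3], Goal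
    107 [0, 1, 2, 3, 5, 4, 6, 7] [0, 1, 2, 3], Goal 107 [0, 1, 2, 3, 6, 4, 5, 7] [0, 1, 2, 3], Goal 107 [0, 1,
    2, 3, 7, 4, 5, 6] [0, 1, 2, 3]]),
  ([(0, 1, 0), (0, 2, 0), (0, 3, 1), (0, 4, 1), (0, 5, 2), (0, 6, 2), (0, 7, 3), (1, 2, 3)], Node (Branch 3 4)
    [Node (Flip 0 3 4) [Goal 108 [0, 1, 2, 4, 3, 5, 6, 7] [0, 1, 2, 3], Goal 108 [0, 1, 2, 3, 4, 5, 6, 7] [0,
    1, 2, 3]], Node (Cycle 1 [3, 4, 0]) [], Node (Flip 0 3 4) [Goal 108 [0, 4, 5, 6, 1, 2, 3, 7] [2, 0, 1, 3],
    Goal 108 [0, 3, 5, 6, 1, 2, 4, 7] [2, 0, 1, 3]], Node (Flip 0 1 2) [Node (Flip 0 3 4) [Goal 108 [0, 2, 4,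
    7, 1, 3, 5, 6] [3, 0, 1, 2], Goal 108 [0, 2, 3, 7, 1, 4, 5, 6] [3, 0, 1, 2]], Node (Flip 0 3 4) [Goal 108
    [0, 1, 4, 7, 2, 3, 5, 6] [3, 0, 1, 2], Goal 108 [0, 1, 3, 7, 2, 4, 5, 6] [3, 0, 1, 2]]]]),
  ([(0, 1, 0), (0, 2, 0), (0, 3, 1), (0, 4, 1), (0, 5, 2), (0, 6, 2), (0, 7, 3)], Node (Branch 1 2) [Node
    (Cycle 0 [1, 2, 0]) [], Node (Flip 0 1 2) [Goal 108 [0, 2, 3, 4, 1, 5, 6, 7] [1, 0, 2, 3], Goal 108 [0, 1,
    3, 4, 2, 5, 6, 7] [1, 0, 2, 3]], Node (Flip 0 1 2) [Goal 108 [0, 2, 5, 6, 1, 3, 4, 7] [2, 0, 1, 3], Goal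
    108 [0, 1, 5, 6, 2, 3, 4, 7] [2, 0, 1, 3]], Goal 109 [0, 1, 2, 3, 4, 5, 6, 7] [0, 1, 2, 3]]),
  ([(0, 1, 0), (0, 2, 0), (0, 3, 1), (0, 4, 1), (0, 5, 2), (0, 6, 3)], Node (Branch 0 7) [Goal 108 [0, 1, 2,
    7, 3, 4, 5, 6] [0, 1, 2, 3], Goal 108 [0, 3, 4, 7, 1, 2, 5, 6] [1, 0, 2, 3], Goal 110 [0, 1, 2, 3, 4, 5,
    7, 6] [0, 1, 2, 3], Goal 110 [0, 1, 2, 3, 4, 6, 7, 5] [0, 1, 3, 2]]),
  ([(0, 1, 0), (0, 2, 0), (0, 3, 1), (0, 4, 2), (0, 5, 3)], Node (Branch 0 6) [Goal 108 [0, 1, 2, 6, 3, 4, 5,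
    7] [0, 1, 2, 3], Goal 111 [0, 1, 2, 3, 6, 4, 5, 7] [0, 1, 2, 3], Goal 111 [0, 1, 2, 4, 6, 3, 5, 7] [0, 2,
    1, 3], Goal 111 [0, 1, 2, 5, 6, 3, 4, 7] [0, 3, 1, 2]]),
  ([(0, 1, 0), (0, 2, 1), (0, 3, 2), (0, 4, 3)], Node (Branch 0 5) [Goal 112 [0, 1, 5, 2, 3, 4, 6, 7] [0, 1,
    2, 3], Goal 112 [0, 2, 5, 1, 3, 4, 6, 7] [1, 0, 2, 3], Goal 112 [0, 3, 5, 1, 2, 4, 6, 7] [2, 0, 1, 3],
    Goal 112 [0, 4, 5, 1, 2, 3, 6, 7] [3, 0, 1, 2]]),
  ([(0, 1, 0), (0, 2, 1), (0, 3, 2)], Node (Cut 3 [0]) [Goal 113 [0, 1, 2, 3, 4, 5, 6, 7] [0, 1, 2, 3], Goal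
    113 [0, 1, 2, 3, 5, 4, 6, 7] [0, 1, 2, 3], Goal 113 [0, 1, 2, 3, 6, 4, 5, 7] [0, 1, 2, 3], Goal 113 [0, 1,
    2, 3, 7, 4, 5, 6] [0, 1, 2, 3]]),
  ([(0, 1, 0), (0, 2, 1)], Node (Cut 2 [0]) [Goal 114 [0, 1, 2, 3, 4, 5, 6, 7] [0, 1, 2, 3], Goal 114 [0, 1,
    2, 4, 3, 5, 6, 7] [0, 1, 2, 3], Goal 114 [0, 1, 2, 5, 3, 4, 6, 7] [0, 1, 2, 3], Goal 114 [0, 1, 2, 6, 3,
    4, 5, 7] [0, 1, 2, 3], Goal 114 [0, 1, 2, 7, 3, 4, 5, 6] [0, 1, 2, 3]]),
  ([(0, 1, 0)], Node (Cut 1 [0]) [Goal 115 [0, 1, 2, 3, 4, 5, 6, 7] [0, 1, 2, 3], Goal 115 [0, 1, 3, 2, 4, 5,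
    6, 7] [0, 1, 2, 3], Goal 115 [0, 1, 4, 2, 3, 5, 6, 7] [0, 1, 2, 3], Goal 115 [0, 1, 5, 2, 3, 4, 6, 7] [0,
    1, 2, 3], Goal 115 [0, 1, 6, 2, 3, 4, 5, 7] [0, 1, 2, 3], Goal 115 [0, 1, 7, 2, 3, 4, 5, 6] [0, 1, 2, 3]]),
  ([], Node (Cut 0 [0]) [Goal 116 [0, 1, 2, 3, 4, 5, 6, 7] [0, 1, 2, 3], Goal 116 [0, 2, 1, 3, 4, 5, 6, 7] [0,
    1, 2, 3], Goal 116 [0, 3, 1, 2, 4, 5, 6, 7] [0, 1, 2, 3], Goal 116 [0, 4, 1, 2, 3, 5, 6, 7] [0, 1, 2, 3],
    Goal 116 [0, 5, 1, 2, 3, 4, 6, 7] [0, 1, 2, 3], Goal 116 [0, 6, 1, 2, 3, 4, 5, 7] [0, 1, 2, 3], Goal 116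
    [0, 7, 1, 2, 3, 4, 5, 6] [0, 1, 2, 3]])]"

text \<open>The empty list of facts is the opening position of the game. Its presence among the
  settled entries is what turns the strategy into a statement about all cycle-free
  partitions.\<close>

lemma twin_star_strategy_valid:
  "check_all 4 [twin_star_facts] twin_star_strategy \<and> [] \<in> set (map fst twin_star_strategy)"
  by code_simp

theorem proposition4p1:
  shows "\<forall>P \<in> cf_partitions 4. \<exists>\<Gamma> \<in> cf_partitions 4.
    weakly_equivalent 4 P \<Gamma> \<and> (\<exists>i\<in>{1..4}. isomorphic_graphs 8 (\<Gamma> i) twin_star_4)"
proof
  fix P assume P: "P \<in> cf_partitions 4"
  have "\<forall>K\<in>fst ` set twin_star_strategy. reaches 4 twin_star_facts K"
    using check_all_sound[OF conjunct1[OF twin_star_strategy_valid]] reaches_self by simp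
  then have "reaches 4 twin_star_facts []"
    using twin_star_strategy_valid by (simp only: set_map)
  \<comment> \<open>Nothing is recorded at the start, so any two bijections serve;
    \<open>Suc\<close> merely shifts the numbering from 0 to 1.\<close>
  moreover have "realizes 4 Suc Suc [] P"
    using bij_betw_Suc_lessThan by (simp add: realizes_def)
  ultimately obtain Q \<phi> \<kappa> where "Q \<in> cf_partitions 4" "weakly_equivalent 4 P Q"
      "realizes 4 \<phi> \<kappa> twin_star_facts Q"
    using P unfolding reaches_def by blast
  then show "\<exists>\<Gamma> \<in> cf_partitions 4. weakly_equivalent 4 P \<Gamma> \<and>
      (\<exists>i\<in>{1..4}. isomorphic_graphs 8 (\<Gamma> i) twin_star_4)"
    using realizes_twin_star by blast
qed

end
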